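(* Consider the system $\dot x=f(x)+g(x)u$, $y=h(x)$ on the open set $U\subset\mathbb R^n$. Suppose that the system is regular and that the Jacobian $d\bar\Phi_{\rm d}(x)$ has full row rank for every $x\in U$ (Assumption $\mathcal B$). Suppose moreover (Assumption $\mathcal C$) that there exists a smooth $\Gamma_{\rm ie}:U\to\mathbb R^{(m-m_{\rm d})\times m}$ such that $\Gamma_{\rm i}(x)=\mathrm{col}\{\Gamma_{\rm ie}(x),L_g\Omega_{k^\star}(x)\}$ is nonsingular and the distribution spanned by the column vectors of $$g_{\rm d}(x)=g(x)\Gamma_{\rm i}^{-1}(x)\begin{bmatrix}0\\ I_{m_{\rm d}}\end{bmatrix}$$ is involutive. Then there exists a set of coordinates in $U$ (a diffeomorphic state transformation $\mathrm{col}\{\eta,\xi\}=\Phi(x)$ on $U$, a smooth nonsingular input transformation $\mathrm{col}\{u_{\rm e},u_{\rm d}\}=\Gamma_{\rm i}(x)u$ and a constant nonsingular output transformation $\mathrm{col}\{y_{\rm e},y_{\rm d}\}=\Gamma_{\rm o}y$) such that the system takes the form $$\begin{aligned} \dot\eta&=f_{\rm e}(x)+g_{\rm e}(x)u_{\rm e}+\sum_{l=1}^{m_{\rm d}}\varphi_l(x)v_{{\rm d},l},\\ \dot\xi_{i,j}&=\xi_{i,j+1}+\sum_{l=1}^{i-1}\delta_{i,j,l}(x)v_{{\rm d},l},\quad j=1,\dots,q_i-1,\\ \dot\xi_{i,q_i}&=v_{{\rm d},i},\\ y_{\rm e}&=h_{\rm e}(x),\qquad y_{{\rm d},i}=\xi_{i,1},\qquad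 i=1,\dots,m_{\rm d}, \end{aligned}$$ with $$\varphi_l(x)=0,\qquad l=1,\dots,m_{\rm d}.$$ Here $q=\{q_1\le\dots\le q_{m_{\rm d}}\}$ are the integers obtained in the infinite zero structure algorithm, $\eta\in\mathbb R^{n-n_{\rm d}}$, $\xi=\mathrm{col}\{\xi_{i,j}: 1\le j\le q_i,\ 1\le i\le m_{\rm d}\}$, $u_{\rm e}\in\mathbb R^{m-m_{\rm d}}$, $y_{\rm d}\in\mathbb R^{m_{\rm d}}$, the coefficient functions are smooth, $v_{{\rm d},i}=a_i(x)+b_i(x)u$ with $\mathrm{col}\{b_1(x),\dots,b_{m_{\rm d}}(x)\}$ of full row rank for $x\in U$, and $\delta_{i,j,l}(x)=0$ for $j<q_l$, $i=1,\dots,m_{\rm d}$.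
   Context: System: $\dot x=f(x)+g(x)u$, $y=h(x)$, with $x\in\mathbb R^n$, $u\in\mathbb R^m$, $y\in\mathbb R^p$; $f,g,h$ are smooth on an open set $U\subset\mathbb R^n$ containing $0$, with $f(0)=0$, $h(0)=0$. For a smooth vector-valued $\Theta$, $d\Theta=\partial\Theta/\partial x$, $L_f\Theta=d\Theta\, f$, $L_g\Theta=d\Theta\, g$. $\mathrm{col}\{\cdot\}$ denotes vertical stacking. Matrices with zero rows are allowed (empty). Infinite zero structure algorithm. Initial step: $\Theta_0=h$, $\Omega_0=\emptyset$, $\rho_0=0$, $k=1$. Step $k$: given $\Theta_{k-1}:U\to\mathbb R^{p-\rho_{k-1}}$ and $\Omega_{k-1}:U\to\mathbb R^{\rho_{k-1}}$ with $L_g\Omega_{k-1}(x)$ of full row rank. Assumption $\mathcal A_k$: $\mathrm{col}\{L_g\Omega_{k-1}(x),L_g\Theta_{k-1}(x)\}$ has constant rank $\rho_k$ for $x\in U$, and there is a constant matrix $R_k\in\mathbb R^{(\rho_k-\rho_{k-1})\times(p-\rho_{k-1})}$ such that $\mathrm{col}\{L_g\Omega_{k-1}(x),L_gR_k\Theta_{k-1}(x)\}$ has full row rank $\rho_k$ for $x\in U$. Choose a constant $S_k\in\mathbb R^{(p-\rho_k)\times(p-\rho_{k-1})}$ with $\mathrm{col}\{R_k,S_k\}$ nonsingular, and set $\Omega_k=\mathrm{col}\{R_1\Theta_0,R_2\Theta_1,\dots,R_k\Theta_{k-1}\}$. There are unique smooth matrix functions $P_{k,l}:U\to\mathbb R^{(p-\rho_k)\times(\rho_l-\rho_{l-1})}$,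 $l=1,\dots,k$, with $L_gS_k\Theta_{k-1}=\sum_{l=1}^kP_{k,l}L_gR_l\Theta_{l-1}$. Set $\Theta_k=L_fS_k\Theta_{k-1}-\sum_{l=1}^kP_{k,l}L_fR_l\Theta_{l-1}$. If $k+\sum_{j=1}^kj(\rho_j-\rho_{j-1})<n$ and $\rho_k<\min\{p,m\}$, increase $k$ by one and repeat; otherwise stop with $k^\star=k$. Put $m_{\rm d}=\rho_{k^\star}$, $n_{\rm d}=\sum_{j=1}^{k^\star}j(\rho_j-\rho_{j-1})$, and let $q=\{q_1\le\dots\le q_{m_{\rm d}}\}$ be the list in which each integer $j\in\{1,\dots,k^\star\}$ occurs $\rho_j-\rho_{j-1}$ times. The system is called regular if Assumptions $\mathcal A_k$, $k=1,\dots,k^\star$, are satisfied. Further notation: $S_{i\leftrightarrow j}=S_iS_{i-1}\cdots S_j$ (identity if $j>i$); $\zeta_{i,j}=R_iS_{i-1\leftrightarrow j}\Theta_{j-1}(x)$ for $1\le j\le i\le k^\star$; $\zeta_i=\mathrm{col}\{\zeta_{i,1},\dots,\zeta_{i,i}\}$; $\bar\Phi_{\rm d}(x)=\mathrm{col}\{\zeta_1,\dots,\zeta_{k^\star}\}\in\mathbb R^{n_{\rm d}}$. A distribution is involutive if it is closed under Lie brackets of vector fields in it.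
   Formalization: A single diffeomorphism Φ on all of U need not exist (e.g. w↦w² on an annulus), so η, f_e, g_e, φ_l and the diffeomorphism property are obtained on a neighbourhood of each point of U; ξ, Γ_i, Γ_o, h_e, v_d and δ remain on all of U. *)

theory Defs
  imports
    "HOL-Analysis.Analysis"
    "Jordan_Normal_Form.DL_Rank"
    "Jordan_Normal_Form.Gauss_Jordan_Elimination"
begin

unbundle no vec_syntax

text \<open>
  States are points of \<open>real ^ 'n\<close>, so that calculus on the open set \<open>U\<close> is that of the
  library. All values (vector fields, outputs, matrix functions) are vectors and matrices with
  natural-number dimensions, because the dimensions produced by the algorithm depend on the
  system. Sizes may be zero. Functions matter only on \<open>U\<close>.

  The coordinates of the state space are numbered \<open>0, ..., n - 1\<close> through the library's
  enumeration \<open>from_nat_into UNIV\<close> of the index type, which is a bijection from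
  \<open>{..<CARD('n)}\<close>.
\<close>

primrec k_times_differentiable_on ::
    "nat \<Rightarrow> 'a::real_normed_vector set \<Rightarrow> ('a \<Rightarrow> 'b::real_normed_vector) \<Rightarrow> bool" where
  "k_times_differentiable_on 0 U \<theta> \<longleftrightarrow> continuous_on U \<theta>"
| "k_times_differentiable_on (Suc k) U \<theta> \<longleftrightarrow>
     (\<forall>x\<in>U. \<theta> differentiable (at x)) \<and>
     (\<forall>v. k_times_differentiable_on k U (\<lambda>x. frechet_derivative \<theta> (at x) v))"

text \<open>Meant for open \<open>U\<close> only, since the derivatives are two-sided.\<close>

definition smooth_on :: "'a::real_normed_vector set \<Rightarrow> ('a \<Rightarrow> 'b::real_normed_vector) \<Rightarrow> bool" where
  "smooth_on U \<theta> \<longleftrightarrow> (\<forall>k. k_times_differentiable_on k U \<theta>)"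

definition smooth_vec :: "(real^'n) set \<Rightarrow> nat \<Rightarrow> (real^'n \<Rightarrow> real Matrix.vec) \<Rightarrow> bool" where
  "smooth_vec U d \<Theta> \<longleftrightarrow>
     (\<forall>x\<in>U. \<Theta> x \<in> carrier_vec d) \<and> (\<forall>i<d. smooth_on U (\<lambda>x. \<Theta> x $ i))"

definition smooth_mat :: "(real^'n) set \<Rightarrow> nat \<Rightarrow> nat \<Rightarrow> (real^'n \<Rightarrow> real Matrix.mat) \<Rightarrow> bool" where
  "smooth_mat U r c M \<longleftrightarrow>
     (\<forall>x\<in>U. M x \<in> carrier_mat r c) \<and> (\<forall>i<r. \<forall>j<c. smooth_on U (\<lambda>x. M x $$ (i, j)))"

definition partial_deriv :: "(real^'n \<Rightarrow> real) \<Rightarrow> real^'n \<Rightarrow> nat \<Rightarrow> real" where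
  "partial_deriv \<theta> x j = frechet_derivative \<theta> (at x) (axis (from_nat_into (UNIV :: 'n set) j) 1)"

definition gradient :: "(real^'n \<Rightarrow> real) \<Rightarrow> real^'n \<Rightarrow> real Matrix.vec" where
  "gradient \<theta> x = Matrix.vec CARD('n) (partial_deriv \<theta> x)"

definition jacobian_mat :: "(real^'n \<Rightarrow> real Matrix.vec) \<Rightarrow> real^'n \<Rightarrow> real Matrix.mat" where
  "jacobian_mat \<Theta> x =
     Matrix.mat (dim_vec (\<Theta> x)) CARD('n) (\<lambda>(i, j). partial_deriv (\<lambda>z. \<Theta> z $ i) x j)"

definition lie_vec ::
    "(real^'n \<Rightarrow> real Matrix.vec) \<Rightarrow> (real^'n \<Rightarrow> real Matrix.vec) \<Rightarrow> real^'n \<Rightarrow> real Matrix.vec" where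
  "lie_vec f \<Theta> x = jacobian_mat \<Theta> x *\<^sub>v f x"

definition lie_mat ::
    "(real^'n \<Rightarrow> real Matrix.mat) \<Rightarrow> (real^'n \<Rightarrow> real Matrix.vec) \<Rightarrow> real^'n \<Rightarrow> real Matrix.mat" where
  "lie_mat g \<Theta> x = jacobian_mat \<Theta> x * g x"

definition point_of :: "real Matrix.vec \<Rightarrow> real^'n" where
  "point_of w = vec_lambda (\<lambda>c. w $ to_nat_on (UNIV :: 'n set) c)"

definition diffeomorphic_coordinates ::
    "(real^'n) set \<Rightarrow> (real^'n \<Rightarrow> real Matrix.vec) \<Rightarrow> bool" where
  "diffeomorphic_coordinates V \<Phi> \<longleftrightarrow>
     smooth_vec V CARD('n) \<Phi> \<and>
     (let F = (\<lambda>x. point_of (\<Phi> x) :: real^'n) in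
        open (F ` V) \<and> (\<exists>G. smooth_on (F ` V) G \<and> (\<forall>x\<in>V. G (F x) = x)))"

definition vcol :: "real Matrix.vec list \<Rightarrow> real Matrix.vec" where
  "vcol vs = foldr (@\<^sub>v) vs vNil"

definition mat_sum :: "nat \<Rightarrow> nat \<Rightarrow> ('i \<Rightarrow> real Matrix.mat) \<Rightarrow> 'i set \<Rightarrow> real Matrix.mat" where
  "mat_sum r c F I = Matrix.mat r c (\<lambda>ij. \<Sum>l\<in>I. F l $$ ij)"

definition mat_rank :: "real Matrix.mat \<Rightarrow> nat" where
  "mat_rank A = vec_space.rank (dim_row A) A"

definition full_row_rank :: "real Matrix.mat \<Rightarrow> bool" where
  "full_row_rank A \<longleftrightarrow> mat_rank A = dim_row A"

definition lie_bracket ::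
    "(real^'n \<Rightarrow> real Matrix.vec) \<Rightarrow> (real^'n \<Rightarrow> real Matrix.vec) \<Rightarrow> real^'n \<Rightarrow> real Matrix.vec" where
  "lie_bracket X Y x = jacobian_mat Y x *\<^sub>v X x - jacobian_mat X x *\<^sub>v Y x"

definition vector_field_in ::
    "(real^'n) set \<Rightarrow> (real^'n \<Rightarrow> real Matrix.vec set) \<Rightarrow> (real^'n \<Rightarrow> real Matrix.vec) \<Rightarrow> bool" where
  "vector_field_in U D X \<longleftrightarrow> smooth_vec U CARD('n) X \<and> (\<forall>x\<in>U. X x \<in> D x)"

definition involutive_on :: "(real^'n) set \<Rightarrow> (real^'n \<Rightarrow> real Matrix.vec set) \<Rightarrow> bool" where
  "involutive_on U D \<longleftrightarrow>
     (\<forall>X Y. vector_field_in U D X \<longrightarrow> vector_field_in U D Y \<longrightarrow> vector_field_in U D (lie_bracket X Y))"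

definition column_distribution ::
    "(real^'n \<Rightarrow> real Matrix.mat) \<Rightarrow> real^'n \<Rightarrow> real Matrix.vec set" where
  "column_distribution M x = vec_space.col_space CARD('n) (M x)"

definition affine_system ::
    "(real^'n) set \<Rightarrow> nat \<Rightarrow> nat \<Rightarrow> (real^'n \<Rightarrow> real Matrix.vec) \<Rightarrow> (real^'n \<Rightarrow> real Matrix.mat)
      \<Rightarrow> (real^'n \<Rightarrow> real Matrix.vec) \<Rightarrow> bool" where
  "affine_system U m p f g h \<longleftrightarrow>
     open U \<and> 0 \<in> U \<and>
     smooth_vec U CARD('n) f \<and> smooth_mat U CARD('n) m g \<and> smooth_vec U p h \<and>
     f 0 = 0\<^sub>v CARD('n) \<and> h 0 = 0\<^sub>v p"

definition inf_zero_dim :: "(nat \<Rightarrow> nat) \<Rightarrow> nat \<Rightarrow> nat" where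
  "inf_zero_dim \<rho> k = (\<Sum>j=1..k. j * (\<rho> j - \<rho> (j - 1)))"

definition inf_zero_list :: "(nat \<Rightarrow> nat) \<Rightarrow> nat \<Rightarrow> nat list" where
  "inf_zero_list \<rho> k = concat (map (\<lambda>j. replicate (\<rho> j - \<rho> (j - 1)) j) [1..<Suc k])"

text \<open>
  In the next three definitions \<open>\<Theta> k\<close>, \<open>\<Omega> k\<close>, \<open>R k\<close>, \<open>S k\<close>, \<open>P k l\<close> and \<open>\<rho> k\<close> are the data of a run
  of the algorithm; \<open>R\<close> and \<open>S\<close> are the choices made along the run. The stacked matrix in
  the last clause of \<open>assumption_A\<close> has \<open>\<rho> k\<close> rows.
\<close>

definition assumption_A ::
    "(real^'n) set \<Rightarrow> nat \<Rightarrow> (real^'n \<Rightarrow> real Matrix.mat) \<Rightarrow> (nat \<Rightarrow> nat) \<Rightarrow> (nat \<Rightarrow> real Matrix.mat)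
      \<Rightarrow> (nat \<Rightarrow> real^'n \<Rightarrow> real Matrix.vec) \<Rightarrow> (nat \<Rightarrow> real^'n \<Rightarrow> real Matrix.vec) \<Rightarrow> nat \<Rightarrow> bool" where
  "assumption_A U p g \<rho> R \<Theta> \<Omega> k \<longleftrightarrow>
     (\<forall>x\<in>U. mat_rank (lie_mat g (\<Omega> (k - 1)) x @\<^sub>r lie_mat g (\<Theta> (k - 1)) x) = \<rho> k) \<and>
     R k \<in> carrier_mat (\<rho> k - \<rho> (k - 1)) (p - \<rho> (k - 1)) \<and>
     (\<forall>x\<in>U. full_row_rank
        (lie_mat g (\<Omega> (k - 1)) x @\<^sub>r lie_mat g (\<lambda>z. R k *\<^sub>v \<Theta> (k - 1) z) x))"

definition algorithm_step ::
    "(real^'n) set \<Rightarrow> nat \<Rightarrow> (real^'n \<Rightarrow> real Matrix.vec) \<Rightarrow> (real^'n \<Rightarrow> real Matrix.mat)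
      \<Rightarrow> (nat \<Rightarrow> nat) \<Rightarrow> (nat \<Rightarrow> real Matrix.mat) \<Rightarrow> (nat \<Rightarrow> real Matrix.mat)
      \<Rightarrow> (nat \<Rightarrow> nat \<Rightarrow> real^'n \<Rightarrow> real Matrix.mat)
      \<Rightarrow> (nat \<Rightarrow> real^'n \<Rightarrow> real Matrix.vec) \<Rightarrow> (nat \<Rightarrow> real^'n \<Rightarrow> real Matrix.vec) \<Rightarrow> nat \<Rightarrow> bool" where
  "algorithm_step U p f g \<rho> R S P \<Theta> \<Omega> k \<longleftrightarrow>
     S k \<in> carrier_mat (p - \<rho> k) (p - \<rho> (k - 1)) \<and> invertible_mat (R k @\<^sub>r S k) \<and>
     (\<forall>x\<in>U. \<Omega> k x = vcol (map (\<lambda>l. R l *\<^sub>v \<Theta> (l - 1) x) [1..<Suc k])) \<and>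
     (\<forall>l\<in>{1..k}. smooth_mat U (p - \<rho> k) (\<rho> l - \<rho> (l - 1)) (P k l)) \<and>
     (\<forall>x\<in>U. lie_mat g (\<lambda>z. S k *\<^sub>v \<Theta> (k - 1) z) x =
        mat_sum (p - \<rho> k) (dim_col (g x))
          (\<lambda>l. P k l x * lie_mat g (\<lambda>z. R l *\<^sub>v \<Theta> (l - 1) z) x) {1..k}) \<and>
     (\<forall>x\<in>U. \<Theta> k x =
        lie_vec f (\<lambda>z. S k *\<^sub>v \<Theta> (k - 1) z) x -
        finsum_vec TYPE(real) (p - \<rho> k)
          (\<lambda>l. P k l x *\<^sub>v lie_vec f (\<lambda>z. R l *\<^sub>v \<Theta> (l - 1) z) x) {1..k})"

definition regular_algorithm_run ::
    "(real^'n) set \<Rightarrow> nat \<Rightarrow> nat \<Rightarrow> (real^'n \<Rightarrow> real Matrix.vec) \<Rightarrow> (real^'n \<Rightarrow> real Matrix.mat)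
      \<Rightarrow> (real^'n \<Rightarrow> real Matrix.vec)
      \<Rightarrow> (nat \<Rightarrow> nat) \<Rightarrow> (nat \<Rightarrow> real Matrix.mat) \<Rightarrow> (nat \<Rightarrow> real Matrix.mat)
      \<Rightarrow> (nat \<Rightarrow> nat \<Rightarrow> real^'n \<Rightarrow> real Matrix.mat)
      \<Rightarrow> (nat \<Rightarrow> real^'n \<Rightarrow> real Matrix.vec) \<Rightarrow> (nat \<Rightarrow> real^'n \<Rightarrow> real Matrix.vec) \<Rightarrow> nat \<Rightarrow> bool" where
  "regular_algorithm_run U m p f g h \<rho> R S P \<Theta> \<Omega> kstar \<longleftrightarrow>
     \<rho> 0 = 0 \<and> (\<forall>x\<in>U. \<Theta> 0 x = h x) \<and> (\<forall>x\<in>U. \<Omega> 0 x = vNil) \<and>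
     (\<forall>k\<in>{1..kstar}. assumption_A U p g \<rho> R \<Theta> \<Omega> k \<and> algorithm_step U p f g \<rho> R S P \<Theta> \<Omega> k) \<and>
     1 \<le> kstar \<and>
     (\<forall>k\<in>{1..<kstar}. k + inf_zero_dim \<rho> k < CARD('n) \<and> \<rho> k < min p m) \<and>
     \<not> (kstar + inf_zero_dim \<rho> kstar < CARD('n) \<and> \<rho> kstar < min p m)"

text \<open>
  \<open>S_prod p \<rho> S i j\<close> is \<open>S i * S (i - 1) * ... * S j\<close>; the trailing identity has the column
  dimension of \<open>S j\<close> and is the value of the empty product.
\<close>

definition S_prod :: "nat \<Rightarrow> (nat \<Rightarrow> nat) \<Rightarrow> (nat \<Rightarrow> real Matrix.mat) \<Rightarrow> nat \<Rightarrow> nat \<Rightarrow> real Matrix.mat" where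
  "S_prod p \<rho> S i j = foldr (*) (map S (rev [j..<Suc i])) (1\<^sub>m (p - \<rho> (j - 1)))"

definition zeta_block ::
    "nat \<Rightarrow> (nat \<Rightarrow> nat) \<Rightarrow> (nat \<Rightarrow> real Matrix.mat) \<Rightarrow> (nat \<Rightarrow> real Matrix.mat)
      \<Rightarrow> (nat \<Rightarrow> real^'n \<Rightarrow> real Matrix.vec) \<Rightarrow> nat \<Rightarrow> nat \<Rightarrow> real^'n \<Rightarrow> real Matrix.vec" where
  "zeta_block p \<rho> R S \<Theta> i j x = (R i * S_prod p \<rho> S (i - 1) j) *\<^sub>v \<Theta> (j - 1) x"

definition zeta ::
    "nat \<Rightarrow> (nat \<Rightarrow> nat) \<Rightarrow> (nat \<Rightarrow> real Matrix.mat) \<Rightarrow> (nat \<Rightarrow> real Matrix.mat)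
      \<Rightarrow> (nat \<Rightarrow> real^'n \<Rightarrow> real Matrix.vec) \<Rightarrow> nat \<Rightarrow> real^'n \<Rightarrow> real Matrix.vec" where
  "zeta p \<rho> R S \<Theta> i x = vcol (map (\<lambda>j. zeta_block p \<rho> R S \<Theta> i j x) [1..<Suc i])"

definition Phi_d_bar ::
    "nat \<Rightarrow> (nat \<Rightarrow> nat) \<Rightarrow> (nat \<Rightarrow> real Matrix.mat) \<Rightarrow> (nat \<Rightarrow> real Matrix.mat)
      \<Rightarrow> (nat \<Rightarrow> real^'n \<Rightarrow> real Matrix.vec) \<Rightarrow> nat \<Rightarrow> real^'n \<Rightarrow> real Matrix.vec" where
  "Phi_d_bar p \<rho> R S \<Theta> kstar x = vcol (map (\<lambda>i. zeta p \<rho> R S \<Theta> i x) [1..<Suc kstar])"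

text \<open>The chains \<open>\<xi> i 1, ..., \<xi> i q\<^sub>i\<close> one after the other; \<open>q\<^sub>i\<close> is \<open>q ! (i - 1)\<close>.\<close>

definition xi_col :: "nat list \<Rightarrow> (nat \<Rightarrow> nat \<Rightarrow> real^'n \<Rightarrow> real) \<Rightarrow> real^'n \<Rightarrow> real Matrix.vec" where
  "xi_col q \<xi> x =
     vec_of_list (concat (map (\<lambda>i. map (\<lambda>j. \<xi> i j x) [1..<Suc (q ! (i - 1))]) [1..<Suc (length q)]))"

end

theory Submission
  imports Defs
begin

text \<open>
  The coordinates \<open>\<xi>\<^sub>i\<^sub>,\<^sub>j\<close> are the components of the \<open>\<zeta>\<^sub>k\<^sub>,\<^sub>j\<close>, and differentiating
  \<open>\<Theta>\<^sub>j\<close> along the run of the algorithm gives their dynamics. The columns \<open>X\<^sub>i\<close> of \<open>g\<^sub>d\<close> are dual to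
  the differentials of the components \<open>\<omega>\<^sub>i = \<xi>\<^sub>i\<^sub>,\<^sub>q\<^sub>i\<close> of \<open>\<Omega>\<close>. By symmetry of second derivatives these
  differentials annihilate every bracket of two of the \<open>X\<^sub>i\<close>; as the bracket lies again in the span
  of the \<open>X\<^sub>i\<close>, the fields commute.

  What remains is a simultaneous system of first integrals of the \<open>X\<^sub>i\<close> around a point \<open>x\<^sub>0\<close>. Flow
  from \<open>x\<close> along \<open>\<Sum>\<^sub>i \<sigma>\<^sub>i(x) X\<^sub>i\<close> with frozen coefficients \<open>\<sigma>\<^sub>i(x) = \<omega>\<^sub>i(x\<^sub>0) - \<omega>\<^sub>i(x)\<close>, i.e. project \<open>x\<close>
  onto the level set of the \<open>\<omega>\<^sub>i\<close> through \<open>x\<^sub>0\<close>. By commutativity the derivative of the position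
  \<open>Y(s, x)\<close> satisfies \<open>dY(s, x) X\<^sub>i(x) = (1 - s) X\<^sub>i(Y(s, x))\<close>, so the end point \<open>Y(1, x)\<close> is constant
  along the \<open>X\<^sub>i\<close>. Since \<open>\<sigma>\<^sub>i\<close> is small near \<open>x\<^sub>0\<close>, the flow up to time 1 is the fixed point of a
  contraction, and smooth dependence on \<open>x\<close> needs no general theory of differential equations.
  Finally \<open>\<eta>\<close> consists of the components of \<open>Y(1, x)\<close> along the common kernel of the \<open>d\<xi>\<^sub>i\<^sub>,\<^sub>j(x\<^sub>0)\<close>,
  and the inverse function theorem applies to \<open>col {\<eta>, \<xi>}\<close>.
\<close>

subsection \<open>Functions of class \<open>C\<^sup>k\<close> depending on a parameter\<close>

text \<open>The factor 1 - s comes from duality: \<open>\<omega> i\<close> grows at unit rate along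
  the i-th field, so moving the start x along it shortens the remaining displacement \<sigma> by the
  same amount, and after a fraction s of the flow only 1 - s of the move survives. At x0 all
  \<sigma> vanish and the flow stands still, so the derivative of the end point is the identity on
  the common kernel of the d\<omega>; this makes \<eta> independent of the \<xi>. As \<sigma> must
  be small, \<eta> is found only near a given point, whereas \<xi>, both transformations and the
  chain coefficients live on all of U.

  The obstacle to smooth dependence: the derivative of a solution solves a linear equation whose
  coefficients contain the solution. The induction on the order therefore carries functions
  differentiated in x alone but jointly continuous in (s, x). The estimates rest on one device: if
  every bound M of a quantity improves to A + M/2, the quantity is at most 2A. The constant 1/2
  passes to the linearised equation, so the same existence lemma supplies the candidate
  derivative.\<close>

lemma k_times_differentiable_on_cong:
  assumes "open V" "\<And>x. x \<in> V \<Longrightarrow> f x = g x" "k_times_differentiable_on k V f"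
  shows "k_times_differentiable_on k V g"
  using assms(2,3)
proof (induction k arbitrary: f g)
  case 0
  then show ?case using continuous_on_cong[of V V f g] by simp
next
  case (Suc k)
  have fd: "(g has_derivative frechet_derivative f (at x)) (at x)" if "x \<in> V" for x
    using Suc.prems that assms(1)
    by (auto simp: frechet_derivative_works
        intro: has_derivative_transform_within_open[where f = f and s = V])
  then have "frechet_derivative g (at x) = frechet_derivative f (at x)" if "x \<in> V" for x
    using frechet_derivative_at that by metis
  then have "k_times_differentiable_on k V (\<lambda>x. frechet_derivative g (at x) v)" for v
    using Suc.prems Suc.IH[of "\<lambda>x. frechet_derivative f (at x) v" "\<lambda>x. frechet_derivative g (at x) v"]
    by auto
  with fd show ?case by (auto simp: differentiable_def)
qed

text \<open>The derivative is existentially quantified so that the closure lemmas can name it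
  explicitly instead of computing a \<open>frechet_derivative\<close>. Joint continuity is demanded
  at every order because differentiability in \<open>x\<close> for each fixed \<open>s\<close> does
  not give it, and integration in \<open>s\<close> relies on it.\<close>

primrec param_Ck ::
    "nat \<Rightarrow> real set \<Rightarrow> 'a::real_normed_vector set \<Rightarrow> (real \<Rightarrow> 'a \<Rightarrow> 'b::real_normed_vector) \<Rightarrow> bool" where
  "param_Ck 0 T V w \<longleftrightarrow> continuous_on (T \<times> V) (\<lambda>(s, x). w s x)"
| "param_Ck (Suc k) T V w \<longleftrightarrow> continuous_on (T \<times> V) (\<lambda>(s, x). w s x) \<and>
     (\<exists>w'. (\<forall>s\<in>T. \<forall>x\<in>V. (w s has_derivative w' s x) (at x)) \<and>
           (\<forall>v. param_Ck k T V (\<lambda>s x. w' s x v)))"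

lemma param_Ck_SucI:
  assumes "continuous_on (T \<times> V) (\<lambda>(s, x). w s x)"
    "\<And>s x. s \<in> T \<Longrightarrow> x \<in> V \<Longrightarrow> (w s has_derivative w' s x) (at x)"
    "\<And>v. param_Ck k T V (\<lambda>s x. w' s x v)"
  shows "param_Ck (Suc k) T V w"
  unfolding param_Ck.simps using assms by blast

lemma param_Ck_SucE:
  assumes "param_Ck (Suc k) T V w"
  obtains w' where
    "\<And>s x. s \<in> T \<Longrightarrow> x \<in> V \<Longrightarrow> (w s has_derivative w' s x) (at x)"
    "\<And>v. param_Ck k T V (\<lambda>s x. w' s x v)"
  using assms unfolding param_Ck.simps by blast

declare param_Ck.simps(2)[simp del]

lemma param_Ck_continuous:
  "param_Ck k T V w \<Longrightarrow> continuous_on (T \<times> V) (\<lambda>(s, x). w s x)"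
  by (cases k) (auto simp: param_Ck.simps(2))

lemma param_Ck_cong:
  assumes "open V" "\<And>s x. s \<in> T \<Longrightarrow> x \<in> V \<Longrightarrow> w s x = u s x" "param_Ck k T V w"
  shows "param_Ck k T V u"
proof -
  have c: "continuous_on (T \<times> V) (\<lambda>(s, x). u s x)"
  proof -
    have "(case z of (s, x) \<Rightarrow> w s x) = (case z of (s, x) \<Rightarrow> u s x)" if "z \<in> T \<times> V" for z
      using that assms(2) by auto
    with param_Ck_continuous[OF assms(3)] show ?thesis
      using continuous_on_cong[of "T \<times> V" "T \<times> V" "\<lambda>(s, x). w s x" "\<lambda>(s, x). u s x"] by simp
  qed
  show ?thesis
  proof (cases k)
    case 0
    with c show ?thesis by simp
  next
    case (Suc j)
    from assms(3)[unfolded Suc] obtain w' where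
      w': "\<And>s x. s \<in> T \<Longrightarrow> x \<in> V \<Longrightarrow> (w s has_derivative w' s x) (at x)"
        "\<And>v. param_Ck j T V (\<lambda>s x. w' s x v)" by (rule param_Ck_SucE) blast
    have "(u s has_derivative w' s x) (at x)" if "s \<in> T" "x \<in> V" for s x
      using has_derivative_transform_within_open[OF w'(1)[OF that] assms(1) that(2)] assms(2) that
      by auto
    with w'(2) c Suc show ?thesis using param_Ck_SucI[of T V u w' j] by blast
  qed
qed

lemma param_Ck_subset:
  assumes "T' \<subseteq> T" "V' \<subseteq> V" "param_Ck k T V w"
  shows "param_Ck k T' V' w"
  using assms(3)
proof (induction k arbitrary: w)
  case 0
  then show ?case using assms(1,2) by (auto elim!: continuous_on_subset)
next
  case (Suc k)
  from Suc.prems obtain w' where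
    w': "\<And>s x. s \<in> T \<Longrightarrow> x \<in> V \<Longrightarrow> (w s has_derivative w' s x) (at x)"
      "\<And>v. param_Ck k T V (\<lambda>s x. w' s x v)" by (rule param_Ck_SucE) blast
  have "continuous_on (T' \<times> V') (\<lambda>(s, x). w s x)"
    using param_Ck_continuous[OF Suc.prems] assms(1,2) by (auto elim!: continuous_on_subset)
  moreover have "(w s has_derivative w' s x) (at x)" if "s \<in> T'" "x \<in> V'" for s x
    using w'(1) that assms(1,2) by blast
  ultimately show ?case using w'(2) Suc.IH param_Ck_SucI[of T' V' w w' k] by blast
qed

lemma param_Ck_Suc_imp: "param_Ck (Suc k) T V w \<Longrightarrow> param_Ck k T V w"
proof (induction k arbitrary: w)
  case 0
  then show ?case using param_Ck_continuous by auto
next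
  case (Suc k)
  from Suc.prems obtain w' where
    w': "\<And>s x. s \<in> T \<Longrightarrow> x \<in> V \<Longrightarrow> (w s has_derivative w' s x) (at x)"
      "\<And>v. param_Ck (Suc k) T V (\<lambda>s x. w' s x v)" by (rule param_Ck_SucE) blast
  then have "param_Ck k T V (\<lambda>s x. w' s x v)" for v using Suc.IH by blast
  with w'(1) param_Ck_continuous[OF Suc.prems] show ?case using param_Ck_SucI[of T V w w' k] by blast
qed

lemma param_Ck_frechet:
  assumes "param_Ck (Suc k) T V w" "open V"
  shows "\<And>s x. s \<in> T \<Longrightarrow> x \<in> V \<Longrightarrow> (w s has_derivative frechet_derivative (w s) (at x)) (at x)"
    and "param_Ck k T V (\<lambda>s x. frechet_derivative (w s) (at x) v)"
proof -
  from assms(1) obtain w' where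
    w': "\<And>s x. s \<in> T \<Longrightarrow> x \<in> V \<Longrightarrow> (w s has_derivative w' s x) (at x)"
      "\<And>v. param_Ck k T V (\<lambda>s x. w' s x v)" by (rule param_Ck_SucE) blast
  have eq: "frechet_derivative (w s) (at x) = w' s x" if "s \<in> T" "x \<in> V" for s x
    using frechet_derivative_at[OF w'(1)[OF that]] by simp
  with w'(1) show "(w s has_derivative frechet_derivative (w s) (at x)) (at x)"
    if "s \<in> T" "x \<in> V" for s x using that by simp
  show "param_Ck k T V (\<lambda>s x. frechet_derivative (w s) (at x) v)"
    using param_Ck_cong[OF assms(2) _ w'(2)[of v]] eq by auto
qed

text \<open>Derivatives of Volterra solutions are built on small balls and have to be glued. Each
  local derivative equals \<open>frechet_derivative\<close>, so they agree on overlaps. Only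
  \<open>V\<close> is localised, never the parameter set \<open>T\<close>.\<close>

lemma param_Ck_local:
  assumes "\<And>x. x \<in> V \<Longrightarrow> \<exists>V'. open V' \<and> x \<in> V' \<and> V' \<subseteq> V \<and> param_Ck k T V' w"
  shows "param_Ck k T V w"
  using assms
proof (induction k arbitrary: w)
  case 0
  show ?case unfolding param_Ck.simps
    unfolding continuous_on_eq_continuous_within
  proof
    fix z assume z: "z \<in> T \<times> V"
    then obtain s x where sx: "z = (s, x)" "s \<in> T" "x \<in> V" by auto
    with 0 obtain V' where V': "open V'" "x \<in> V'" "V' \<subseteq> V" "continuous_on (T \<times> V') (\<lambda>(s, x). w s x)"
      by (metis param_Ck.simps(1))
    have "continuous (at z within (T \<times> V')) (\<lambda>(s, x). w s x)"
      using V' sx by (auto simp: continuous_on_eq_continuous_within)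
    moreover have "at z within (T \<times> V') = at z within (T \<times> V)"
      using V'(1-3) sx
      by (intro at_within_nhd[where S = "UNIV \<times> V'"]) (auto intro: open_Times)
    ultimately show "continuous (at z within (T \<times> V)) (\<lambda>(s, x). w s x)"
      by (simp add: continuous_within)
  qed
next
  case (Suc k)
  have loc: "\<exists>V'. open V' \<and> x \<in> V' \<and> V' \<subseteq> V \<and> param_Ck j T V' w" if "j \<le> Suc k" "x \<in> V" for j x
  proof -
    have "param_Ck (Suc k) T V' w \<Longrightarrow> param_Ck j T V' w" for V'
      using that(1) by (induction j rule: inc_induct) (auto intro: param_Ck_Suc_imp simp del: param_Ck.simps)
    with Suc.prems[OF that(2)] show ?thesis by blast
  qed
  have c: "continuous_on (T \<times> V) (\<lambda>(s, x). w s x)"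
  proof -
    have "param_Ck k T V w" by (rule Suc.IH) (use loc in auto)
    then show ?thesis by (rule param_Ck_continuous)
  qed
  let ?w' = "\<lambda>s x. frechet_derivative (w s) (at x)"
  have "(w s has_derivative ?w' s x) (at x)" if "s \<in> T" "x \<in> V" for s x
    using Suc.prems[OF that(2)] param_Ck_frechet(1) that(1) by blast
  moreover have "param_Ck k T V (\<lambda>s x. ?w' s x v)" for v
  proof (rule Suc.IH)
    fix x assume "x \<in> V"
    from Suc.prems[OF this] obtain V' where V': "open V'" "x \<in> V'" "V' \<subseteq> V" "param_Ck (Suc k) T V' w"
      by blast
    from param_Ck_frechet(2)[OF V'(4,1)] have "param_Ck k T V' (\<lambda>s x. ?w' s x v)" .
    with V' show "\<exists>V'. open V' \<and> x \<in> V' \<and> V' \<subseteq> V \<and> param_Ck k T V' (\<lambda>s x. ?w' s x v)"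
      by blast
  qed
  ultimately show ?case using c param_Ck_SucI[of T V w ?w' k] by blast
qed

lemma param_Ck_independent:
  assumes "open V" "k_times_differentiable_on k V \<theta>"
  shows "param_Ck k T V (\<lambda>_. \<theta>)"
  using assms(2)
proof (induction k arbitrary: \<theta>)
  have c: "continuous_on (T \<times> V) (\<lambda>(s, x). \<phi> x)" if "continuous_on V \<phi>" for \<phi> :: "'a \<Rightarrow> 'b"
  proof -
    have "snd ` (T \<times> V) \<subseteq> V" by auto
    from continuous_on_compose2[OF that continuous_on_snd[OF continuous_on_id] this]
    show ?thesis by (simp add: case_prod_beta)
  qed
  { case 0 then show ?case using c by simp }
  case (Suc k)
  then have d: "(\<theta> has_derivative frechet_derivative \<theta> (at x)) (at x)" if "x \<in> V" for x
    using that by (auto simp: frechet_derivative_works)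
  then have "continuous_on V \<theta>"
    using assms(1) continuous_on_eq_continuous_at has_derivative_continuous by blast
  moreover have "param_Ck k T V (\<lambda>_ x. frechet_derivative \<theta> (at x) v)" for v
    using Suc by auto
  ultimately show ?case
    using c d by (intro param_Ck_SucI[of T V "\<lambda>_. \<theta>" "\<lambda>_ x. frechet_derivative \<theta> (at x)" k])
qed

lemma param_Ck_imp_k_times:
  assumes "open V" "param_Ck k T V w" "s \<in> T"
  shows "k_times_differentiable_on k V (w s)"
  using assms(2)
proof (induction k arbitrary: w)
  case 0
  then have "continuous_on (T \<times> V) (\<lambda>(s, x). w s x)" by simp
  moreover have "Pair s ` V \<subseteq> T \<times> V" using assms(3) by auto
  ultimately have "continuous_on V (\<lambda>x. case (s, x) of (s, x) \<Rightarrow> w s x)"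
    using continuous_on_compose2 continuous_on_Pair[OF continuous_on_const continuous_on_id] by blast
  then show ?case by simp
next
  case (Suc k)
  have "w s differentiable (at x)" if "x \<in> V" for x
    using param_Ck_frechet(1)[OF Suc.prems assms(1) assms(3) that] by (auto simp: differentiable_def)
  moreover have "k_times_differentiable_on k V (\<lambda>x. frechet_derivative (w s) (at x) v)" for v
    using Suc.IH[OF param_Ck_frechet(2)[OF Suc.prems assms(1), of v]] .
  ultimately show ?case by simp
qed

section \<open>Closure properties of the classes with parameter\<close>

lemma param_Ck_const: "param_Ck k T V (\<lambda>s x. c)"
proof (induction k arbitrary: c)
  case 0
  show ?case by simp
next
  case (Suc k)
  show ?case
    by (rule param_Ck_SucI[where w' = "\<lambda>s x v. 0"]) (simp_all add: Suc)
qed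

lemma param_Ck_snd_linear:
  assumes "bounded_linear L"
  shows "param_Ck k T V (\<lambda>s. L)"
proof -
  have c: "continuous_on (T \<times> V) (\<lambda>(s, x). L x)"
    by (auto simp: case_prod_beta intro!: continuous_intros bounded_linear.continuous_on[OF assms])
  show ?thesis
  proof (cases k)
    case 0
    with c show ?thesis by simp
  next
    case (Suc j)
    show ?thesis unfolding Suc
      by (rule param_Ck_SucI[where w' = "\<lambda>s x. L"])
        (use c param_Ck_const in \<open>auto intro!: bounded_linear_imp_has_derivative assms\<close>)
  qed
qed

lemma param_Ck_linear:
  assumes "bounded_linear L" "param_Ck k T V w"
  shows "param_Ck k T V (\<lambda>s x. L (w s x))"
  using assms(2)
proof (induction k arbitrary: w)
  case 0
  then show ?case
    using bounded_linear.continuous_on[OF assms(1), of "T \<times> V" "\<lambda>(s, x). w s x"]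
    by (simp add: case_prod_beta)
next
  case (Suc k)
  from Suc.prems obtain w' where
    w': "\<And>s x. s \<in> T \<Longrightarrow> x \<in> V \<Longrightarrow> (w s has_derivative w' s x) (at x)"
      "\<And>v. param_Ck k T V (\<lambda>s x. w' s x v)" by (rule param_Ck_SucE) blast
  show ?case
  proof (rule param_Ck_SucI)
    show "continuous_on (T \<times> V) (\<lambda>(s, x). L (w s x))"
      using bounded_linear.continuous_on[OF assms(1) param_Ck_continuous[OF Suc.prems]]
      by (simp add: case_prod_beta)
    show "((\<lambda>x. L (w s x)) has_derivative (\<lambda>v. L (w' s x v))) (at x)" if "s \<in> T" "x \<in> V" for s x
      by (rule bounded_linear.has_derivative[OF assms(1) w'(1)[OF that]])
    show "param_Ck k T V (\<lambda>s x. L (w' s x v))" for v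
      by (rule Suc.IH[OF w'(2)])
  qed
qed

lemma param_Ck_add:
  assumes "param_Ck k T V u" "param_Ck k T V w"
  shows "param_Ck k T V (\<lambda>s x. u s x + w s x)"
  using assms
proof (induction k arbitrary: u w)
  case 0
  then show ?case by (auto simp: case_prod_beta intro!: continuous_intros)
next
  case (Suc k)
  from Suc.prems(1) obtain u' where
    u': "\<And>s x. s \<in> T \<Longrightarrow> x \<in> V \<Longrightarrow> (u s has_derivative u' s x) (at x)"
      "\<And>v. param_Ck k T V (\<lambda>s x. u' s x v)" by (rule param_Ck_SucE) blast
  from Suc.prems(2) obtain w' where
    w': "\<And>s x. s \<in> T \<Longrightarrow> x \<in> V \<Longrightarrow> (w s has_derivative w' s x) (at x)"
      "\<And>v. param_Ck k T V (\<lambda>s x. w' s x v)" by (rule param_Ck_SucE) blast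
  show ?case
  proof (rule param_Ck_SucI)
    show "continuous_on (T \<times> V) (\<lambda>(s, x). u s x + w s x)"
      using continuous_on_add[OF Suc.prems[THEN param_Ck_continuous]] by (simp add: case_prod_beta)
    show "((\<lambda>x. u s x + w s x) has_derivative (\<lambda>v. u' s x v + w' s x v)) (at x)"
      if "s \<in> T" "x \<in> V" for s x
      by (rule has_derivative_add[OF u'(1)[OF that] w'(1)[OF that]])
  qed (rule Suc.IH[OF u'(2) w'(2)])
qed

lemma param_Ck_sum:
  assumes "\<And>i. i \<in> I \<Longrightarrow> param_Ck k T V (w i)"
  shows "param_Ck k T V (\<lambda>s x. \<Sum>i\<in>I. w i s x)"
  using assms by (induction I rule: infinite_finite_induct) (simp_all add: param_Ck_const param_Ck_add)

lemma param_Ck_bilinear: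
  assumes "bounded_bilinear pr" "param_Ck k T V u" "param_Ck k T V w"
  shows "param_Ck k T V (\<lambda>s x. pr (u s x) (w s x))"
  using assms(2,3)
proof (induction k arbitrary: u w)
  case 0
  then show ?case
    using bounded_bilinear.continuous_on[OF assms(1)] by (auto simp: case_prod_beta)
next
  case (Suc k)
  from Suc.prems(1) obtain u' where
    u': "\<And>s x. s \<in> T \<Longrightarrow> x \<in> V \<Longrightarrow> (u s has_derivative u' s x) (at x)"
      "\<And>v. param_Ck k T V (\<lambda>s x. u' s x v)" by (rule param_Ck_SucE) blast
  from Suc.prems(2) obtain w' where
    w': "\<And>s x. s \<in> T \<Longrightarrow> x \<in> V \<Longrightarrow> (w s has_derivative w' s x) (at x)"
      "\<And>v. param_Ck k T V (\<lambda>s x. w' s x v)" by (rule param_Ck_SucE) blast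
  show ?case
  proof (rule param_Ck_SucI)
    show "continuous_on (T \<times> V) (\<lambda>(s, x). pr (u s x) (w s x))"
      using bounded_bilinear.continuous_on[OF assms(1) Suc.prems[THEN param_Ck_continuous]]
      by (simp add: case_prod_beta)
    show "((\<lambda>x. pr (u s x) (w s x)) has_derivative (\<lambda>v. pr (u s x) (w' s x v) + pr (u' s x v) (w s x))) (at x)"
      if "s \<in> T" "x \<in> V" for s x
      by (rule bounded_bilinear.FDERIV[OF assms(1) u'(1)[OF that] w'(1)[OF that]])
    show "param_Ck k T V (\<lambda>s x. pr (u s x) (w' s x v) + pr (u' s x v) (w s x))" for v
      by (intro param_Ck_add Suc.IH u' w' Suc.prems[THEN param_Ck_Suc_imp])
  qed
qed

lemma param_Ck_Pair:
  assumes "param_Ck k T V u" "param_Ck k T V w"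
  shows "param_Ck k T V (\<lambda>s x. (u s x, w s x))"
proof -
  have "param_Ck k T V (\<lambda>s x. (u s x, 0) + (0, w s x))"
    by (intro param_Ck_add param_Ck_linear[where L = "\<lambda>z. (z, 0)"]
        param_Ck_linear[where L = "\<lambda>z. (0, z)"] assms bounded_linear_Pair
        bounded_linear_ident bounded_linear_zero)
  then show ?thesis by simp
qed

lemma continuous_on_param_compose:
  fixes T :: "'t::topological_space set"
  assumes F: "continuous_on (T \<times> W) (\<lambda>(s, x). F s x)"
    and w: "continuous_on (T \<times> V) (\<lambda>(s, x). w s x)"
    and W: "\<And>s x. s \<in> T \<Longrightarrow> x \<in> V \<Longrightarrow> w s x \<in> W"
  shows "continuous_on (T \<times> V) (\<lambda>(s, x). F s (w s x))"
proof -
  have "(\<lambda>p. (fst p, case p of (s, x) \<Rightarrow> w s x)) ` (T \<times> V) \<subseteq> T \<times> W"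
    using W by auto
  from continuous_on_compose2[OF F continuous_on_Pair[OF continuous_on_fst[OF continuous_on_id] w] this]
  show ?thesis by (simp add: case_prod_beta)
qed

text \<open>In the chain rule both the base point and the direction of \<open>F'\<close> vary with
  \<open>x\<close>. Expanding the direction in \<open>Basis\<close> leaves scalar coefficients times
  \<open>F'\<close> in fixed directions, to which the induction hypothesis applies; this is where
  the finite dimension of the middle space enters.\<close>

lemma param_Ck_compose:
  fixes F :: "real \<Rightarrow> 'c::euclidean_space \<Rightarrow> 'b::real_normed_vector"
  assumes "param_Ck k T W F" "param_Ck k T V w"
    "\<And>s x. s \<in> T \<Longrightarrow> x \<in> V \<Longrightarrow> w s x \<in> W"
  shows "param_Ck k T V (\<lambda>s x. F s (w s x))"
  using assms
proof (induction k arbitrary: F w)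
  case 0
  show ?case
    using continuous_on_param_compose[OF 0(1,2)[unfolded param_Ck.simps]] 0(3) by simp
next
  case (Suc k)
  from Suc.prems(1) obtain F' where
    F': "\<And>s x. s \<in> T \<Longrightarrow> x \<in> W \<Longrightarrow> (F s has_derivative F' s x) (at x)"
      "\<And>v. param_Ck k T W (\<lambda>s x. F' s x v)" by (rule param_Ck_SucE) blast
  from Suc.prems(2) obtain w' where
    w': "\<And>s x. s \<in> T \<Longrightarrow> x \<in> V \<Longrightarrow> (w s has_derivative w' s x) (at x)"
      "\<And>v. param_Ck k T V (\<lambda>s x. w' s x v)" by (rule param_Ck_SucE) blast
  let ?D = "\<lambda>s x v. \<Sum>b\<in>Basis. inner (w' s x v) b *\<^sub>R F' s (w s x) b"
  show ?case
  proof (rule param_Ck_SucI)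
    show "continuous_on (T \<times> V) (\<lambda>(s, x). F s (w s x))"
      using continuous_on_param_compose[OF Suc.prems(1,2)[THEN param_Ck_continuous]] Suc.prems(3)
      by simp
    show "((\<lambda>x. F s (w s x)) has_derivative ?D s x) (at x)" if sx: "s \<in> T" "x \<in> V" for s x
    proof -
      have F'': "(F s has_derivative F' s (w s x)) (at (w s x))"
        using F'(1) Suc.prems(3) sx by blast
      note lin = has_derivative_linear[OF F'']
      have eq: "F' s (w s x) z = (\<Sum>b\<in>Basis. inner z b *\<^sub>R F' s (w s x) b)" for z
      proof -
        have "F' s (w s x) z = F' s (w s x) (\<Sum>b\<in>Basis. inner z b *\<^sub>R b)"
          by (simp only: euclidean_representation)
        also have "\<dots> = (\<Sum>b\<in>Basis. F' s (w s x) (inner z b *\<^sub>R b))"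
          by (rule linear_sum[OF lin])
        finally show ?thesis by (simp only: linear_cmul[OF lin])
      qed
      from has_derivative_compose[OF w'(1)[OF sx] F''] show ?thesis
        by (simp only: eq[symmetric])
    qed
    show "param_Ck k T V (\<lambda>s x. ?D s x v)" for v
    proof (intro param_Ck_sum param_Ck_bilinear[OF bounded_bilinear_scaleR])
      show "param_Ck k T V (\<lambda>s x. inner (w' s x v) b)" for b
        by (rule param_Ck_linear[OF bounded_linear_inner_left w'(2)])
      show "param_Ck k T V (\<lambda>s x. F' s (w s x) b)" for b
        by (rule Suc.IH[OF F'(2) param_Ck_Suc_imp[OF Suc.prems(2)] Suc.prems(3)])
    qed
  qed
qed

subsection \<open>Volterra equations\<close>

lemma continuous_on_slice:
  assumes "continuous_on (T \<times> V) (\<lambda>(s, x). w s x)" "x \<in> V"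
  shows "continuous_on T (\<lambda>s. w s x)"
proof -
  have "(\<lambda>s. (s, x)) ` T \<subseteq> T \<times> V" using assms(2) by auto
  from continuous_on_compose2[OF assms(1) continuous_on_Pair[OF continuous_on_id continuous_on_const] this]
  show ?thesis by simp
qed

text \<open>Compactness of \<open>T\<close> gives one radius for all \<open>s\<close>: the
  derivative, seen as an operator, differs near the curve \<kappa> by at most \<open>e\<close> from
  its value on the curve, uniformly in \<open>s\<close>, and the mean value inequality turns this
  into the bound on the remainder.\<close>

lemma uniform_derivative:
  fixes F :: "real \<Rightarrow> 'c::euclidean_space \<Rightarrow> 'b::real_normed_vector"
  assumes "compact T" "open W"
    and F': "\<And>s x. s \<in> T \<Longrightarrow> x \<in> W \<Longrightarrow> (F s has_derivative F' s x) (at x)"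
    and cont: "\<And>v. continuous_on (T \<times> W) (\<lambda>(s, x). F' s x v)"
    and \<kappa>: "continuous_on T \<kappa>" "\<And>s. s \<in> T \<Longrightarrow> \<kappa> s \<in> W"
  shows "e > 0 \<Longrightarrow> \<exists>d>0. \<forall>s\<in>T. \<forall>z. norm z < d \<longrightarrow>
            \<kappa> s + z \<in> W \<and> norm (F s (\<kappa> s + z) - F s (\<kappa> s) - F' s (\<kappa> s) z) \<le> e * norm z"
    and "\<exists>C\<ge>0. \<forall>s\<in>T. \<forall>z. norm (F' s (\<kappa> s) z) \<le> C * norm z"
proof -
  have "compact (\<kappa> ` T)" using compact_continuous_image[OF \<kappa>(1) assms(1)] .
  from compact_subset_open_imp_ball_epsilon_subset[OF this assms(2)] \<kappa>(2)
  obtain \<epsilon> where \<epsilon>: "\<epsilon> > 0" "(\<Union>x\<in>\<kappa> ` T. ball x \<epsilon>) \<subseteq> W" by blast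
  have W: "\<kappa> s + z \<in> W" if "s \<in> T" "norm z < \<epsilon>" for s z
  proof -
    have "\<kappa> s + z \<in> ball (\<kappa> s) \<epsilon>" using that by (simp add: dist_norm)
    with \<epsilon>(2) that(1) show ?thesis by blast
  qed
  \<comment> \<open>Operator-valued, since continuity in every fixed direction is continuity in norm
    in finite dimension. The perturbation \<open>z\<close> comes before \<open>s\<close> because the
    compactness argument below fixes a point of the first factor and runs over the compact second
    one.\<close>
  define \<Psi> where "\<Psi> = (\<lambda>(z, s). Blinfun (F' s (\<kappa> s + z)))"
  have app: "blinfun_apply (\<Psi> (z, s)) = F' s (\<kappa> s + z)" if "s \<in> T" "norm z < \<epsilon>" for s z
    using has_derivative_bounded_linear[OF F'[OF that(1) W[OF that]]]
    by (simp add: \<Psi>_def bounded_linear_Blinfun_apply)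
  have "continuous_on (ball 0 \<epsilon> \<times> T) \<Psi>"
  proof (rule continuous_on_blinfun_componentwise)
    fix v :: 'c
    have im: "(\<lambda>p. (snd p, \<kappa> (snd p) + fst p)) ` (ball 0 \<epsilon> \<times> T) \<subseteq> T \<times> W"
      using W by auto
    have "continuous_on (ball 0 \<epsilon> \<times> T) (\<lambda>p. \<kappa> (snd p))"
      by (rule continuous_on_compose2[OF \<kappa>(1) continuous_on_snd[OF continuous_on_id]]) auto
    then have "continuous_on (ball 0 \<epsilon> \<times> T) (\<lambda>p. (snd p, \<kappa> (snd p) + fst p))"
      by (intro continuous_intros)
    from continuous_on_compose2[OF cont[of v] this im]
    have c: "continuous_on (ball 0 \<epsilon> \<times> T) (\<lambda>p. F' (snd p) (\<kappa> (snd p) + fst p) v)" by simp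
    have "blinfun_apply (\<Psi> p) v = F' (snd p) (\<kappa> (snd p) + fst p) v" if "p \<in> ball 0 \<epsilon> \<times> T" for p
      using that app[of "snd p" "fst p"] by auto
    with c show "continuous_on (ball 0 \<epsilon> \<times> T) (\<lambda>p. blinfun_apply (\<Psi> p) v)"
      using continuous_on_cong[of "ball 0 \<epsilon> \<times> T" "ball 0 \<epsilon> \<times> T" "\<lambda>p. blinfun_apply (\<Psi> p) v"
          "\<lambda>p. F' (snd p) (\<kappa> (snd p) + fst p) v"] by simp
  qed
  note cont\<Psi> = this
  have z0: "(0::'c) \<in> ball 0 \<epsilon>" using \<epsilon>(1) by simp
  show "\<exists>d>0. \<forall>s\<in>T. \<forall>z. norm z < d \<longrightarrow>
            \<kappa> s + z \<in> W \<and> norm (F s (\<kappa> s + z) - F s (\<kappa> s) - F' s (\<kappa> s) z) \<le> e * norm z"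
    if e: "e > 0"
  proof -
    obtain X0 where X0: "0 \<in> X0" "open X0"
      "\<forall>x\<in>X0 \<inter> ball 0 \<epsilon>. \<forall>t\<in>T. dist (\<Psi> (x, t)) (\<Psi> (0, t)) \<le> e"
      using continuous_on_prod_compactE[OF cont\<Psi> assms(1) z0 e] by metis
    have "open (X0 \<inter> ball 0 \<epsilon>)" "0 \<in> X0 \<inter> ball 0 \<epsilon>" using X0 \<epsilon>(1) by auto
    then obtain d where d: "d > 0" "ball 0 d \<subseteq> X0 \<inter> ball 0 \<epsilon>"
      using openE by blast
    show ?thesis
    proof (intro exI[of _ d] conjI ballI allI impI d(1))
      fix s and z :: 'c assume s: "s \<in> T" and z: "norm z < d"
      have n: "norm u < \<epsilon> \<and> u \<in> X0" if "norm u < d" for u :: 'c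
      proof -
        have "u \<in> ball 0 d" using that by simp
        with d(2) have "u \<in> X0 \<inter> ball 0 \<epsilon>" by blast
        then show ?thesis by simp
      qed
      show "\<kappa> s + z \<in> W" using W s z n by blast
      have "norm (F s (\<kappa> s + z) - F s (\<kappa> s) - F' s (\<kappa> s) (\<kappa> s + z - \<kappa> s)) \<le> norm (\<kappa> s + z - \<kappa> s) * e"
      proof (rule differentiable_bound_linearization[where S = "ball (\<kappa> s) d"])
        show "\<kappa> s + t *\<^sub>R (\<kappa> s + z - \<kappa> s) \<in> ball (\<kappa> s) d" if "t \<in> {0..1}" for t
          using z that mult_left_le_one_le[of "norm z" t] by (auto simp: dist_norm)
        show "(F s has_derivative F' s x) (at x within ball (\<kappa> s) d)" if "x \<in> ball (\<kappa> s) d" for x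
        proof -
          have "norm (x - \<kappa> s) < d" using that by (simp add: dist_norm norm_minus_commute)
          then have "\<kappa> s + (x - \<kappa> s) \<in> W" using W[OF s] n by blast
          then have "x \<in> W" by simp
          from has_derivative_at_withinI[OF F'[OF s this]] show ?thesis .
        qed
        show "onorm (F' s x - F' s (\<kappa> s)) \<le> e" if "x \<in> ball (\<kappa> s) d" for x
        proof -
          have x: "norm (x - \<kappa> s) < d" using that by (simp add: dist_norm norm_minus_commute)
          from n[OF x] X0(3) s have "dist (\<Psi> (x - \<kappa> s, s)) (\<Psi> (0, s)) \<le> e" by simp
          moreover have "blinfun_apply (\<Psi> (x - \<kappa> s, s) - \<Psi> (0, s)) = F' s x - F' s (\<kappa> s)"
            using app[OF s, of "x - \<kappa> s"] app[OF s, of 0] n[OF x] \<epsilon>(1)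
            by (auto simp: blinfun.diff_left)
          ultimately show ?thesis
            by (simp add: dist_norm norm_blinfun.rep_eq)
        qed
        show "\<kappa> s \<in> ball (\<kappa> s) d" using d(1) by simp
      qed
      then show "norm (F s (\<kappa> s + z) - F s (\<kappa> s) - F' s (\<kappa> s) z) \<le> e * norm z"
        by (simp add: mult.commute)
    qed
  qed
  have im0: "(\<lambda>s. (0::'c, s)) ` T \<subseteq> ball 0 \<epsilon> \<times> T" using \<epsilon>(1) by auto
  have "continuous_on T (\<lambda>s. \<Psi> (0, s))"
    using continuous_on_compose2[OF cont\<Psi> continuous_on_Pair[OF continuous_on_const continuous_on_id] im0] .
  from compact_imp_bounded[OF compact_continuous_image[OF this assms(1)]]
  obtain C where C: "C > 0" "\<forall>x\<in>(\<lambda>s. \<Psi> (0, s)) ` T. norm x \<le> C"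
    unfolding bounded_pos by metis
  show "\<exists>C\<ge>0. \<forall>s\<in>T. \<forall>z. norm (F' s (\<kappa> s) z) \<le> C * norm z"
  proof (intro exI[of _ C] conjI ballI allI)
    fix s z assume s: "s \<in> T"
    have "norm (blinfun_apply (\<Psi> (0, s)) z) \<le> norm (\<Psi> (0, s)) * norm z" by (rule norm_blinfun)
    also have "\<dots> \<le> C * norm z" by (intro mult_right_mono C(2)[rule_format] imageI s) simp
    finally show "norm (F' s (\<kappa> s) z) \<le> C * norm z" using app[OF s, of 0] \<epsilon>(1) by simp
  qed (use C(1) in simp)
qed

text \<open>Apply the improvement to the maximum M itself, which is attained by compactness: M <= A
  + M / 2. This stands in for Gronwall's inequality below.\<close>

lemma contraction_bound:
  fixes g :: "'t::topological_space \<Rightarrow> 'b::real_normed_vector"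
  assumes "compact T" "continuous_on T g"
    and step: "\<And>M. (\<And>s. s \<in> T \<Longrightarrow> norm (g s) \<le> M) \<Longrightarrow> (\<And>s. s \<in> T \<Longrightarrow> norm (g s) \<le> A + M / 2)"
    and s: "s \<in> T"
  shows "norm (g s) \<le> 2 * A"
proof -
  have "continuous_on T (\<lambda>s. norm (g s))" using assms(2) by (rule continuous_on_norm)
  from continuous_attains_sup[OF assms(1) _ this] s
  obtain t where t: "t \<in> T" "\<And>r. r \<in> T \<Longrightarrow> norm (g r) \<le> norm (g t)" by blast
  from step[OF t(2) t(1)] have "norm (g t) \<le> 2 * A" by simp
  with t(2)[OF s] show ?thesis by simp
qed

text \<open>The difference quotients in the second variable are bounded by \<open>L\<close>, and so
  is their limit. This hands the contraction constant of an equation down to its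
  linearisation.\<close>

lemma derivative_bound_of_lipschitz:
  fixes F :: "'a::real_normed_vector \<times> 'b::real_normed_vector \<Rightarrow> 'c::real_normed_vector"
  assumes "open Z" "z \<in> Z" "(F has_derivative F') (at (x, z))" "L \<ge> 0"
    and lip: "\<And>z'. z' \<in> Z \<Longrightarrow> norm (F (x, z') - F (x, z)) \<le> L * norm (z' - z)"
  shows "norm (F' (0, b)) \<le> L * norm b"
proof -
  have "((\<lambda>t. F (x, z + t *\<^sub>R b)) has_derivative (\<lambda>t. F' (0, t *\<^sub>R b))) (at 0)"
  proof (rule has_derivative_compose[where g = F, unfolded o_def])
    show "((\<lambda>t. (x, z + t *\<^sub>R b)) has_derivative (\<lambda>t. (0, t *\<^sub>R b))) (at 0)"
      by (auto intro!: derivative_eq_intros)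
    show "(F has_derivative F') (at (x, z + 0 *\<^sub>R b))" using assms(3) by simp
  qed
  moreover have "(\<lambda>t. F' (0, t *\<^sub>R b)) = (\<lambda>t. t *\<^sub>R F' (0, b))"
  proof
    fix t :: real
    have "F' (t *\<^sub>R (0, b)) = t *\<^sub>R F' (0, b)"
      using linear_cmul[OF has_derivative_linear[OF assms(3)]] .
    then show "F' (0, t *\<^sub>R b) = t *\<^sub>R F' (0, b)" by simp
  qed
  ultimately have "((\<lambda>t. F (x, z + t *\<^sub>R b)) has_vector_derivative F' (0, b)) (at 0)"
    by (simp add: has_vector_derivative_def)
  then have "\<forall>r>0. \<exists>s>0. \<forall>t. t \<noteq> 0 \<and> \<bar>t\<bar> < s \<longrightarrow>
      norm (F (x, z + t *\<^sub>R b) - F (x, z) - t *\<^sub>R F' (0, b)) / \<bar>t\<bar> < r"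
    by (simp add: has_vector_derivative_def LIM_def has_derivative_iff_norm)
  moreover have "norm (D - t *\<^sub>R F' (0, b)) / \<bar>t\<bar> = norm (D /\<^sub>R t - F' (0, b))" if "t \<noteq> 0" for D t
  proof -
    have "D /\<^sub>R t - F' (0, b) = (D - t *\<^sub>R F' (0, b)) /\<^sub>R t"
      using that by (simp add: scaleR_diff_right)
    then show ?thesis by (simp add: divide_inverse mult.commute)
  qed
  ultimately have lim: "((\<lambda>t. (F (x, z + t *\<^sub>R b) - F (x, z)) /\<^sub>R t) \<longlongrightarrow> F' (0, b)) (at 0)"
    unfolding LIM_eq by simp
  have "((\<lambda>t. z + t *\<^sub>R b) \<longlongrightarrow> z + 0 *\<^sub>R b) (at 0)" by (intro tendsto_intros)
  from topological_tendstoD[OF this assms(1)] assms(2)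
  have ev: "\<forall>\<^sub>F t in at 0. z + t *\<^sub>R b \<in> Z" by simp
  have "\<forall>\<^sub>F t in at 0. norm ((F (x, z + t *\<^sub>R b) - F (x, z)) /\<^sub>R t) \<le> L * norm b"
    using ev eventually_neq_at_within[of 0 "0::real" UNIV]
  proof eventually_elim
    case (elim t)
    have "norm (F (x, z + t *\<^sub>R b) - F (x, z)) \<le> L * norm (t *\<^sub>R b)"
      using lip[OF elim(1)] by simp
    with elim(2) show ?case by (simp add: divide_simps mult.commute mult.left_commute)
  qed
  from tendsto_upperbound[OF tendsto_norm[OF lim] this] show ?thesis by simp
qed


text \<open>This is \<open>\<integral>\<^sub>0\<^sup>s u\<close>, rescaled so that the range of integration does not depend on \<open>s\<close>.\<close>

definition volterra :: "(real \<Rightarrow> 'b::euclidean_space) \<Rightarrow> real \<Rightarrow> 'b" where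
  "volterra u s = s *\<^sub>R integral {0..1} (\<lambda>t. u (s * t))"

lemma unit_mult_mem: "s \<in> {0..1} \<Longrightarrow> t \<in> {0..1} \<Longrightarrow> s * t \<in> {0..1::real}"
  by (auto simp: mult_le_one)

lemma continuous_on_rescale:
  assumes "continuous_on {0..1} u" "s \<in> {0..1::real}"
  shows "continuous_on {0..1} (\<lambda>t. u (s * t))"
proof -
  have "(\<lambda>t. s * t) ` {0..1} \<subseteq> {0..1}" using unit_mult_mem assms(2) by blast
  then show ?thesis
    by (rule continuous_on_compose2[OF assms(1) continuous_on_mult_left[OF continuous_on_id]])
qed

lemma scaled_integrable:
  fixes u :: "real \<Rightarrow> 'b::euclidean_space"
  assumes "continuous_on {0..1} u" "s \<in> {0..1}"
  shows "(\<lambda>t. u (s * t)) integrable_on {0..1}"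
  by (rule integrable_continuous_real[OF continuous_on_rescale[OF assms]])

lemma volterra_norm_le:
  assumes "continuous_on {0..1} u" "s \<in> {0..1}" "\<And>r. r \<in> {0..1} \<Longrightarrow> norm (u r) \<le> B"
  shows "norm (volterra u s) \<le> B"
proof -
  have "norm (integral {0..1} (\<lambda>t. u (s * t))) \<le> B * (1 - 0)"
    by (rule integral_bound[OF _ continuous_on_rescale[OF assms(1,2)]])
      (use assms(3) unit_mult_mem[OF assms(2)] in auto)
  then have "\<bar>s\<bar> * norm (integral {0..1} (\<lambda>t. u (s * t))) \<le> 1 * B"
    using assms(2) by (intro mult_mono) auto
  then show ?thesis by (simp add: volterra_def)
qed

lemma volterra_diff:
  assumes "continuous_on {0..1} u" "continuous_on {0..1} w" "s \<in> {0..1}"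
  shows "volterra (\<lambda>r. u r - w r) s = volterra u s - volterra w s"
  unfolding volterra_def
  using integral_diff[OF scaled_integrable[OF assms(1,3)] scaled_integrable[OF assms(2,3)]]
  by (simp add: scaleR_diff_right)

lemma volterra_sum_scaleR:
  assumes "finite I" "\<And>i. i \<in> I \<Longrightarrow> continuous_on {0..1} (u i)" "s \<in> {0..1}"
  shows "volterra (\<lambda>r. \<Sum>i\<in>I. a i *\<^sub>R u i r) s = (\<Sum>i\<in>I. a i *\<^sub>R volterra (u i) s)"
proof -
  have "integral {0..1} (\<lambda>t. \<Sum>i\<in>I. a i *\<^sub>R u i (s * t)) = (\<Sum>i\<in>I. integral {0..1} (\<lambda>t. a i *\<^sub>R u i (s * t)))"
    by (intro integral_sum assms(1) integrable_cmul scaled_integrable assms(2,3))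
  then show ?thesis
    by (simp add: volterra_def scaleR_sum_right mult.commute)
qed

lemma volterra_eq_integral:
  assumes "continuous_on {0..1} u" "s \<in> {0..1}"
  shows "volterra u s = integral {0..s} u"
proof (cases "s = 0")
  case False
  have "u integrable_on {0..s}"
    using assms(2) by (intro integrable_continuous_real continuous_on_subset[OF assms(1)]) auto
  then have "(u has_integral integral {0..s} u) {0..s}" by (rule integrable_integral)
  from has_integral_stretch_real[OF this False]
  have "((\<lambda>t. u (s * t)) has_integral (1 / \<bar>s\<bar>) *\<^sub>R integral {0..s} u) ((\<lambda>x. x / s) ` {0..s})" .
  moreover have "(\<lambda>x. x / s) ` {0..s} = {0..1}"
    using False assms(2) by (simp add: image_divide_atLeastAtMost)
  ultimately have "integral {0..1} (\<lambda>t. u (s * t)) = (1 / \<bar>s\<bar>) *\<^sub>R integral {0..s} u"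
    by (simp add: integral_unique)
  then show ?thesis using False assms(2) by (simp add: volterra_def)
qed (simp add: volterra_def)

lemma volterra_cong:
  assumes "\<And>r. r \<in> {0..1} \<Longrightarrow> u r = w r" "s \<in> {0..1}"
  shows "volterra u s = volterra w s"
  unfolding volterra_def using assms unit_mult_mem by (auto intro!: integral_cong arg_cong[where f = "\<lambda>z. s *\<^sub>R z"])

lemma continuous_on_volterra:
  fixes w :: "real \<Rightarrow> 'a::topological_space \<Rightarrow> 'b::euclidean_space"
  assumes c: "continuous_on ({0..1} \<times> V) (\<lambda>(s, x). w s x)"
  shows "continuous_on ({0..1} \<times> V) (\<lambda>(s, x). volterra (\<lambda>r. w r x) s)"
proof -
  have "continuous_on (({0..1} \<times> V) \<times> cbox 0 1) (\<lambda>q::(real \<times> 'a) \<times> real. (fst (fst q) * snd q, snd (fst q)))"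
    by (intro continuous_intros)
  moreover have "(\<lambda>q. (fst (fst q) * snd q, snd (fst q))) ` (({0..1::real} \<times> V) \<times> cbox 0 1) \<subseteq> {0..1} \<times> V"
  proof (rule image_subsetI)
    fix q :: "(real \<times> 'a) \<times> real" assume "q \<in> ({0..1} \<times> V) \<times> cbox 0 1"
    then have "fst (fst q) \<in> {0..1}" "snd q \<in> {0..1}" "snd (fst q) \<in> V" by auto
    with unit_mult_mem[OF this(1,2)] show "(fst (fst q) * snd q, snd (fst q)) \<in> {0..1} \<times> V" by simp
  qed
  ultimately have "continuous_on (({0..1} \<times> V) \<times> cbox 0 1)
      (\<lambda>q. case (fst (fst q) * snd q, snd (fst q)) of (s, x) \<Rightarrow> w s x)"
    by (rule continuous_on_compose2[OF c])
  then have "continuous_on (({0..1} \<times> V) \<times> cbox 0 1) (\<lambda>(p, t). w (fst p * t) (snd p))"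
    by (simp add: case_prod_beta)
  from integral_continuous_on_param[OF this]
  have "continuous_on ({0..1} \<times> V) (\<lambda>p. integral {0..1} (\<lambda>t. w (fst p * t) (snd p)))" by simp
  then have "continuous_on ({0..1} \<times> V) (\<lambda>p. fst p *\<^sub>R integral {0..1} (\<lambda>t. w (fst p * t) (snd p)))"
    by (intro continuous_intros)
  then show ?thesis by (simp add: case_prod_beta volterra_def)
qed

text \<open>For the rescaled integral over the fixed interval this is the Leibniz rule. It is
  applied on a ball around \<open>x\<close>, because that rule asks for a convex set of
  parameters.\<close>

lemma has_derivative_volterra:
  fixes w :: "real \<Rightarrow> 'a::euclidean_space \<Rightarrow> 'b::euclidean_space"
  assumes V: "open V"
    and w': "\<And>s x. s \<in> {0..1} \<Longrightarrow> x \<in> V \<Longrightarrow> (w s has_derivative w' s x) (at x)"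
    and cw: "continuous_on ({0..1} \<times> V) (\<lambda>(s, x). w s x)"
    and cw': "\<And>v. continuous_on ({0..1} \<times> V) (\<lambda>(s, x). w' s x v)"
    and s: "s \<in> {0..1}" and x: "x \<in> V"
  shows "((\<lambda>x. volterra (\<lambda>r. w r x) s) has_derivative (\<lambda>v. volterra (\<lambda>r. w' r x v) s)) (at x)"
proof -
  obtain d where d: "d > 0" "ball x d \<subseteq> V" by (rule openE[OF V x])
  let ?U = "ball x d"
  have xU: "x \<in> ?U" using d(1) by simp
  define \<Psi> where "\<Psi> z t = Blinfun (w' (s * t) z)" for z t
  have app: "blinfun_apply (\<Psi> z t) = w' (s * t) z" if "z \<in> ?U" "t \<in> {0..1}" for z t
  proof -
    have "z \<in> V" using that(1) d(2) by blast
    from has_derivative_bounded_linear[OF w'[OF unit_mult_mem[OF s that(2)] this]]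
    show ?thesis by (simp add: \<Psi>_def bounded_linear_Blinfun_apply)
  qed
  have cslice: "continuous_on {0..1} (\<lambda>r. w r z)" if "z \<in> ?U" for z
  proof (rule continuous_on_slice[OF cw])
    show "z \<in> V" using that d(2) by blast
  qed
  have cont\<Psi>: "continuous_on (?U \<times> cbox 0 1) (\<lambda>(z, t). \<Psi> z t)"
  proof (rule continuous_on_blinfun_componentwise)
    fix v :: 'a
    have "continuous_on (?U \<times> cbox 0 1) (\<lambda>p. (s * snd p, fst p))"
      by (intro continuous_intros)
    moreover have "(\<lambda>p. (s * snd p, fst p)) ` (?U \<times> cbox 0 1) \<subseteq> {0..1} \<times> V"
    proof (rule image_subsetI)
      fix p :: "'a \<times> real" assume "p \<in> ?U \<times> cbox 0 1"
      then have "fst p \<in> ?U" "snd p \<in> {0..1}" by auto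
      with unit_mult_mem[OF s this(2)] d(2) show "(s * snd p, fst p) \<in> {0..1} \<times> V" by blast
    qed
    ultimately have "continuous_on (?U \<times> cbox 0 1) (\<lambda>p. case (s * snd p, fst p) of (r, x) \<Rightarrow> w' r x v)"
      by (rule continuous_on_compose2[OF cw'[of v]])
    moreover have "blinfun_apply (case p of (z, t) \<Rightarrow> \<Psi> z t) v = (case (s * snd p, fst p) of (r, x) \<Rightarrow> w' r x v)"
      if "p \<in> ?U \<times> cbox 0 1" for p
      using that app[of "fst p" "snd p"] by (auto simp: case_prod_beta)
    ultimately show "continuous_on (?U \<times> cbox 0 1) (\<lambda>p. blinfun_apply (case p of (z, t) \<Rightarrow> \<Psi> z t) v)"
      using continuous_on_cong[of "?U \<times> cbox 0 1" "?U \<times> cbox 0 1"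
          "\<lambda>p. blinfun_apply (case p of (z, t) \<Rightarrow> \<Psi> z t) v"
          "\<lambda>p. case (s * snd p, fst p) of (r, x) \<Rightarrow> w' r x v"] by simp
  qed
  have "((\<lambda>z. integral (cbox 0 1) (\<lambda>t. w (s * t) z)) has_derivative
         blinfun_apply (integral (cbox 0 1) (\<Psi> x))) (at x within ?U)"
  proof (rule leibniz_rule[OF _ _ cont\<Psi> xU convex_ball])
    fix z and t :: real assume z: "z \<in> ?U" and t: "t \<in> cbox 0 1"
    then have "z \<in> V" using d(2) by blast
    from w'[OF unit_mult_mem[OF s] this] t app[OF z, of t]
    have "(w (s * t) has_derivative blinfun_apply (\<Psi> z t)) (at z)" by simp
    then show "((\<lambda>x. w (s * t) x) has_derivative blinfun_apply (\<Psi> z t)) (at z within ?U)"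
      by (rule has_derivative_at_withinI)
  next
    fix z assume z: "z \<in> ?U"
    show "(\<lambda>t. w (s * t) z) integrable_on cbox 0 1"
      using scaled_integrable[OF cslice[OF z] s] by simp
  qed
  then have "((\<lambda>z. integral {0..1} (\<lambda>t. w (s * t) z)) has_derivative
         blinfun_apply (integral {0..1} (\<Psi> x))) (at x)"
    using at_within_open[OF xU open_ball] by simp
  from has_derivative_scaleR_right[OF this, of s]
  have "((\<lambda>x. volterra (\<lambda>r. w r x) s) has_derivative (\<lambda>v. s *\<^sub>R blinfun_apply (integral {0..1} (\<Psi> x)) v)) (at x)"
    by (simp add: volterra_def)
  moreover have "blinfun_apply (integral {0..1} (\<Psi> x)) v = integral {0..1} (\<lambda>t. w' (s * t) x v)" for v
  proof -
    have "continuous_on {0..1} (\<Psi> x)"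
    proof -
      have "Pair x ` {0..1::real} \<subseteq> ?U \<times> cbox 0 1" using d(1) by auto
      from continuous_on_compose2[OF cont\<Psi> continuous_on_Pair[OF continuous_on_const continuous_on_id] this]
      show ?thesis by simp
    qed
    then have "\<Psi> x integrable_on {0..1}" by (rule integrable_continuous_real)
    then have "blinfun_apply (integral {0..1} (\<Psi> x)) v = integral {0..1} (\<lambda>t. blinfun_apply (\<Psi> x t) v)"
      by (rule blinfun_apply_integral)
    also have "\<dots> = integral {0..1} (\<lambda>t. w' (s * t) x v)"
      by (rule integral_cong) (simp add: app[OF xU])
    finally show ?thesis .
  qed
  ultimately show ?thesis by (simp add: volterra_def)
qed

lemma continuous_on_uncurried_compose:
  fixes G :: "real \<Rightarrow> 'a::topological_space \<times> 'b::topological_space \<Rightarrow> 'c::topological_space"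
  assumes "continuous_on (T \<times> (K \<times> Z)) (\<lambda>(r, p). G r p)"
    "continuous_on (T \<times> K) (\<lambda>(s, x). u s x)" "\<And>s x. s \<in> T \<Longrightarrow> x \<in> K \<Longrightarrow> u s x \<in> Z"
  shows "continuous_on (T \<times> K) (\<lambda>(s, x). G s (x, u s x))"
proof (rule continuous_on_param_compose[OF assms(1)])
  have "continuous_on (T \<times> K) (\<lambda>q. (snd q, case q of (s, x) \<Rightarrow> u s x))"
    by (rule continuous_on_Pair[OF continuous_on_snd[OF continuous_on_id] assms(2)])
  then show "continuous_on (T \<times> K) (\<lambda>(s, x). (x, u s x))" by (simp add: case_prod_beta)
  show "(x, u s x) \<in> K \<times> Z" if "s \<in> T" "x \<in> K" for s x using assms(3) that by simp
qed

text \<open>Picard iteration for all \<open>x\<close> in \<open>K\<close> at once, so that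
  convergence is uniform in \<open>(s, x)\<close> and the limit jointly continuous. Since
  \<open>volterra\<close> does not increase a bound on {0..1}, the Lipschitz constant 1/2 of
  \<open>G\<close> is also the contraction constant of the iteration.\<close>

lemma volterra_fixpoint_exists:
  fixes c :: "real \<Rightarrow> 'a::topological_space \<Rightarrow> 'b::euclidean_space"
  assumes K: "compact K" and Z: "closed Z" "z0 \<in> Z"
    and c: "continuous_on ({0..1} \<times> K) (\<lambda>(s, x). c s x)"
    and G: "continuous_on ({0..1} \<times> (K \<times> Z)) (\<lambda>(r, p). G r p)"
    and lip: "\<And>s x z z'. s \<in> {0..1} \<Longrightarrow> x \<in> K \<Longrightarrow> z \<in> Z \<Longrightarrow> z' \<in> Z \<Longrightarrow>
        norm (G s (x, z) - G s (x, z')) \<le> norm (z - z') / 2"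
    and self: "\<And>s x u. s \<in> {0..1} \<Longrightarrow> x \<in> K \<Longrightarrow> (\<And>r. r \<in> {0..1} \<Longrightarrow> u r \<in> Z) \<Longrightarrow>
        continuous_on {0..1} u \<Longrightarrow> c s x + volterra (\<lambda>r. G r (x, u r)) s \<in> Z"
  obtains y where "continuous_on ({0..1} \<times> K) (\<lambda>(s, x). y s x)"
    "\<And>s x. s \<in> {0..1} \<Longrightarrow> x \<in> K \<Longrightarrow> y s x \<in> Z"
    "\<And>s x. s \<in> {0..1} \<Longrightarrow> x \<in> K \<Longrightarrow> y s x = c s x + volterra (\<lambda>r. G r (x, y r x)) s"
proof -
  define \<T> where "\<T> u s x = c s x + volterra (\<lambda>r. G r (x, u r x)) s" for u :: "real \<Rightarrow> 'a \<Rightarrow> 'b" and s x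
  define Y where "Y n = (\<T> ^^ n) (\<lambda>_ _. z0)" for n
  have Y0: "Y 0 s x = z0" and YSuc: "Y (Suc n) s x = c s x + volterra (\<lambda>r. G r (x, Y n r x)) s" for n s x
    by (simp_all add: Y_def \<T>_def)
  have contG: "continuous_on ({0..1} \<times> K) (\<lambda>(r, x). G r (x, u r x))"
    if "continuous_on ({0..1} \<times> K) (\<lambda>(s, x). u s x)" "\<And>s x. s \<in> {0..1} \<Longrightarrow> x \<in> K \<Longrightarrow> u s x \<in> Z" for u
    by (rule continuous_on_uncurried_compose[OF G that])
  have Y: "continuous_on ({0..1} \<times> K) (\<lambda>(s, x). Y n s x) \<and> (\<forall>s\<in>{0..1}. \<forall>x\<in>K. Y n s x \<in> Z)" for n
  proof (induction n)
    case 0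
    show ?case by (simp add: Y0 Z(2) case_prod_beta)
  next
    case (Suc n)
    then have "continuous_on ({0..1} \<times> K) (\<lambda>(s, x). volterra (\<lambda>r. G r (x, Y n r x)) s)"
      by (intro continuous_on_volterra contG) auto
    from continuous_on_add[OF c this]
    have "continuous_on ({0..1} \<times> K) (\<lambda>(s, x). Y (Suc n) s x)"
      by (simp add: YSuc case_prod_beta)
    moreover have "Y (Suc n) s x \<in> Z" if "s \<in> {0..1}" "x \<in> K" for s x
      unfolding YSuc using Suc continuous_on_slice[of "{0..1}" K "Y n" x] that
      by (intro self) auto
    ultimately show ?case by blast
  qed
  have contract: "norm ((volterra (\<lambda>r. G r (x, u r x)) s) - (volterra (\<lambda>r. G r (x, w r x)) s)) \<le> B / 2"
    if u: "continuous_on ({0..1} \<times> K) (\<lambda>(s, x). u s x)" "\<And>s x. s \<in> {0..1} \<Longrightarrow> x \<in> K \<Longrightarrow> u s x \<in> Z"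
      and w: "continuous_on ({0..1} \<times> K) (\<lambda>(s, x). w s x)" "\<And>s x. s \<in> {0..1} \<Longrightarrow> x \<in> K \<Longrightarrow> w s x \<in> Z"
      and B: "\<And>r. r \<in> {0..1} \<Longrightarrow> norm (u r x - w r x) \<le> B" and s: "s \<in> {0..1}" and x: "x \<in> K"
    for u w s x B
  proof -
    note cu = continuous_on_slice[OF contG[OF u] x] and cw = continuous_on_slice[OF contG[OF w] x]
    have "norm (volterra (\<lambda>r. G r (x, u r x) - G r (x, w r x)) s) \<le> B / 2"
    proof (rule volterra_norm_le[OF continuous_on_diff[OF cu cw] s])
      fix r :: real assume r: "r \<in> {0..1}"
      have "norm (G r (x, u r x) - G r (x, w r x)) \<le> norm (u r x - w r x) / 2"
        by (rule lip[OF r x u(2)[OF r x] w(2)[OF r x]])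
      with B[OF r] show "norm (G r (x, u r x) - G r (x, w r x)) \<le> B / 2" by simp
    qed
    then show ?thesis using volterra_diff[OF cu cw s] by simp
  qed
  \<comment> \<open>Compactness of \<open>K\<close> enters here: the first two iterates differ by a
    bounded amount \<open>M\<close>, and every later difference is at most half the one
    before.\<close>
  have "compact ({0..1::real} \<times> K)" by (intro compact_Times K compact_Icc)
  moreover have "continuous_on ({0..1} \<times> K) (\<lambda>p. (case p of (s, x) \<Rightarrow> Y 1 s x) - (case p of (s, x) \<Rightarrow> Y 0 s x))"
    by (intro continuous_on_diff Y[THEN conjunct1])
  ultimately have "bounded ((\<lambda>p. (case p of (s, x) \<Rightarrow> Y 1 s x) - (case p of (s, x) \<Rightarrow> Y 0 s x)) ` ({0..1} \<times> K))"
    using compact_continuous_image compact_imp_bounded by blast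
  then obtain M where M: "\<And>s x. s \<in> {0..1} \<Longrightarrow> x \<in> K \<Longrightarrow> norm (Y 1 s x - Y 0 s x) \<le> M"
    unfolding bounded_iff by fastforce
  have diff: "norm (Y (Suc n) s x - Y n s x) \<le> M * (1 / 2) ^ n" if "s \<in> {0..1}" "x \<in> K" for n s x
    using that
  proof (induction n arbitrary: s x)
    case 0
    then show ?case using M by simp
  next
    case (Suc n)
    have "norm ((volterra (\<lambda>r. G r (x, Y (Suc n) r x)) s) - (volterra (\<lambda>r. G r (x, Y n r x)) s))
        \<le> (M * (1 / 2) ^ n) / 2"
      using Y Suc by (intro contract) blast+
    then show ?case by (simp add: YSuc)
  qed
  have "summable (\<lambda>n. M * (1 / 2 :: real) ^ n)"
    by (intro summable_mult summable_geometric) simp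
  from Weierstrass_m_test[of "{0..1} \<times> K" "\<lambda>n p. Y (Suc n) (fst p) (snd p) - Y n (fst p) (snd p)", OF _ this] diff
  obtain D where "uniform_limit ({0..1} \<times> K)
      (\<lambda>n p. \<Sum>i<n. Y (Suc i) (fst p) (snd p) - Y i (fst p) (snd p)) D sequentially"
    by fastforce
  then have "uniform_limit ({0..1} \<times> K) (\<lambda>n p. Y n (fst p) (snd p) - z0) D sequentially"
    by (subst (asm) sum_lessThan_telescope) (simp add: Y0)
  moreover have "uniform_limit ({0..1} \<times> K) (\<lambda>n p. z0) (\<lambda>p. z0) sequentially"
    by (rule uniform_limitI) simp
  ultimately have "uniform_limit ({0..1} \<times> K) (\<lambda>n p. (Y n (fst p) (snd p) - z0) + z0) (\<lambda>p. D p + z0) sequentially"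
    by (rule uniform_limit_add)
  then have lim: "uniform_limit ({0..1} \<times> K) (\<lambda>n p. Y n (fst p) (snd p)) (\<lambda>p. D p + z0) sequentially"
    by simp
  define y where "y s x = D (s, x) + z0" for s x
  have cy: "continuous_on ({0..1} \<times> K) (\<lambda>(s, x). y s x)"
    using uniform_limit_theorem[OF _ lim] Y by (simp add: y_def case_prod_beta)
  have conv: "(\<lambda>n. Y n s x) \<longlonglongrightarrow> y s x" if "s \<in> {0..1}" "x \<in> K" for s x
    using tendsto_uniform_limitI[OF lim, of "(s, x)"] that by (simp add: y_def)
  have yZ: "y s x \<in> Z" if "s \<in> {0..1}" "x \<in> K" for s x
    by (rule closed_sequentially[OF Z(1) _ conv[OF that]]) (use Y that in blast)
  have "y s x = c s x + volterra (\<lambda>r. G r (x, y r x)) s" if sx: "s \<in> {0..1}" "x \<in> K" for s x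
  proof (rule LIMSEQ_unique)
    show "(\<lambda>n. Y (Suc n) s x) \<longlonglongrightarrow> y s x"
      using conv[OF sx] by (rule LIMSEQ_Suc)
    show "(\<lambda>n. Y (Suc n) s x) \<longlonglongrightarrow> c s x + volterra (\<lambda>r. G r (x, y r x)) s"
    proof (rule LIMSEQ_I)
      fix e :: real assume e: "e > 0"
      from uniform_limitD[OF lim e] obtain N where
        N: "\<And>n p. n \<ge> N \<Longrightarrow> p \<in> {0..1} \<times> K \<Longrightarrow> dist (Y n (fst p) (snd p)) (D p + z0) < e"
        unfolding eventually_sequentially by blast
      show "\<exists>no. \<forall>n\<ge>no. norm (Y (Suc n) s x - (c s x + volterra (\<lambda>r. G r (x, y r x)) s)) < e"
      proof (intro exI[of _ N] allI impI)
        fix n assume n: "n \<ge> N"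
        have "norm (volterra (\<lambda>r. G r (x, Y n r x)) s - volterra (\<lambda>r. G r (x, y r x)) s) \<le> e / 2"
        proof (rule contract[OF _ _ cy yZ _ sx])
          show "norm (Y n r x - y r x) \<le> e" if "r \<in> {0..1}" for r
            using N[OF n, of "(r, x)"] that sx(2) by (simp add: y_def dist_norm)
        qed (use Y in auto)
        with e show "norm (Y (Suc n) s x - (c s x + volterra (\<lambda>r. G r (x, y r x)) s)) < e"
          by (simp add: YSuc)
      qed
    qed
  qed
  with cy yZ that show thesis by blast
qed

text \<open>
  The derivative of a solution in a fixed direction solves the linearised equation, which has the
  same form and the same contraction constant; hence the induction on the order.
\<close>

lemma volterra_smooth:
  fixes y c :: "real \<Rightarrow> 'a::euclidean_space \<Rightarrow> 'b::euclidean_space"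
    and F :: "real \<Rightarrow> 'a \<times> 'b \<Rightarrow> 'b"
  assumes "open V" "open Z"
    and "param_Ck k {0..1} V c" "param_Ck k {0..1} (V \<times> Z) F"
    and "\<And>s x z z'. s \<in> {0..1} \<Longrightarrow> x \<in> V \<Longrightarrow> z \<in> Z \<Longrightarrow> z' \<in> Z \<Longrightarrow>
        norm (F s (x, z) - F s (x, z')) \<le> norm (z - z') / 2"
    and "continuous_on ({0..1} \<times> V) (\<lambda>(s, x). y s x)"
    and "\<And>s x. s \<in> {0..1} \<Longrightarrow> x \<in> V \<Longrightarrow> y s x \<in> Z"
    and "\<And>s x. s \<in> {0..1} \<Longrightarrow> x \<in> V \<Longrightarrow> y s x = c s x + volterra (\<lambda>r. F r (x, y r x)) s"
  shows "param_Ck k {0..1} V y"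
  using assms
proof (induction k arbitrary: V Z c F y)
  case 0
  then show ?case by simp
next
  case (Suc k)
  note V = Suc.prems(1) and Z = Suc.prems(2) and cS = Suc.prems(3) and FS = Suc.prems(4)
    and lip = Suc.prems(5) and conty = Suc.prems(6) and yZ = Suc.prems(7) and eqy = Suc.prems(8)
  have VZ: "open (V \<times> Z)" using V Z by (rule open_Times)
  \<comment> \<open>The lower order comes first: the coefficients of the linearised equation contain
    \<open>y\<close> itself, and their class is known only after this.\<close>
  have yk: "param_Ck k {0..1} V y"
    by (rule Suc.IH[OF V Z param_Ck_Suc_imp[OF cS] param_Ck_Suc_imp[OF FS] lip conty yZ eqy])
  from cS obtain c' where
    c': "\<And>s x. s \<in> {0..1} \<Longrightarrow> x \<in> V \<Longrightarrow> (c s has_derivative c' s x) (at x)"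
      "\<And>v. param_Ck k {0..1} V (\<lambda>s x. c' s x v)" by (rule param_Ck_SucE) blast
  from FS obtain F' where
    F': "\<And>s p. s \<in> {0..1} \<Longrightarrow> p \<in> V \<times> Z \<Longrightarrow> (F s has_derivative F' s p) (at p)"
      "\<And>v. param_Ck k {0..1} (V \<times> Z) (\<lambda>s x. F' s x v)" by (rule param_Ck_SucE) blast
  have F'lin: "linear (F' s (x, y s x))" if "s \<in> {0..1}" "x \<in> V" for s x
    using has_derivative_linear[OF F'(1)[OF that(1)]] yZ[OF that] that(2) by blast
  have F'add: "F' s (x, y s x) (v, z) = F' s (x, y s x) (v, 0) + F' s (x, y s x) (0, z)"
    if "s \<in> {0..1}" "x \<in> V" for s x v z
    using linear_add[OF F'lin[OF that], of "(v, 0)" "(0, z)"] by simp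
  have F'half: "norm (F' s (x, y s x) (0, b)) \<le> norm b / 2" if sx: "s \<in> {0..1}" "x \<in> V" for s x b
  proof -
    have "norm (F' s (x, y s x) (0, b)) \<le> 1 / 2 * norm b"
    proof (rule derivative_bound_of_lipschitz[OF Z yZ[OF sx]])
      show "(F s has_derivative F' s (x, y s x)) (at (x, y s x))"
        using F'(1)[OF sx(1)] yZ[OF sx] sx(2) by blast
      show "norm (F s (x, z') - F s (x, y s x)) \<le> 1 / 2 * norm (z' - y s x)" if "z' \<in> Z" for z'
        using lip[OF sx that yZ[OF sx]] by simp
    qed simp
    then show ?thesis by simp
  qed
  \<comment> \<open>Right-hand side of the equation expected for the derivative of \<open>y\<close>
    in direction \<open>v\<close>, with \<open>snd p\<close> in place of that derivative.\<close>
  define G where "G v r p = F' r (fst p, y r (fst p)) (v, snd p)" for v r and p :: "'a \<times> 'b"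
  have F'y: "param_Ck k {0..1} V (\<lambda>r x. F' r (x, y r x) w)" for w
  proof (rule param_Ck_compose[OF F'(2)])
    show "param_Ck k {0..1} V (\<lambda>s x. (x, y s x))"
      by (rule param_Ck_Pair[OF param_Ck_snd_linear[OF bounded_linear_ident] yk])
  qed (use yZ in auto)
  \<comment> \<open>\<open>snd p\<close> enters linearly; its basis expansion leaves
    \<open>F'\<close> in the fixed directions \<open>(0, b)\<close>.\<close>
  have Gk: "param_Ck k {0..1} (V \<times> UNIV) (G v)" for v
  proof -
    have F'yfst: "param_Ck k {0..1} (V \<times> UNIV) (\<lambda>r (p::'a \<times> 'b). F' r (fst p, y r (fst p)) w)" for w
      by (rule param_Ck_compose[OF F'y param_Ck_snd_linear[OF bounded_linear_fst]]) auto
    have "param_Ck k {0..1} (V \<times> UNIV) (\<lambda>r (p::'a \<times> 'b). F' r (fst p, y r (fst p)) (v, 0)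
        + (\<Sum>b\<in>Basis. inner (snd p) b *\<^sub>R F' r (fst p, y r (fst p)) (0, b)))"
      by (intro param_Ck_add F'yfst param_Ck_sum param_Ck_bilinear[OF bounded_bilinear_scaleR]
          param_Ck_snd_linear bounded_linear_compose[OF bounded_linear_inner_left bounded_linear_snd])
    moreover have "F' r (fst p, y r (fst p)) (v, 0)
        + (\<Sum>b\<in>Basis. inner (snd p) b *\<^sub>R F' r (fst p, y r (fst p)) (0, b)) = G v r p"
      if r: "r \<in> {0..1}" and p: "p \<in> V \<times> UNIV" for r and p :: "'a \<times> 'b"
    proof -
      have x: "fst p \<in> V" using p by auto
      note lin = F'lin[OF r x]
      have "(0, snd p) = (\<Sum>b\<in>Basis. inner (snd p) b *\<^sub>R (0::'a, b))"
      proof -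
        have "(\<Sum>b\<in>Basis. inner (snd p) b *\<^sub>R (0::'a, b)) = (\<Sum>b\<in>Basis. (0, inner (snd p) b *\<^sub>R b))" by simp
        also have "\<dots> = (0, \<Sum>b\<in>Basis. inner (snd p) b *\<^sub>R b)" by (simp add: sum_prod)
        finally show ?thesis by (simp add: euclidean_representation)
      qed
      then have "F' r (fst p, y r (fst p)) (0, snd p)
          = (\<Sum>b\<in>Basis. F' r (fst p, y r (fst p)) (inner (snd p) b *\<^sub>R (0, b)))"
        using linear_sum[OF lin] by metis
      then have "F' r (fst p, y r (fst p)) (0, snd p)
          = (\<Sum>b\<in>Basis. inner (snd p) b *\<^sub>R F' r (fst p, y r (fst p)) (0, b))"
        by (simp only: linear_cmul[OF lin])
      then show ?thesis unfolding G_def by (subst F'add[OF r x]) simp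
    qed
    ultimately show ?thesis
      by (rule param_Ck_cong[OF open_Times[OF V open_UNIV], rotated])
  qed
  have Glip: "norm (G v s (x, z) - G v s (x, z')) \<le> norm (z - z') / 2"
    if sx: "s \<in> {0..1}" "x \<in> V" for v s x z z'
  proof -
    have "G v s (x, z) - G v s (x, z') = F' s (x, y s x) (0, z - z')"
      using linear_diff[OF F'lin[OF sx], of "(v, z)" "(v, z')"] by (simp add: G_def)
    with F'half[OF sx] show ?thesis by simp
  qed
  show ?case
  proof (rule param_Ck_local)
    \<comment> \<open>The existence of solutions asks for a compact set of \<open>x\<close>,
      differentiability for an open one: hence a closed ball inside \<open>V\<close> and its
      interior.\<close>
    fix x0 assume "x0 \<in> V"
    with V obtain \<epsilon> where \<epsilon>: "\<epsilon> > 0" "cball x0 \<epsilon> \<subseteq> V" unfolding open_contains_cball by blast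
    let ?B = "ball x0 \<epsilon>"
    have BV: "?B \<subseteq> V" using \<epsilon>(2) ball_subset_cball by blast
    have "\<exists>W. continuous_on ({0..1} \<times> cball x0 \<epsilon>) (\<lambda>(s, x). W s x) \<and>
        (\<forall>s\<in>{0..1}. \<forall>x\<in>cball x0 \<epsilon>. W s x = c' s x v + volterra (\<lambda>r. G v r (x, W r x)) s)" for v
    proof -
      obtain W where "continuous_on ({0..1} \<times> cball x0 \<epsilon>) (\<lambda>(s, x). W s x)"
        "\<And>s x. s \<in> {0..1} \<Longrightarrow> x \<in> cball x0 \<epsilon> \<Longrightarrow> W s x = c' s x v + volterra (\<lambda>r. G v r (x, W r x)) s"
      proof (rule volterra_fixpoint_exists[of "cball x0 \<epsilon>" UNIV 0 "\<lambda>s x. c' s x v" "G v"])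
        show "continuous_on ({0..1} \<times> cball x0 \<epsilon>) (\<lambda>(s, x). c' s x v)"
          by (rule continuous_on_subset[OF param_Ck_continuous[OF c'(2)]]) (use \<epsilon>(2) in blast)
        show "continuous_on ({0..1} \<times> (cball x0 \<epsilon> \<times> UNIV)) (\<lambda>(r, p). G v r p)"
          by (rule continuous_on_subset[OF param_Ck_continuous[OF Gk]]) (use \<epsilon>(2) in blast)
        show "norm (G v s (x, z) - G v s (x, z')) \<le> norm (z - z') / 2"
          if "s \<in> {0..1}" "x \<in> cball x0 \<epsilon>" for s x z z'
          using Glip[OF that(1)] that(2) \<epsilon>(2) by blast
      qed auto
      then show ?thesis by blast
    qed
    then obtain W where
      W: "\<And>v. continuous_on ({0..1} \<times> cball x0 \<epsilon>) (\<lambda>(s, x). W v s x)"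
      and W_eq: "\<And>v s x. s \<in> {0..1} \<Longrightarrow> x \<in> cball x0 \<epsilon> \<Longrightarrow>
          W v s x = c' s x v + volterra (\<lambda>r. G v r (x, W v r x)) s"
      by metis
    have contW: "continuous_on ({0..1} \<times> ?B) (\<lambda>(s, x). W v s x)" for v
      by (rule continuous_on_subset[OF W]) auto
    have Wk: "param_Ck k {0..1} ?B (W v)" for v
    proof (rule Suc.IH[OF open_ball open_UNIV _ _ _ contW])
      show "param_Ck k {0..1} ?B (\<lambda>s x. c' s x v)"
        by (rule param_Ck_subset[OF subset_refl BV c'(2)])
      show "param_Ck k {0..1} (?B \<times> UNIV) (G v)"
        by (rule param_Ck_subset[OF subset_refl _ Gk]) (use BV in blast)
      show "norm (G v s (x, z) - G v s (x, z')) \<le> norm (z - z') / 2"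
        if "s \<in> {0..1}" "x \<in> ?B" for s x z z'
        using Glip[OF that(1)] that(2) BV by blast
      show "W v s x = c' s x v + volterra (\<lambda>r. G v r (x, W v r x)) s"
        if "s \<in> {0..1}" "x \<in> ?B" for s x
        using W_eq[OF that(1)] that(2) by auto
    qed auto
    \<comment> \<open>Only the solutions for basis vectors are combined. This makes \<open>D\<close>
      linear in \<open>v\<close> from the start, and \<open>D_eq\<close> recovers the equation for
      every direction.\<close>
    define D where "D s x v = (\<Sum>b\<in>Basis. inner v b *\<^sub>R W b s x)" for s x v
    have D_cont: "continuous_on {0..1} (\<lambda>s. D s x v)" if "x \<in> ?B" for x v
      unfolding D_def by (intro continuous_intros continuous_on_slice[OF contW that])
    have contF'y: "continuous_on {0..1} (\<lambda>r. F' r (x, y r x) (v, u r))"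
      if u: "continuous_on {0..1} u" and x: "x \<in> V" for x v u
    proof -
      have "continuous_on ({0..1} \<times> ({x} \<times> UNIV)) (\<lambda>(r, p). G v r p)"
        by (rule continuous_on_subset[OF param_Ck_continuous[OF Gk]]) (use x in blast)
      moreover have "continuous_on ({0..1} \<times> {x}) (\<lambda>(s, x). u s)"
      proof -
        have "fst ` ({0..1} \<times> {x}) \<subseteq> {0..1}" by auto
        from continuous_on_compose2[OF u continuous_on_fst[OF continuous_on_id] this]
        show ?thesis by (simp add: case_prod_beta)
      qed
      ultimately have "continuous_on ({0..1} \<times> {x}) (\<lambda>(s, z). G v s (z, u s))"
        by (rule continuous_on_uncurried_compose) simp
      from continuous_on_slice[OF this, of x] show ?thesis by (simp add: G_def)
    qed
    have D_eq: "D s x v = c' s x v + volterra (\<lambda>r. F' r (x, y r x) (v, D r x v)) s"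
      if s: "s \<in> {0..1}" and x: "x \<in> ?B" for s x v
    proof -
      have xV: "x \<in> V" using x BV by blast
      have v: "v = (\<Sum>b\<in>Basis. inner v b *\<^sub>R b)" by (simp add: euclidean_representation)
      have "c' s x v = (\<Sum>b\<in>Basis. inner v b *\<^sub>R c' s x b)"
      proof -
        have lin: "linear (c' s x)" using has_derivative_linear[OF c'(1)[OF s xV]] .
        have "c' s x v = c' s x (\<Sum>b\<in>Basis. inner v b *\<^sub>R b)" by (simp add: euclidean_representation)
        also have "\<dots> = (\<Sum>b\<in>Basis. c' s x (inner v b *\<^sub>R b))" by (rule linear_sum[OF lin])
        finally show ?thesis by (simp only: linear_cmul[OF lin])
      qed
      moreover have "volterra (\<lambda>r. F' r (x, y r x) (v, D r x v)) s
          = (\<Sum>b\<in>Basis. inner v b *\<^sub>R volterra (\<lambda>r. G b r (x, W b r x)) s)"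
      proof -
        have "F' r (x, y r x) (v, D r x v) = (\<Sum>b\<in>Basis. inner v b *\<^sub>R G b r (x, W b r x))"
          if r: "r \<in> {0..1}" for r
        proof -
          note lin = F'lin[OF r xV]
          have "(v, D r x v) = (\<Sum>b\<in>Basis. inner v b *\<^sub>R (b, W b r x))"
          proof -
            have "(\<Sum>b\<in>Basis. inner v b *\<^sub>R (b, W b r x))
                = (\<Sum>b\<in>Basis. (inner v b *\<^sub>R b, inner v b *\<^sub>R W b r x))" by simp
            also have "\<dots> = (\<Sum>b\<in>Basis. inner v b *\<^sub>R b, D r x v)" by (simp only: sum_prod D_def)
            finally show ?thesis by (simp add: euclidean_representation)
          qed
          then have "F' r (x, y r x) (v, D r x v) = (\<Sum>b\<in>Basis. F' r (x, y r x) (inner v b *\<^sub>R (b, W b r x)))"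
            using linear_sum[OF lin] by metis
          then show ?thesis by (simp only: linear_cmul[OF lin] G_def fst_conv snd_conv)
        qed
        then have "volterra (\<lambda>r. F' r (x, y r x) (v, D r x v)) s
            = volterra (\<lambda>r. \<Sum>b\<in>Basis. inner v b *\<^sub>R G b r (x, W b r x)) s"
          using s by (rule volterra_cong)
        also have "\<dots> = (\<Sum>b\<in>Basis. inner v b *\<^sub>R volterra (\<lambda>r. G b r (x, W b r x)) s)"
        proof (rule volterra_sum_scaleR[OF finite_Basis _ s])
          show "continuous_on {0..1} (\<lambda>r. G b r (x, W b r x))" for b
            using contF'y[OF continuous_on_slice[OF contW x] xV] by (simp add: G_def)
        qed
        finally show ?thesis .
      qed
      moreover have "W b s x = c' s x b + volterra (\<lambda>r. G b r (x, W b r x)) s" for b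
        using W_eq[OF s] x by auto
      then have "D s x v = (\<Sum>b\<in>Basis. inner v b *\<^sub>R (c' s x b + volterra (\<lambda>r. G b r (x, W b r x)) s))"
        unfolding D_def by (rule sum.cong[OF refl, OF arg_cong])
      ultimately show ?thesis by (simp add: scaleR_add_right sum.distrib)
    qed
    \<comment> \<open>The error \<open>err\<close> of the linear approximation by \<open>D\<close>
      solves the linearised equation up to a term that is small compared with \<open>norm h\<close>,
      so \<open>contraction_bound\<close> makes \<open>err\<close> itself small compared with
      \<open>norm h\<close>.\<close>
    have deriv: "(y s has_derivative D s x) (at x)" if s: "s \<in> {0..1}" and x: "x \<in> ?B" for s x
    proof -
      have xV: "x \<in> V" using x BV by blast
      define \<kappa> where "\<kappa> r = (x, y r x)" for r
      have \<kappa>cont: "continuous_on {0..1} \<kappa>"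
        unfolding \<kappa>_def by (intro continuous_on_Pair continuous_on_const continuous_on_slice[OF conty xV])
      have \<kappa>mem: "\<kappa> r \<in> V \<times> Z" if "r \<in> {0..1}" for r
        using yZ[OF that xV] xV by (simp add: \<kappa>_def)
      have UF1: "\<exists>d>0. \<forall>r\<in>{0..1}. \<forall>p. norm p < d \<longrightarrow> \<kappa> r + p \<in> V \<times> Z \<and>
          norm (F r (\<kappa> r + p) - F r (\<kappa> r) - F' r (\<kappa> r) p) \<le> e * norm p" if "e > 0" for e
        by (rule uniform_derivative(1)[OF compact_Icc VZ F'(1) param_Ck_continuous[OF F'(2)] \<kappa>cont \<kappa>mem];
            (assumption | rule that))
      have UF2: "\<exists>C\<ge>0. \<forall>r\<in>{0..1}. \<forall>p. norm (F' r (\<kappa> r) p) \<le> C * norm p"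
        by (rule uniform_derivative(2)[OF compact_Icc VZ F'(1) param_Ck_continuous[OF F'(2)] \<kappa>cont \<kappa>mem])
      have Uc1: "\<exists>d>0. \<forall>r\<in>{0..1}. \<forall>h. norm h < d \<longrightarrow> x + h \<in> V \<and>
          norm (c r (x + h) - c r x - c' r x h) \<le> e * norm h" if "e > 0" for e
        by (rule uniform_derivative(1)[OF compact_Icc V c'(1) param_Ck_continuous[OF c'(2)]
              continuous_on_const[of _ x] xV]; (assumption | rule that))
      have Uc2: "\<exists>C\<ge>0. \<forall>r\<in>{0..1}. \<forall>h. norm (c' r x h) \<le> C * norm h"
        by (rule uniform_derivative(2)[OF compact_Icc V c'(1) param_Ck_continuous[OF c'(2)]
              continuous_on_const[of _ x] xV])
      obtain C1 where C10: "C1 \<ge> 0" "\<forall>r\<in>{0..1}. \<forall>h. norm (c' r x h) \<le> C1 * norm h"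
        using Uc2 by (elim exE conjE)
      note C1 = C10(1) C10(2)[rule_format]
      obtain C2 where C20: "C2 \<ge> 0" "\<forall>r\<in>{0..1}. \<forall>p. norm (F' r (\<kappa> r) p) \<le> C2 * norm p"
        using UF2 by (elim exE conjE)
      note C2 = C20(1) C20(2)[rule_format]
      have one: "(0::real) < 1" by simp
      obtain dc where dc0: "dc > 0" "\<forall>r\<in>{0..1}. \<forall>h. norm h < dc \<longrightarrow> x + h \<in> V \<and>
            norm (c r (x + h) - c r x - c' r x h) \<le> 1 * norm h"
          using Uc1[OF one] by (elim exE conjE)
        note dc = dc0(1) dc0(2)[rule_format]
      obtain dF where dF0: "dF > 0" "\<forall>r\<in>{0..1}. \<forall>p. norm p < dF \<longrightarrow> \<kappa> r + p \<in> V \<times> Z \<and>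
            norm (F r (\<kappa> r + p) - F r (\<kappa> r) - F' r (\<kappa> r) p) \<le> 1 * norm p"
          using UF1[OF one] by (elim exE conjE)
        note dF = dF0(1) dF0(2)[rule_format, THEN conjunct2]
      \<comment> \<open>The increment in \<open>x\<close> costs 1 + C1 for \<open>c\<close> and 1 +
        C2 for \<open>F\<close> at fixed second argument, each 1 being the remainder at tolerance 1.
        The contraction doubles the sum, which makes \<open>L\<close> a Lipschitz constant of
        \<open>y\<close> in \<open>x\<close>.\<close>
      define A where "A = (1 + C1) + (1 + C2)"
      define L where "L = 2 * A"
      have L: "L \<ge> 0" using C1(1) C2(1) by (simp add: L_def A_def)
      show ?thesis unfolding has_derivative_at_alt
      proof (intro conjI allI impI)
        show "bounded_linear (D s x)"
          unfolding D_def[abs_def]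
          by (intro bounded_linear_sum bounded_linear_scaleR_const bounded_linear_inner_left)
        fix e :: real assume e: "e > 0"
        \<comment> \<open>The joint increment \<open>(h, \<Delta> t)\<close> has norm at most 1 + L
          times \<open>norm h\<close>, so with tolerance \<open>e1\<close> the remainder of
          \<open>F\<close> is at most e/4 times \<open>norm h\<close>. The remainder of
          \<open>c\<close> adds another e/4, and the contraction doubles the sum e/2 to e.\<close>
        define e1 where "e1 = e / (4 * (1 + L))"
        have e1: "e1 > 0" using e L by (simp add: e1_def)
        obtain d1 where d10: "d1 > 0" "\<forall>r\<in>{0..1}. \<forall>p. norm p < d1 \<longrightarrow> \<kappa> r + p \<in> V \<times> Z \<and>
            norm (F r (\<kappa> r + p) - F r (\<kappa> r) - F' r (\<kappa> r) p) \<le> e1 * norm p"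
          using UF1[OF e1] by (elim exE conjE)
        note d1 = d10(1) d10(2)[rule_format, THEN conjunct2]
        have "1 + L \<noteq> 0" using L by simp
        from nonzero_mult_divide_mult_cancel_right[OF this, of e 4]
        have e1L: "e1 * (1 + L) = e / 4"
          by (simp only: e1_def times_divide_eq_left)
        have e4: "e / 4 > 0" using e by simp
        obtain d2 where d20: "d2 > 0" "\<forall>r\<in>{0..1}. \<forall>h. norm h < d2 \<longrightarrow> x + h \<in> V \<and>
            norm (c r (x + h) - c r x - c' r x h) \<le> (e / 4) * norm h"
          using Uc1[OF e4] by (elim exE conjE)
        note d2 = d20(1) d20(2)[rule_format, THEN conjunct2]
        define d where "d = min (min dF dc) (min (d1 / (1 + L)) d2)"
        have d: "d > 0" using dc(1) dF(1) d1(1) d2(1) L by (simp add: d_def)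
        have "norm (y s z - y s x - D s x (z - x)) \<le> e * norm (z - x)" if z: "norm (z - x) < d" for z
        proof -
          define h where "h = z - x"
          have zh: "z = x + h" by (simp add: h_def)
          have hd: "norm h < dF" "norm h < dc" "norm h < d1 / (1 + L)" "norm h < d2"
            using z by (simp_all add: d_def h_def)
          have zV: "z \<in> V" using dc(2)[OF s hd(2)] by (simp add: zh)
          define \<Delta> where "\<Delta> r = y r z - y r x" for r
          have yr: "continuous_on {0..1} (\<lambda>r. y r z)" "continuous_on {0..1} (\<lambda>r. y r x)"
            by (rule continuous_on_slice[OF conty zV], rule continuous_on_slice[OF conty xV])
          have cont\<Delta>: "continuous_on {0..1} \<Delta>"
            unfolding \<Delta>_def by (rule continuous_on_diff[OF yr])
          have Fr: "continuous_on {0..1} (\<lambda>r. F r (u, y r u))" if "u \<in> V" for u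
            using continuous_on_slice[OF continuous_on_uncurried_compose[OF param_Ck_continuous[OF FS] conty yZ] that] .
          have cbound: "norm (c r z - c r x) \<le> (1 + C1) * norm h" if r: "r \<in> {0..1}" for r
          proof -
            have "norm (c r z - c r x - c' r x h) \<le> norm h" using dc(2)[OF r hd(2)] by (simp add: zh)
            then show ?thesis
              using C1(2)[OF r, of h] norm_triangle_sub[of "c r z - c r x" "c' r x h"]
              by (simp add: algebra_simps)
          qed
          have Fbound: "norm (F r (z, y r x) - F r (x, y r x)) \<le> (1 + C2) * norm h" if r: "r \<in> {0..1}" for r
          proof -
            have "norm (F r (z, y r x) - F r (x, y r x) - F' r (\<kappa> r) (h, 0)) \<le> norm h"
              using dF(2)[OF r, of "(h, 0)"] hd(1) by (simp add: zh \<kappa>_def norm_Pair)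
            moreover have "norm (F' r (\<kappa> r) (h, 0)) \<le> C2 * norm h"
              using C2(2)[OF r, of "(h, 0)"] by (simp add: norm_Pair)
            ultimately show ?thesis
              using norm_triangle_sub[of "F r (z, y r x) - F r (x, y r x)" "F' r (\<kappa> r) (h, 0)"]
              by (simp add: algebra_simps)
          qed
          have \<Delta>L: "norm (\<Delta> r) \<le> L * norm h" if r: "r \<in> {0..1}" for r
          proof -
            have "norm (\<Delta> r) \<le> 2 * (A * norm h)"
            proof (rule contraction_bound[OF compact_Icc cont\<Delta> _ r])
              fix M and r :: real
              assume M: "\<And>s. s \<in> {0..1} \<Longrightarrow> norm (\<Delta> s) \<le> M" and r: "r \<in> {0..1}"
              have "\<Delta> r = (c r z - c r x) + volterra (\<lambda>t. F t (z, y t z) - F t (x, y t x)) r"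
                using volterra_diff[OF Fr[OF zV] Fr[OF xV] r] eqy[OF r zV] eqy[OF r xV]
                by (simp add: \<Delta>_def)
              moreover have "norm (volterra (\<lambda>t. F t (z, y t z) - F t (x, y t x)) r) \<le> M / 2 + (1 + C2) * norm h"
              proof (rule volterra_norm_le[OF continuous_on_diff[OF Fr[OF zV] Fr[OF xV]] r])
                fix t :: real assume t: "t \<in> {0..1}"
                have "norm (F t (z, y t z) - F t (z, y t x)) \<le> norm (\<Delta> t) / 2"
                  using lip[OF t zV yZ[OF t zV] yZ[OF t xV]] by (simp add: \<Delta>_def)
                with M[OF t] have 1: "norm (F t (z, y t z) - F t (z, y t x)) \<le> M / 2" by simp
                have "norm (F t (z, y t z) - F t (x, y t x))
                    \<le> norm (F t (z, y t z) - F t (z, y t x)) + norm (F t (z, y t x) - F t (x, y t x))"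
                  using norm_triangle_ineq[of "F t (z, y t z) - F t (z, y t x)" "F t (z, y t x) - F t (x, y t x)"]
                  by simp
                with 1 Fbound[OF t]
                show "norm (F t (z, y t z) - F t (x, y t x)) \<le> M / 2 + (1 + C2) * norm h" by linarith
              qed
              ultimately have "norm (\<Delta> r) \<le> (1 + C1) * norm h + (M / 2 + (1 + C2) * norm h)"
                using cbound[OF r] by (simp only:) (rule norm_triangle_le, rule add_mono)
              then show "norm (\<Delta> r) \<le> A * norm h + M / 2"
                by (simp add: A_def algebra_simps)
            qed
            then show ?thesis by (simp add: L_def)
          qed
          define err where "err r = \<Delta> r - D r x h" for r
          have conterr: "continuous_on {0..1} err"
            unfolding err_def by (rule continuous_on_diff[OF cont\<Delta> D_cont[OF x]])
          have "norm (err s) \<le> 2 * (e / 2 * norm h)"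
          proof (rule contraction_bound[OF compact_Icc conterr _ s])
            fix M and r :: real
            assume M: "\<And>s. s \<in> {0..1} \<Longrightarrow> norm (err s) \<le> M" and r: "r \<in> {0..1}"
            note cF' = contF'y[OF D_cont[OF x] xV, of h h]
            have "err r = (c r z - c r x - c' r x h)
                + volterra (\<lambda>t. (F t (z, y t z) - F t (x, y t x)) - F' t (x, y t x) (h, D t x h)) r"
              using volterra_diff[OF Fr[OF zV] Fr[OF xV] r] eqy[OF r zV] eqy[OF r xV] D_eq[OF r x, of h]
                volterra_diff[OF continuous_on_diff[OF Fr[OF zV] Fr[OF xV]] cF' r]
              by (simp add: \<Delta>_def err_def)
            moreover have c4: "norm (c r z - c r x - c' r x h) \<le> e / 4 * norm h"
              using d2(2)[OF r hd(4)] by (simp add: zh)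
            moreover have v4: "norm (volterra (\<lambda>t. (F t (z, y t z) - F t (x, y t x)) - F' t (x, y t x) (h, D t x h)) r)
                \<le> e / 4 * norm h + M / 2"
            proof (rule volterra_norm_le[OF continuous_on_diff[OF continuous_on_diff[OF Fr[OF zV] Fr[OF xV]] cF'] r])
              fix t :: real assume t: "t \<in> {0..1}"
              have n: "norm (h, \<Delta> t) \<le> (1 + L) * norm h"
                using norm_Pair_le[of h "\<Delta> t"] \<Delta>L[OF t] by (simp add: algebra_simps)
              also have "\<dots> < d1" using hd(3) L by (simp add: pos_less_divide_eq mult.commute)
              finally have "norm (F t (\<kappa> t + (h, \<Delta> t)) - F t (\<kappa> t) - F' t (\<kappa> t) (h, \<Delta> t)) \<le> e1 * norm (h, \<Delta> t)"
                by (rule d1(2)[OF t])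
              also have "\<dots> \<le> e1 * ((1 + L) * norm h)" using n e1 by (intro mult_left_mono) auto
              also have "\<dots> = e / 4 * norm h" by (simp only: mult.assoc[symmetric] e1L)
              finally have E: "norm (F t (z, y t z) - F t (x, y t x) - F' t (x, y t x) (h, \<Delta> t)) \<le> e / 4 * norm h"
                by (simp add: \<kappa>_def zh \<Delta>_def)
              have "F' t (x, y t x) (h, \<Delta> t) - F' t (x, y t x) (h, D t x h) = F' t (x, y t x) (0, err t)"
                using linear_diff[OF F'lin[OF t xV], of "(h, \<Delta> t)" "(h, D t x h)"] by (simp add: err_def)
              then have "(F t (z, y t z) - F t (x, y t x)) - F' t (x, y t x) (h, D t x h)
                = (F t (z, y t z) - F t (x, y t x) - F' t (x, y t x) (h, \<Delta> t)) + F' t (x, y t x) (0, err t)"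
                by (simp add: algebra_simps)
              moreover have "norm (F' t (x, y t x) (0, err t)) \<le> M / 2"
                using F'half[OF t xV, of "err t"] M[OF t] by simp
              from norm_triangle_le[OF add_mono[OF E this]] calculation
              show "norm ((F t (z, y t z) - F t (x, y t x)) - F' t (x, y t x) (h, D t x h))
                  \<le> e / 4 * norm h + M / 2"
                by (simp only:)
            qed
            ultimately have "norm (err r) \<le> e / 4 * norm h + (e / 4 * norm h + M / 2)"
              using norm_triangle_le[OF add_mono[OF c4 v4]] by (simp only:)
            then show "norm (err r) \<le> e / 2 * norm h + M / 2" by simp
          qed
          then show ?thesis by (simp add: err_def \<Delta>_def h_def)
        qed
        with d show "\<exists>d>0. \<forall>z. norm (z - x) < d \<longrightarrow> norm (y s z - y s x - D s x (z - x)) \<le> e * norm (z - x)"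
          by blast
      qed
    qed
    have "param_Ck (Suc k) {0..1} ?B y"
    proof (rule param_Ck_SucI[OF _ deriv])
      show "continuous_on ({0..1} \<times> ?B) (\<lambda>(s, x). y s x)"
        by (rule continuous_on_subset[OF conty]) (use BV in blast)
      show "param_Ck k {0..1} ?B (\<lambda>s x. D s x v)" for v
        unfolding D_def
        by (intro param_Ck_sum param_Ck_linear[OF bounded_linear_scaleR_right] Wk)
    qed
    with \<epsilon>(1) BV show "\<exists>V'. open V' \<and> x0 \<in> V' \<and> V' \<subseteq> V \<and> param_Ck (Suc k) {0..1} V' y"
      by (intro exI[of _ ?B]) simp
  qed
qed

subsection \<open>Smooth functions\<close>

lemma smooth_on_param_Ck:
  assumes "open U" "smooth_on U \<theta>"
  shows "param_Ck k T U (\<lambda>_. \<theta>)"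
  using assms param_Ck_independent unfolding smooth_on_def by blast

lemma smooth_onI_param_Ck:
  assumes "open U" "\<And>k. param_Ck k {0} U (\<lambda>_. \<theta>)"
  shows "smooth_on U \<theta>"
  unfolding smooth_on_def using param_Ck_imp_k_times[OF assms(1) assms(2), of 0] by simp

lemma smooth_on_param_slice:
  assumes "open U" "\<And>k. param_Ck k T U w" "s \<in> T"
  shows "smooth_on U (w s)"
  unfolding smooth_on_def using param_Ck_imp_k_times[OF assms(1) assms(2) assms(3)] by simp

lemma smooth_on_has_derivative:
  assumes "smooth_on U \<theta>" "x \<in> U"
  shows "(\<theta> has_derivative frechet_derivative \<theta> (at x)) (at x)"
proof -
  have "k_times_differentiable_on (Suc 0) U \<theta>" using assms(1) unfolding smooth_on_def by blast
  then have "\<theta> differentiable (at x)" using assms(2) by simp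
  then show ?thesis by (simp add: frechet_derivative_works)
qed

lemma smooth_on_imp_continuous_on:
  assumes "smooth_on U \<theta>"
  shows "continuous_on U \<theta>"
proof -
  have "k_times_differentiable_on 0 U \<theta>" using assms unfolding smooth_on_def by blast
  then show ?thesis by simp
qed

lemma smooth_on_frechet_derivative:
  assumes "smooth_on U \<theta>"
  shows "smooth_on U (\<lambda>x. frechet_derivative \<theta> (at x) v)"
  unfolding smooth_on_def
proof
  fix k
  have "k_times_differentiable_on (Suc k) U \<theta>" using assms unfolding smooth_on_def by blast
  then show "k_times_differentiable_on k U (\<lambda>x. frechet_derivative \<theta> (at x) v)" by simp
qed

lemma smooth_on_cong:
  assumes "open U" "smooth_on U f" "\<And>x. x \<in> U \<Longrightarrow> f x = g x"
  shows "smooth_on U g"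
  unfolding smooth_on_def
proof
  fix k
  have "k_times_differentiable_on k U f" using assms(2) unfolding smooth_on_def by blast
  from k_times_differentiable_on_cong[OF assms(1) assms(3) this]
  show "k_times_differentiable_on k U g" .
qed

lemma smooth_on_subset:
  assumes "open U" "smooth_on U f" "open V" "V \<subseteq> U"
  shows "smooth_on V f"
  by (rule smooth_onI_param_Ck[OF assms(3) param_Ck_subset[OF subset_refl assms(4) smooth_on_param_Ck[OF assms(1,2)]]])

lemma smooth_on_const: "open U \<Longrightarrow> smooth_on U (\<lambda>x. c)"
  by (rule smooth_onI_param_Ck) (simp_all add: param_Ck_const)

lemma smooth_on_linear:
  assumes "open U" "bounded_linear L" "smooth_on U f"
  shows "smooth_on U (\<lambda>x. L (f x))"
  by (rule smooth_onI_param_Ck[OF assms(1) param_Ck_linear[OF assms(2) smooth_on_param_Ck[OF assms(1,3)]]])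

lemma smooth_on_bounded_linear:
  assumes "open U" "bounded_linear L"
  shows "smooth_on U L"
  by (rule smooth_onI_param_Ck[OF assms(1) param_Ck_snd_linear[OF assms(2)]])

lemma smooth_on_add:
  assumes "open U" "smooth_on U f" "smooth_on U g"
  shows "smooth_on U (\<lambda>x. f x + g x)"
  by (rule smooth_onI_param_Ck[OF assms(1)
        param_Ck_add[OF smooth_on_param_Ck[OF assms(1,2)] smooth_on_param_Ck[OF assms(1,3)]]])

lemma smooth_on_sum:
  assumes "open U" "\<And>i. i \<in> I \<Longrightarrow> smooth_on U (f i)"
  shows "smooth_on U (\<lambda>x. \<Sum>i\<in>I. f i x)"
  by (rule smooth_onI_param_Ck[OF assms(1) param_Ck_sum[OF smooth_on_param_Ck[OF assms(1,2)]]])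

lemma smooth_on_bilinear:
  assumes "open U" "bounded_bilinear pr" "smooth_on U f" "smooth_on U g"
  shows "smooth_on U (\<lambda>x. pr (f x) (g x))"
  by (rule smooth_onI_param_Ck[OF assms(1) param_Ck_bilinear[OF assms(2)
          smooth_on_param_Ck[OF assms(1,3)] smooth_on_param_Ck[OF assms(1,4)]]])

lemma smooth_on_mult:
  fixes f g :: "'a::real_normed_vector \<Rightarrow> 'b::real_normed_algebra"
  assumes "open U" "smooth_on U f" "smooth_on U g"
  shows "smooth_on U (\<lambda>x. f x * g x)"
  by (rule smooth_on_bilinear[OF assms(1) bounded_bilinear_mult assms(2,3)])

lemma smooth_on_uminus: "open U \<Longrightarrow> smooth_on U f \<Longrightarrow> smooth_on U (\<lambda>x. - f x)"
  by (rule smooth_on_linear[OF _ bounded_linear_minus[OF bounded_linear_ident]])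

lemma smooth_on_diff:
  assumes "open U" "smooth_on U f" "smooth_on U g"
  shows "smooth_on U (\<lambda>x. f x - g x)"
  using smooth_on_add[OF assms(1,2) smooth_on_uminus[OF assms(1,3)]] by simp

lemma smooth_on_prod:
  fixes f :: "'i \<Rightarrow> 'a::real_normed_vector \<Rightarrow> real"
  assumes "open U" "\<And>i. i \<in> I \<Longrightarrow> smooth_on U (f i)"
  shows "smooth_on U (\<lambda>x. \<Prod>i\<in>I. f i x)"
  using assms(2)
  by (induction I rule: infinite_finite_induct)
    (simp_all add: smooth_on_const smooth_on_mult assms(1))

lemma smooth_on_compose:
  fixes f :: "'a::real_normed_vector \<Rightarrow> 'c::euclidean_space"
  assumes "open U" "open W" "smooth_on W g" "smooth_on U f" "\<And>x. x \<in> U \<Longrightarrow> f x \<in> W"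
  shows "smooth_on U (\<lambda>x. g (f x))"
  by (rule smooth_onI_param_Ck[OF assms(1) param_Ck_compose[OF smooth_on_param_Ck[OF assms(2,3)]
          smooth_on_param_Ck[OF assms(1,4)] assms(5)]])

text \<open>The derivative is a multiple of the square of the inverse, so each order follows from
  the previous one by the product rule.\<close>

lemma smooth_on_real_inverse: "smooth_on (- {0}) (inverse :: real \<Rightarrow> real)"
proof (rule smooth_onI_param_Ck)
  show op: "open (- {0} :: real set)" by auto
  fix k
  show "param_Ck k {0} (- {0}) (\<lambda>_. inverse :: real \<Rightarrow> real)"
  proof (induction k)
    have c: "continuous_on ({0::real} \<times> (- {0})) (\<lambda>(s::real, x::real). inverse x)"
      by (auto simp: case_prod_beta intro!: continuous_on_inverse continuous_on_snd continuous_on_id)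
    { case 0 show ?case using c by simp }
    case (Suc k)
    show ?case
    proof (rule param_Ck_SucI[OF c])
      show "(inverse has_derivative (\<lambda>v. - (inverse x * v * inverse x))) (at x)" if "x \<in> - {0}" for x :: real
        using that by (intro has_derivative_inverse') simp
      have sq: "param_Ck k {0} (- {0}) (\<lambda>s (x::real). inverse x * inverse x)"
        by (rule param_Ck_bilinear[OF bounded_bilinear_mult Suc Suc])
      show "param_Ck k {0} (- {0}) (\<lambda>s x. - (inverse x * v * inverse x))" for v :: real
        using param_Ck_linear[OF bounded_linear_mult_right sq, of "- v"]
        by (simp add: mult.commute mult.left_commute)
    qed
  qed
qed

lemma smooth_on_divide:
  fixes f g :: "'a::real_normed_vector \<Rightarrow> real"
  assumes "open U" "smooth_on U f" "smooth_on U g" "\<And>x. x \<in> U \<Longrightarrow> g x \<noteq> 0"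
  shows "smooth_on U (\<lambda>x. f x / g x)"
proof -
  have "smooth_on U (\<lambda>x. inverse (g x))"
    by (rule smooth_on_compose[OF assms(1) _ smooth_on_real_inverse assms(3)]) (use assms(4) in auto)
  from smooth_on_mult[OF assms(1,2) this] show ?thesis by (simp add: divide_inverse)
qed

lemma param_Ck_frechet_apply:
  fixes \<theta> :: "'c::euclidean_space \<Rightarrow> 'b::real_normed_vector"
  assumes "open U" "smooth_on U \<theta>" "param_Ck k T V y" "\<And>s x. s \<in> T \<Longrightarrow> x \<in> V \<Longrightarrow> y s x \<in> U"
    "param_Ck k T V w" "open V"
  shows "param_Ck k T V (\<lambda>s x. frechet_derivative \<theta> (at (y s x)) (w s x))"
proof -
  have "param_Ck k T V (\<lambda>s x. frechet_derivative \<theta> (at (y s x)) b)" for b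
    by (rule param_Ck_compose[OF smooth_on_param_Ck[OF assms(1) smooth_on_frechet_derivative[OF assms(2)]] assms(3,4)])
  then have "param_Ck k T V (\<lambda>s x. \<Sum>b\<in>Basis. inner (w s x) b *\<^sub>R frechet_derivative \<theta> (at (y s x)) b)"
    by (intro param_Ck_sum param_Ck_bilinear[OF bounded_bilinear_scaleR]
        param_Ck_linear[OF bounded_linear_inner_left assms(5)])
  moreover have "(\<Sum>b\<in>Basis. inner (w s x) b *\<^sub>R frechet_derivative \<theta> (at (y s x)) b)
      = frechet_derivative \<theta> (at (y s x)) (w s x)" if "s \<in> T" "x \<in> V" for s x
  proof -
    note lin = has_derivative_linear[OF smooth_on_has_derivative[OF assms(2) assms(4)[OF that]]]
    have "frechet_derivative \<theta> (at (y s x)) (w s x)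
        = frechet_derivative \<theta> (at (y s x)) (\<Sum>b\<in>Basis. inner (w s x) b *\<^sub>R b)"
      by (simp only: euclidean_representation)
    also have "\<dots> = (\<Sum>b\<in>Basis. frechet_derivative \<theta> (at (y s x)) (inner (w s x) b *\<^sub>R b))"
      by (rule linear_sum[OF lin])
    finally show ?thesis by (simp only: linear_cmul[OF lin])
  qed
  ultimately show ?thesis by (rule param_Ck_cong[OF assms(6), rotated])
qed

text \<open>Compactness bounds the derivative on each basis vector, and convexity turns the
  resulting bound into a Lipschitz constant.\<close>

lemma smooth_on_derivative_bound:
  fixes X :: "'a::euclidean_space \<Rightarrow> 'b::real_normed_vector"
  assumes "open U" "smooth_on U X" "compact K" "convex K" "K \<subseteq> U"
  obtains L where "L \<ge> 0" "\<And>z b. z \<in> K \<Longrightarrow> norm (frechet_derivative X (at z) b) \<le> L * norm b"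
    "\<And>z z'. z \<in> K \<Longrightarrow> z' \<in> K \<Longrightarrow> norm (X z - X z') \<le> L * norm (z - z')"
proof -
  have "bounded ((\<lambda>z. frechet_derivative X (at z) b) ` K)" for b
    by (intro compact_imp_bounded compact_continuous_image assms(3)
        continuous_on_subset[OF smooth_on_imp_continuous_on[OF smooth_on_frechet_derivative[OF assms(2)]] assms(5)])
  then have "\<forall>b. \<exists>C. \<forall>z\<in>K. norm (frechet_derivative X (at z) b) \<le> C"
    unfolding bounded_iff by auto
  then obtain C where C: "\<And>b z. z \<in> K \<Longrightarrow> norm (frechet_derivative X (at z) b) \<le> C b" by metis
  define L where "L = (\<Sum>b\<in>Basis. \<bar>C b\<bar>)"
  have bd: "norm (frechet_derivative X (at z) v) \<le> L * norm v" if z: "z \<in> K" for z v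
  proof -
    note lin = has_derivative_linear[OF smooth_on_has_derivative[OF assms(2) subsetD[OF assms(5) z]]]
    have "frechet_derivative X (at z) v = frechet_derivative X (at z) (\<Sum>b\<in>Basis. inner v b *\<^sub>R b)"
      by (simp only: euclidean_representation)
    also have "\<dots> = (\<Sum>b\<in>Basis. inner v b *\<^sub>R frechet_derivative X (at z) b)"
      by (simp only: linear_sum[OF lin] linear_cmul[OF lin])
    also have "norm \<dots> \<le> (\<Sum>b\<in>Basis. norm v * \<bar>C b\<bar>)"
    proof (rule sum_norm_le)
      fix b :: 'a assume b: "b \<in> Basis"
      have "norm (frechet_derivative X (at z) b) \<le> \<bar>C b\<bar>" using C[OF z, of b] by linarith
      then show "norm (inner v b *\<^sub>R frechet_derivative X (at z) b) \<le> norm v * \<bar>C b\<bar>"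
        using Basis_le_norm[OF b, of v] by (simp add: mult_mono)
    qed
    finally show ?thesis by (simp add: L_def sum_distrib_left[symmetric] mult.commute)
  qed
  have L: "L \<ge> 0" by (simp add: L_def sum_nonneg)
  show thesis
  proof (rule that[OF L bd])
    fix z z' assume z: "z \<in> K" and z': "z' \<in> K"
    have "norm (X z - X z') \<le> L * norm (z - z')"
    proof (rule differentiable_bound[OF assms(4) _ _ z z'])
      show "(X has_derivative frechet_derivative X (at x)) (at x within K)" if "x \<in> K" for x
        by (rule has_derivative_at_withinI[OF smooth_on_has_derivative[OF assms(2) subsetD[OF assms(5) that]]])
      show "onorm (frechet_derivative X (at x)) \<le> L" if "x \<in> K" for x
        by (rule onorm_bound[OF L bd[OF that]])
    qed
    then show "norm (X z - X z') \<le> L * norm (z - z')" .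
  qed
qed

subsection \<open>First integrals of commuting vector fields\<close>

lemma commuting_fields_first_integrals:
  fixes X :: "nat \<Rightarrow> 'a::euclidean_space \<Rightarrow> 'a" and \<omega> :: "nat \<Rightarrow> 'a \<Rightarrow> real"
  assumes U: "open U" "x0 \<in> U"
    and X: "\<And>i. i < d \<Longrightarrow> smooth_on U (X i)"
    and \<omega>: "\<And>i. i < d \<Longrightarrow> smooth_on U (\<omega> i)"
    and dual: "\<And>i j x. i < d \<Longrightarrow> j < d \<Longrightarrow> x \<in> U \<Longrightarrow>
        frechet_derivative (\<omega> j) (at x) (X i x) = (if i = j then 1 else 0)"
    and comm: "\<And>i j x. i < d \<Longrightarrow> j < d \<Longrightarrow> x \<in> U \<Longrightarrow>
        frechet_derivative (X i) (at x) (X j x) = frechet_derivative (X j) (at x) (X i x)"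
  obtains V \<eta> where "open V" "x0 \<in> V" "V \<subseteq> U" "smooth_on V (\<eta> :: 'a \<Rightarrow> 'a)"
    "\<And>x i. x \<in> V \<Longrightarrow> i < d \<Longrightarrow> frechet_derivative \<eta> (at x) (X i x) = 0"
    "\<And>v. (\<And>j. j < d \<Longrightarrow> frechet_derivative (\<omega> j) (at x0) v = 0) \<Longrightarrow>
        frechet_derivative \<eta> (at x0) v = v"
proof -
  obtain r where r: "r > 0" "cball x0 r \<subseteq> U" using U unfolding open_contains_cball by blast
  define \<sigma> where "\<sigma> j x = \<omega> j x0 - \<omega> j x" for j x
  have \<sigma>: "smooth_on U (\<sigma> j)" if "j < d" for j
    unfolding \<sigma>_def by (intro smooth_on_diff smooth_on_const U \<omega> that)
  have "\<exists>L\<ge>0. (\<forall>z\<in>cball x0 r. \<forall>b. norm (frechet_derivative (X j) (at z) b) \<le> L * norm b) \<and>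
      (\<forall>z\<in>cball x0 r. \<forall>z'\<in>cball x0 r. norm (X j z - X j z') \<le> L * norm (z - z'))" if j: "j < d" for j
  proof -
    obtain L where "L \<ge> 0" "\<And>z b. z \<in> cball x0 r \<Longrightarrow> norm (frechet_derivative (X j) (at z) b) \<le> L * norm b"
      "\<And>z z'. z \<in> cball x0 r \<Longrightarrow> z' \<in> cball x0 r \<Longrightarrow> norm (X j z - X j z') \<le> L * norm (z - z')"
      by (rule smooth_on_derivative_bound[OF U(1) X[OF j] compact_cball convex_cball r(2)]) blast
    then show ?thesis by (intro exI[of _ L]) simp
  qed
  then obtain L where L0: "\<And>j. j < d \<Longrightarrow> L j \<ge> 0"
    and Lder: "\<And>j z b. j < d \<Longrightarrow> z \<in> cball x0 r \<Longrightarrow> norm (frechet_derivative (X j) (at z) b) \<le> L j * norm b"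
    and Llip: "\<And>j z z'. j < d \<Longrightarrow> z \<in> cball x0 r \<Longrightarrow> z' \<in> cball x0 r \<Longrightarrow>
        norm (X j z - X j z') \<le> L j * norm (z - z')"
    by metis
  have "\<exists>M. \<forall>z\<in>cball x0 r. norm (X j z) \<le> M" if "j < d" for j
  proof -
    have "bounded (X j ` cball x0 r)"
      by (intro compact_imp_bounded compact_continuous_image compact_cball
          continuous_on_subset[OF smooth_on_imp_continuous_on[OF X[OF that]] r(2)])
    then show ?thesis unfolding bounded_iff by auto
  qed
  then obtain M where M: "\<And>j z. j < d \<Longrightarrow> z \<in> cball x0 r \<Longrightarrow> norm (X j z) \<le> M j" by metis
  \<comment> \<open>On the ball of radius \<open>r\<close>, \<open>S1 x\<close> is a Lipschitz
    constant and \<open>S2 x\<close> a bound for the field with coefficients frozen at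
    \<open>x\<close>. Both vanish at \<open>x0\<close>, since the \<open>\<sigma> j\<close>
    do.\<close>
  define S1 where "S1 x = (\<Sum>j<d. \<bar>\<sigma> j x\<bar> * L j)" for x
  define S2 where "S2 x = (\<Sum>j<d. \<bar>\<sigma> j x\<bar> * M j)" for x
  have cont\<sigma>: "continuous_on U (\<lambda>x. \<bar>\<sigma> j x\<bar>)" if "j < d" for j
    by (rule continuous_on_rabs[OF smooth_on_imp_continuous_on[OF \<sigma>[OF that]]])
  have cS: "continuous_on U S1" "continuous_on U S2"
    unfolding S1_def[abs_def] S2_def[abs_def]
    by (intro continuous_on_sum continuous_on_mult_right cont\<sigma>; simp)+
  have S0: "S1 x0 = 0" "S2 x0 = 0" by (simp_all add: S1_def S2_def \<sigma>_def)
  \<comment> \<open>The bound 1/2 on \<open>S1\<close> makes the Volterra map a contraction;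
    \<delta> < r/2 together with the bound r/2 on \<open>S2\<close> keeps its values within distance
    r of \<open>x0\<close>.\<close>
  obtain \<delta> where \<delta>: "\<delta> > 0" "cball x0 \<delta> \<subseteq> U" "\<delta> < r / 2"
    "\<And>x. x \<in> cball x0 \<delta> \<Longrightarrow> S1 x \<le> 1 / 2" "\<And>x. x \<in> cball x0 \<delta> \<Longrightarrow> S2 x \<le> r / 2"
  proof -
    have r2: "r / 2 > 0" and half: "(1 / 2 :: real) > 0" using r(1) by simp_all
    have "\<exists>e>0. \<forall>x\<in>U. dist x x0 < e \<longrightarrow> dist (S1 x) (S1 x0) < 1 / 2"
      by (rule cS(1)[unfolded continuous_on_iff, rule_format, OF U(2) half])
    then obtain e1 where e1: "e1 > 0" "\<forall>x\<in>U. dist x x0 < e1 \<longrightarrow> dist (S1 x) (S1 x0) < 1 / 2" by blast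
    have "\<exists>e>0. \<forall>x\<in>U. dist x x0 < e \<longrightarrow> dist (S2 x) (S2 x0) < r / 2"
      by (rule cS(2)[unfolded continuous_on_iff, rule_format, OF U(2) r2])
    then obtain e2 where e2: "e2 > 0" "\<forall>x\<in>U. dist x x0 < e2 \<longrightarrow> dist (S2 x) (S2 x0) < r / 2" by blast
    \<comment> \<open>Half the minimum, so that the closed ball of radius \<delta> satisfies the
      strict inequalities.\<close>
    define \<delta> where "\<delta> = min (min e1 e2) (r / 2) / 2"
    have \<delta>: "\<delta> > 0" "\<delta> < e1" "\<delta> < e2" "\<delta> < r / 2" "\<delta> \<le> r"
      using e1(1) e2(1) r(1) by (auto simp: \<delta>_def min_def)
    have sub: "cball x0 \<delta> \<subseteq> U" using r(2) \<delta>(5) subset_cball[OF \<delta>(5), of x0] by blast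
    have *: "x \<in> U \<and> dist x x0 < e1 \<and> dist x x0 < e2" if "x \<in> cball x0 \<delta>" for x
      using that sub \<delta> by (auto simp: dist_commute)
    show thesis
    proof (rule that[OF \<delta>(1) sub \<delta>(4)])
      show "S1 x \<le> 1 / 2" if "x \<in> cball x0 \<delta>" for x
        using e1(2) *[OF that] S0 by (auto simp: dist_real_def abs_le_iff)
      show "S2 x \<le> r / 2" if "x \<in> cball x0 \<delta>" for x
        using e2(2) *[OF that] S0 by (auto simp: dist_real_def abs_le_iff)
    qed
  qed
  define F where "F p = (\<Sum>j<d. \<sigma> j (fst p) *\<^sub>R X j (snd p))" for p
  have FS: "smooth_on (U \<times> U) F"
    unfolding F_def[abs_def]
    by (intro smooth_on_sum open_Times U smooth_on_bilinear[OF _ bounded_bilinear_scaleR]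
        smooth_on_compose[OF _ U(1) \<sigma>] smooth_on_compose[OF _ U(1) X]
        smooth_on_bounded_linear bounded_linear_fst bounded_linear_snd) auto
  have Flip: "norm (F (x, z) - F (x, z')) \<le> norm (z - z') / 2"
    if "x \<in> cball x0 \<delta>" "z \<in> cball x0 r" "z' \<in> cball x0 r" for x z z'
  proof -
    have "F (x, z) - F (x, z') = (\<Sum>j<d. \<sigma> j x *\<^sub>R (X j z - X j z'))"
      by (simp add: F_def sum_subtractf scaleR_diff_right)
    also have "norm \<dots> \<le> (\<Sum>j<d. (\<bar>\<sigma> j x\<bar> * L j) * norm (z - z'))"
    proof (rule sum_norm_le)
      fix j assume "j \<in> {..<d}"
      then show "norm (\<sigma> j x *\<^sub>R (X j z - X j z')) \<le> (\<bar>\<sigma> j x\<bar> * L j) * norm (z - z')"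
        using Llip[OF _ that(2,3), of j] by (simp add: mult_left_mono mult.assoc)
    qed
    also have "\<dots> = S1 x * norm (z - z')" by (simp add: S1_def sum_distrib_right)
    also have "\<dots> \<le> 1 / 2 * norm (z - z')" by (intro mult_right_mono \<delta>(4) that) simp
    finally show ?thesis by simp
  qed
  have Fbd: "norm (F (x, z)) \<le> r / 2" if "x \<in> cball x0 \<delta>" "z \<in> cball x0 r" for x z
  proof -
    have "norm (F (x, z)) \<le> (\<Sum>j<d. \<bar>\<sigma> j x\<bar> * M j)"
      unfolding F_def
    proof (rule sum_norm_le)
      fix j assume "j \<in> {..<d}"
      then show "norm (\<sigma> j (fst (x, z)) *\<^sub>R X j (snd (x, z))) \<le> \<bar>\<sigma> j x\<bar> * M j"
        using M[OF _ that(2), of j] by (simp add: mult_left_mono)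
    qed
    with \<delta>(5)[OF that(1)] show ?thesis by (simp add: S2_def)
  qed
  have cF: "continuous_on (U \<times> U) F" by (rule smooth_on_imp_continuous_on[OF FS])
  have cFs: "continuous_on ({0..1::real} \<times> (cball x0 \<delta> \<times> cball x0 r)) (\<lambda>(s, p). F p)"
  proof -
    have "snd ` ({0..1::real} \<times> (cball x0 \<delta> \<times> cball x0 r)) \<subseteq> U \<times> U" using \<delta>(2) r(2) by auto
    from continuous_on_compose2[OF cF continuous_on_snd[OF continuous_on_id] this]
    show ?thesis by (simp add: case_prod_beta)
  qed
  obtain Y where Yc: "continuous_on ({0..1} \<times> cball x0 \<delta>) (\<lambda>(s, x). Y s x)"
    and YZ: "\<And>s x. s \<in> {0..1} \<Longrightarrow> x \<in> cball x0 \<delta> \<Longrightarrow> Y s x \<in> cball x0 r"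
    and Yeq: "\<And>s x. s \<in> {0..1} \<Longrightarrow> x \<in> cball x0 \<delta> \<Longrightarrow> Y s x = x + volterra (\<lambda>t. F (x, Y t x)) s"
  proof (rule volterra_fixpoint_exists[OF compact_cball closed_cball _ _ cFs Flip])
    show "x0 \<in> cball x0 r" using r(1) by simp
    show "continuous_on ({0..1::real} \<times> cball x0 \<delta>) (\<lambda>(s, x). x)"
      using continuous_on_snd[OF continuous_on_id, of "{0..1::real} \<times> cball x0 \<delta>"] by (simp add: case_prod_beta)
    show "x + volterra (\<lambda>t. F (x, u t)) s \<in> cball x0 r"
      if s: "s \<in> {0..1}" and x: "x \<in> cball x0 \<delta>" and u: "\<And>t. t \<in> {0..1} \<Longrightarrow> u t \<in> cball x0 r"
        and cu: "continuous_on {0..1} u" for s x u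
    proof -
      have "continuous_on {0..1} (\<lambda>t. F (x, u t))"
      proof (rule continuous_on_compose2[OF cF continuous_on_Pair[OF continuous_on_const cu]])
        show "(\<lambda>t. (x, u t)) ` {0..1} \<subseteq> U \<times> U" using u x \<delta>(2) r(2) by blast
      qed
      from volterra_norm_le[OF this s] Fbd[OF x u]
      have "norm (volterra (\<lambda>t. F (x, u t)) s) \<le> r / 2" by blast
      moreover have "norm (x - x0) \<le> r / 2" using x \<delta>(3) by (simp add: dist_norm norm_minus_commute)
      ultimately have "norm ((x - x0) + volterra (\<lambda>t. F (x, u t)) s) \<le> r / 2 + r / 2"
        by (intro norm_triangle_le add_mono)
      then show ?thesis
        by (simp add: dist_norm norm_minus_commute[of x0] algebra_simps)
    qed
  qed auto
  let ?V = "ball x0 \<delta>"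
  have VU: "?V \<subseteq> U" and Vc: "?V \<subseteq> cball x0 \<delta>" using \<delta>(2) ball_subset_cball by blast+
  have YU: "Y s x \<in> U" if "s \<in> {0..1}" "x \<in> ?V" for s x
    using YZ[OF that(1)] that(2) Vc r(2) by blast
  \<comment> \<open>Strictly inside the ball, thanks to \<delta> < r/2:
    \<open>volterra_smooth\<close> works with an open set of values.\<close>
  have Yball: "Y s x \<in> ball x0 r" if s: "s \<in> {0..1}" and x: "x \<in> ?V" for s x
  proof -
    have xc: "x \<in> cball x0 \<delta>" using x Vc by blast
    have "continuous_on {0..1} (\<lambda>t. F (x, Y t x))"
      using continuous_on_slice[OF continuous_on_uncurried_compose[OF cFs Yc YZ] xc] .
    from volterra_norm_le[OF this s] Fbd[OF xc YZ[OF _ xc]]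
    have "norm (volterra (\<lambda>t. F (x, Y t x)) s) \<le> r / 2" by blast
    moreover have "norm (x - x0) < r / 2" using x \<delta>(3) by (simp add: dist_norm norm_minus_commute)
    ultimately have "norm ((x - x0) + volterra (\<lambda>t. F (x, Y t x)) s) < r / 2 + r / 2"
      by (intro norm_triangle_lt add_less_le_mono)
    then show ?thesis
      using Yeq[OF s xc] by (simp add: dist_norm norm_minus_commute[of x0] algebra_simps)
  qed
  have YC: "param_Ck k {0..1} ?V Y" for k
  proof (rule volterra_smooth[OF open_ball open_ball, of k x0 \<delta> "\<lambda>s x. x" x0 r "\<lambda>s. F"])
    show "param_Ck k {0..1} ?V (\<lambda>s x. x)" by (rule param_Ck_snd_linear[OF bounded_linear_ident])
    show "param_Ck k {0..1} (?V \<times> ball x0 r) (\<lambda>s. F)"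
      by (rule param_Ck_subset[OF subset_refl _ smooth_on_param_Ck[OF open_Times[OF U(1) U(1)] FS]])
        (use VU r(2) ball_subset_cball in blast)
    show "norm (F (x, z) - F (x, z')) \<le> norm (z - z') / 2"
      if "x \<in> ?V" "z \<in> ball x0 r" "z' \<in> ball x0 r" for x z z'
      by (rule Flip) (use that in auto)
    show "continuous_on ({0..1} \<times> ?V) (\<lambda>(s, x). Y s x)"
      by (rule continuous_on_subset[OF Yc]) (use Vc in blast)
    show "Y s x = x + volterra (\<lambda>t. F (x, Y t x)) s" if "s \<in> {0..1}" "x \<in> ?V" for s x
      by (rule Yeq[OF that(1)]) (use that Vc in blast)
  qed (use Yball in blast)
  define Y' where "Y' s x = frechet_derivative (Y s) (at x)" for s x
  have Y': "(Y s has_derivative Y' s x) (at x)" if "s \<in> {0..1}" "x \<in> ?V" for s x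
    unfolding Y'_def by (rule param_Ck_frechet(1)[OF YC[of "Suc 0"] open_ball that])
  have Y'C: "param_Ck k {0..1} ?V (\<lambda>s x. Y' s x v)" for k v
    unfolding Y'_def by (rule param_Ck_frechet(2)[OF YC[of "Suc k"] open_ball])
  define DX where "DX j z = frechet_derivative (X j) (at z)" for j z
  have DX: "(X j has_derivative DX j z) (at z)" if "j < d" "z \<in> U" for j z
    unfolding DX_def by (rule smooth_on_has_derivative[OF X[OF that(1)] that(2)])
  have DXY: "param_Ck k {0..1} ?V (\<lambda>s x. DX j (Y s x) (w s x))"
    if "j < d" "param_Ck k {0..1} ?V w" for j k w
    unfolding DX_def by (rule param_Ck_frechet_apply[OF U(1) X[OF that(1)] YC YU that(2) open_ball])
  have XY: "param_Ck k {0..1} ?V (\<lambda>s x. X j (Y s x))" if "j < d" for j k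
    by (rule param_Ck_compose[OF smooth_on_param_Ck[OF U(1) X[OF that]] YC YU])
  have \<sigma>C: "param_Ck k {0..1} ?V (\<lambda>s. \<sigma> j)" if "j < d" for j k
    by (rule param_Ck_subset[OF subset_refl VU smooth_on_param_Ck[OF U(1) \<sigma>[OF that]]])
  have d\<omega>C: "param_Ck k {0..1} ?V (\<lambda>s x. - frechet_derivative (\<omega> j) (at x) v)" if "j < d" for j k v
    by (rule param_Ck_subset[OF subset_refl VU smooth_on_param_Ck[OF U(1)
            smooth_on_uminus[OF U(1) smooth_on_frechet_derivative[OF \<omega>[OF that]]]]])
  have d\<sigma>: "(\<sigma> j has_derivative (\<lambda>v. - frechet_derivative (\<omega> j) (at x) v)) (at x)"
    if "j < d" "x \<in> U" for j x
    using has_derivative_diff[OF has_derivative_const smooth_on_has_derivative[OF \<omega>[OF that(1)] that(2)]]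
    unfolding \<sigma>_def[abs_def] by simp
  \<comment> \<open>Derivative of \<open>F (x, Y t x)\<close> in \<open>x\<close>. The first term
    comes from the moving point \<open>Y t x\<close>, the second from the coefficients \<sigma>,
    whose derivative is minus that of \<omega>.\<close>
  define Fd where "Fd t x v = (\<Sum>j<d. \<sigma> j x *\<^sub>R DX j (Y t x) (Y' t x v)
      + (- frechet_derivative (\<omega> j) (at x) v) *\<^sub>R X j (Y t x))" for t x v
  have Fd: "((\<lambda>x. F (x, Y t x)) has_derivative Fd t x) (at x)" if t: "t \<in> {0..1}" and x: "x \<in> ?V" for t x
  proof -
    have xU: "x \<in> U" using x VU by blast
    have "((\<lambda>x. \<Sum>j<d. \<sigma> j x *\<^sub>R X j (Y t x)) has_derivative (\<lambda>v. \<Sum>j<d. \<sigma> j x *\<^sub>R DX j (Y t x) (Y' t x v)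
        + (- frechet_derivative (\<omega> j) (at x) v) *\<^sub>R X j (Y t x))) (at x)"
      by (intro has_derivative_sum has_derivative_scaleR d\<sigma> xU
          has_derivative_compose[OF Y'[OF t x] DX[OF _ YU[OF t x]]]) simp_all
    then show ?thesis unfolding Fd_def[abs_def] F_def by simp
  qed
  have FdC: "param_Ck k {0..1} ?V (\<lambda>t x. Fd t x v)" for k v
    unfolding Fd_def
    by (intro param_Ck_sum param_Ck_add param_Ck_bilinear[OF bounded_bilinear_scaleR]
        \<sigma>C d\<omega>C XY DXY Y'C; simp)
  have FYC: "param_Ck k {0..1} ?V (\<lambda>t x. F (x, Y t x))" for k
    unfolding F_def fst_conv snd_conv
    by (intro param_Ck_sum param_Ck_bilinear[OF bounded_bilinear_scaleR] \<sigma>C XY; simp)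
  have Y'eq: "Y' s x v = v + volterra (\<lambda>t. Fd t x v) s" if s: "s \<in> {0..1}" and x: "x \<in> ?V" for s x v
  proof -
    have "((\<lambda>x. x + volterra (\<lambda>t. F (x, Y t x)) s) has_derivative (\<lambda>v. v + volterra (\<lambda>t. Fd t x v) s)) (at x)"
      by (rule has_derivative_add[OF has_derivative_ident has_derivative_volterra[OF open_ball Fd
              param_Ck_continuous[OF FYC] param_Ck_continuous[OF FdC] s x]])
    then have "(Y s has_derivative (\<lambda>v. v + volterra (\<lambda>t. Fd t x v) s)) (at x)"
      by (rule has_derivative_transform_within_open[OF _ open_ball x]) (use Yeq[OF s] Vc in auto)
    from has_derivative_unique[OF Y'[OF s x] this] show ?thesis by (rule fun_cong)
  qed
  have vanish: "Y' 1 x (X i x) = 0" if i: "i < d" and x: "x \<in> ?V" for i x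
  proof -
    have xU: "x \<in> U" and xc: "x \<in> cball x0 \<delta>" using x VU Vc by blast+
    \<comment> \<open>The expected value of \<open>Y' s x (X i x)\<close>. Both start at
      \<open>X i x\<close> and obey the same linear Volterra equation, so any bound on their
      difference \<open>e\<close> can be halved and \<open>e\<close> vanishes.\<close>
    define Q where "Q s = (1 - s) *\<^sub>R X i (Y s x)" for s
    define q where "q t = (1 - t) *\<^sub>R (\<Sum>j<d. \<sigma> j x *\<^sub>R DX j (Y t x) (X i (Y t x))) - X i (Y t x)" for t
    have cXY: "continuous_on {0..1} (\<lambda>t. X i (Y t x))"
      by (rule continuous_on_slice[OF param_Ck_continuous[OF XY[OF i]] x])
    have cq: "continuous_on {0..1} q"
      unfolding q_def[abs_def]
      by (intro continuous_on_diff continuous_on_scaleR continuous_on_sum continuous_on_const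
          continuous_on_id cXY continuous_on_slice[OF param_Ck_continuous[OF DXY[OF _ XY[OF i]]] x]) simp
    have cFY: "continuous_on {0..1} (\<lambda>t. F (x, Y t x))"
      by (rule continuous_on_slice[OF param_Ck_continuous[OF FYC] x])
    have dY: "((\<lambda>s. Y s x) has_vector_derivative F (x, Y t x)) (at t within {0..1})" if t: "t \<in> {0..1}" for t
    proof -
      have "((\<lambda>s. x + integral {0..s} (\<lambda>t. F (x, Y t x))) has_vector_derivative 0 + F (x, Y t x)) (at t within {0..1})"
        by (rule has_vector_derivative_add[OF has_vector_derivative_const integral_has_vector_derivative[OF cFY t]])
      moreover have "x + integral {0..s} (\<lambda>t. F (x, Y t x)) = Y s x" if "s \<in> {0..1}" for s
        using Yeq[OF that xc] volterra_eq_integral[OF cFY that] by simp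
      ultimately show ?thesis
        using has_vector_derivative_transform[OF t] by (metis (no_types, lifting) add_0)
    qed
    have dQ: "(Q has_vector_derivative q t) (at t within {0..1})" if t: "t \<in> {0..1}" for t
    proof -
      note YtU = YU[OF t x]
      have "((X i \<circ> (\<lambda>s. Y s x)) has_vector_derivative DX i (Y t x) (F (x, Y t x))) (at t within {0..1})"
        by (rule vector_derivative_diff_chain_within[OF dY[OF t] has_derivative_at_withinI[OF DX[OF i YtU]]])
      moreover have "DX i (Y t x) (F (x, Y t x)) = (\<Sum>j<d. \<sigma> j x *\<^sub>R DX j (Y t x) (X i (Y t x)))"
      proof -
        note lin = has_derivative_linear[OF DX[OF i YtU]]
        have "DX i (Y t x) (F (x, Y t x)) = (\<Sum>j<d. \<sigma> j x *\<^sub>R DX i (Y t x) (X j (Y t x)))"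
          by (simp only: F_def fst_conv snd_conv linear_sum[OF lin] linear_cmul[OF lin])
        also have "\<dots> = (\<Sum>j<d. \<sigma> j x *\<^sub>R DX j (Y t x) (X i (Y t x)))"
          using comm[OF i _ YtU] by (intro sum.cong refl) (simp add: DX_def)
        finally show ?thesis .
      qed
      ultimately have "((\<lambda>s. X i (Y s x)) has_vector_derivative
          (\<Sum>j<d. \<sigma> j x *\<^sub>R DX j (Y t x) (X i (Y t x)))) (at t within {0..1})"
        by (simp only: o_def)
      moreover have "((\<lambda>s. 1 - s) has_field_derivative - 1) (at t within {0..1})"
        by (auto intro!: derivative_eq_intros)
      ultimately show ?thesis
        using has_vector_derivative_scaleR unfolding Q_def[abs_def] q_def
        by fastforce
    qed
    have Qeq: "Q s = X i x + volterra q s" if s: "s \<in> {0..1}" for s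
    proof -
      have "(q has_integral (Q s - Q 0)) {0..s}"
      proof (rule fundamental_theorem_of_calculus)
        fix t assume "t \<in> {0..s}"
        then have "t \<in> {0..1}" using s by auto
        from has_vector_derivative_within_subset[OF dQ[OF this]]
        show "(Q has_vector_derivative q t) (at t within {0..s})" using s by auto
      qed (use s in auto)
      then have "Q s - Q 0 = volterra q s"
        using volterra_eq_integral[OF cq s] by (simp add: integral_unique)
      moreover have "Y 0 x = x" using Yeq[of 0, OF _ xc] by (simp add: volterra_def)
      then have "Q 0 = X i x" by (simp add: Q_def)
      ultimately show ?thesis by (simp add: algebra_simps)
    qed
    define e where "e t = Y' t x (X i x) - Q t" for t
    have cFd: "continuous_on {0..1} (\<lambda>t. Fd t x (X i x))"
      by (rule continuous_on_slice[OF param_Ck_continuous[OF FdC] x])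
    have ce: "continuous_on {0..1} e"
      unfolding e_def[abs_def] Q_def
      by (intro continuous_on_diff continuous_on_scaleR continuous_on_const continuous_on_id cXY
          continuous_on_slice[OF param_Ck_continuous[OF Y'C] x])
    have "norm (e 1) \<le> 2 * 0"
    proof (rule contraction_bound[OF compact_Icc ce])
      fix M and s :: real assume M: "\<And>s. s \<in> {0..1} \<Longrightarrow> norm (e s) \<le> M" and s: "s \<in> {0..1}"
      have "e s = volterra (\<lambda>t. Fd t x (X i x) - q t) s"
        using Y'eq[OF s x] Qeq[OF s] volterra_diff[OF cFd cq s] by (simp add: e_def)
      moreover have "norm (volterra (\<lambda>t. Fd t x (X i x) - q t) s) \<le> M / 2"
      proof (rule volterra_norm_le[OF continuous_on_diff[OF cFd cq] s])
        fix t :: real assume t: "t \<in> {0..1}"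
        have lin: "linear (DX j (Y t x))" if "j < d" for j
          by (rule has_derivative_linear[OF DX[OF that YU[OF t x]]])
        \<comment> \<open>By duality the coefficient part of \<open>Fd\<close> in direction
          \<open>X i x\<close> is just minus \<open>X i (Y t x)\<close>, which cancels against the
          last term of \<open>q\<close>.\<close>
        have "Fd t x (X i x) = (\<Sum>j<d. \<sigma> j x *\<^sub>R DX j (Y t x) (Y' t x (X i x)))
            + (\<Sum>j<d. (- (if i = j then 1 else 0)) *\<^sub>R X j (Y t x))"
          unfolding Fd_def sum.distrib[symmetric] using dual[OF i _ xU] by (intro sum.cong refl) simp
        also have "(\<Sum>j<d. (- (if i = j then 1 else 0)) *\<^sub>R X j (Y t x)) = - X i (Y t x)"
        proof -
          have "(\<Sum>j<d. (- (if i = j then 1 else 0)) *\<^sub>R X j (Y t x))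
              = (\<Sum>j<d. if i = j then - X j (Y t x) else 0)"
            by (intro sum.cong refl) simp
          also have "\<dots> = - X i (Y t x)" using i by simp
          finally show ?thesis .
        qed
        finally have "Fd t x (X i x) - q t = (\<Sum>j<d. \<sigma> j x *\<^sub>R DX j (Y t x) (Y' t x (X i x)))
            - (1 - t) *\<^sub>R (\<Sum>j<d. \<sigma> j x *\<^sub>R DX j (Y t x) (X i (Y t x)))"
          by (simp add: q_def)
        also have "\<dots> = (\<Sum>j<d. \<sigma> j x *\<^sub>R DX j (Y t x) (e t))"
          unfolding scaleR_sum_right sum_subtractf[symmetric]
        proof (intro sum.cong refl)
          fix j assume "j \<in> {..<d}"
          then have "j < d" by simp
          note l = lin[OF this]
          show "\<sigma> j x *\<^sub>R DX j (Y t x) (Y' t x (X i x)) - (1 - t) *\<^sub>R \<sigma> j x *\<^sub>R DX j (Y t x) (X i (Y t x))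
              = \<sigma> j x *\<^sub>R DX j (Y t x) (e t)"
            unfolding e_def Q_def linear_diff[OF l] linear_cmul[OF l]
            by (simp add: scaleR_diff_right mult.commute)
        qed
        finally have "norm (Fd t x (X i x) - q t) = norm (\<Sum>j<d. \<sigma> j x *\<^sub>R DX j (Y t x) (e t))" by simp
        also have "\<dots> \<le> (\<Sum>j<d. (\<bar>\<sigma> j x\<bar> * L j) * norm (e t))"
        proof (rule sum_norm_le)
          fix j assume "j \<in> {..<d}"
          then have "norm (DX j (Y t x) (e t)) \<le> L j * norm (e t)"
            unfolding DX_def using Lder YZ[OF t xc] by simp
          then show "norm (\<sigma> j x *\<^sub>R DX j (Y t x) (e t)) \<le> (\<bar>\<sigma> j x\<bar> * L j) * norm (e t)"
            by (simp add: mult_left_mono mult.assoc)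
        qed
        also have "\<dots> = S1 x * norm (e t)" by (simp add: S1_def sum_distrib_right)
        also have "\<dots> \<le> 1 / 2 * M"
          using L0 by (intro mult_mono \<delta>(4) xc M t) (auto intro!: sum_nonneg simp: S1_def)
        finally show "norm (Fd t x (X i x) - q t) \<le> M / 2" by simp
      qed
      ultimately show "norm (e s) \<le> 0 + M / 2" by simp
    qed simp
    then show ?thesis by (simp add: e_def Q_def)
  qed
  have x0: "x0 \<in> ?V" using \<delta>(1) by simp
  show thesis
  proof (rule that[of ?V "Y 1"])
    show "open ?V" by (rule open_ball)
    show "x0 \<in> ?V" by (rule x0)
    show "?V \<subseteq> U" by (rule VU)
    show "smooth_on ?V (Y 1)" by (rule smooth_on_param_slice[OF open_ball YC]) simp
    show "frechet_derivative (Y 1) (at x) (X i x) = 0" if "x \<in> ?V" "i < d" for x i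
      using vanish[OF that(2,1)] by (simp add: Y'_def)
    show "frechet_derivative (Y 1) (at x0) v = v"
      if "\<And>j. j < d \<Longrightarrow> frechet_derivative (\<omega> j) (at x0) v = 0" for v
    proof -
      \<comment> \<open>At \<open>x0\<close> the first terms carry the factor
        \<open>\<sigma> j x0\<close>, which is 0, and the others the derivative of
        \<open>\<omega> j\<close> in direction \<open>v\<close>.\<close>
      have "Fd t x0 v = 0" for t
        unfolding Fd_def using that by (intro sum.neutral ballI) (simp add: \<sigma>_def)
      then have "volterra (\<lambda>t. Fd t x0 v) 1 = 0" by (simp add: volterra_def)
      with Y'eq[OF _ x0, of 1 v] show ?thesis by (simp add: Y'_def)
    qed
  qed
qed

lemma frechet_derivative_eqI: "(f has_derivative f') (at x) \<Longrightarrow> frechet_derivative f (at x) = f'"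
  by (metis frechet_derivative_at)

lemma frechet_derivative_cong_open:
  assumes "open U" "x \<in> U" "\<And>z. z \<in> U \<Longrightarrow> f z = g z" "f differentiable (at x)"
  shows "frechet_derivative g (at x) = frechet_derivative f (at x)"
proof -
  have "(f has_derivative frechet_derivative f (at x)) (at x)"
    using assms(4) by (simp add: frechet_derivative_works)
  from has_derivative_transform_within_open[OF this assms(1,2,3)]
  show ?thesis by (rule frechet_derivative_eqI)
qed

subsection \<open>Symmetry of second derivatives and the inverse function theorem\<close>

text \<open>Write \<theta>(z + s u) - \<theta>(z) as the integral of the derivative in direction u,
  differentiate it in z in direction v, and then in s at 0. The bound on u keeps the segments from
  all z near x inside \<open>U\<close>.\<close>

lemma second_derivative_symmetric_small:
  fixes \<theta> :: "'a::euclidean_space \<Rightarrow> 'b::euclidean_space"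
  assumes U: "open U" and \<theta>: "smooth_on U \<theta>" and d: "ball x (d + d) \<subseteq> U" "d > 0" and u: "norm u < d"
  shows "frechet_derivative (\<lambda>z. frechet_derivative \<theta> (at z) v) (at x) u
       = frechet_derivative (\<lambda>z. frechet_derivative \<theta> (at z) u) (at x) v"
proof -
  let ?V = "ball x d"
  have x: "x \<in> ?V" using d(2) by simp
  have mem: "z + r *\<^sub>R u \<in> U" if "r \<in> {0..1}" "z \<in> ?V" for r z
  proof -
    have "norm (r *\<^sub>R u) \<le> norm u" using that(1) by (simp add: mult_left_le_one_le)
    then have "norm (x - (z + r *\<^sub>R u)) < d + d"
      using that(2) u norm_triangle_ineq4[of "x - z" "r *\<^sub>R u"] by (simp add: dist_norm algebra_simps)
    then show ?thesis using d(1) by (auto simp: dist_norm)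
  qed
  define D where "D w z = frechet_derivative \<theta> (at z) w" for w z
  have DS: "smooth_on U (D w)" for w
    unfolding D_def by (rule smooth_on_frechet_derivative[OF \<theta>])
  have shift: "param_Ck k {0..1} ?V (\<lambda>r z. z + r *\<^sub>R u)" for k
  proof (cases k)
    case 0
    have "continuous_on ({0..1} \<times> ?V) (\<lambda>p. snd p + fst p *\<^sub>R u)" by (intro continuous_intros)
    then show ?thesis using 0 by (simp add: case_prod_beta)
  next
    case (Suc j)
    have "continuous_on ({0..1} \<times> ?V) (\<lambda>p. snd p + fst p *\<^sub>R u)" by (intro continuous_intros)
    then show ?thesis unfolding Suc
      by (intro param_Ck_SucI[where w' = "\<lambda>r z v. v"] param_Ck_const)
        (auto simp: case_prod_beta intro!: derivative_eq_intros)
  qed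
  have Dshift: "param_Ck k {0..1} ?V (\<lambda>r z. D w (z + r *\<^sub>R u))" for k w
    by (rule param_Ck_compose[OF smooth_on_param_Ck[OF U DS] shift mem])
  have line: "((\<lambda>s. \<phi> (z + s *\<^sub>R u)) has_vector_derivative frechet_derivative \<phi> (at (z + r *\<^sub>R u)) u) (at r within {0..1})"
    if \<phi>: "smooth_on U \<phi>" and r: "r \<in> {0..1}" and z: "z \<in> ?V" for \<phi> :: "'a \<Rightarrow> 'b" and r z
  proof -
    have "((\<lambda>s. z + s *\<^sub>R u) has_vector_derivative u) (at r within {0..1})"
      by (auto intro!: derivative_eq_intros)
    from vector_derivative_diff_chain_within[OF this
        has_derivative_at_withinI[OF smooth_on_has_derivative[OF \<phi> mem[OF r z]]]]
    show ?thesis by (simp add: o_def)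
  qed
  have eq: "\<theta> (z + s *\<^sub>R u) = \<theta> z + volterra (\<lambda>r. D u (z + r *\<^sub>R u)) s" if s: "s \<in> {0..1}" and z: "z \<in> ?V" for s z
  proof -
    have c: "continuous_on {0..1} (\<lambda>r. D u (z + r *\<^sub>R u))"
      by (rule continuous_on_slice[OF param_Ck_continuous[OF Dshift] z])
    have "((\<lambda>r. D u (z + r *\<^sub>R u)) has_integral \<theta> (z + s *\<^sub>R u) - \<theta> (z + 0 *\<^sub>R u)) {0..s}"
    proof (rule fundamental_theorem_of_calculus)
      fix t assume "t \<in> {0..s}"
      then have "t \<in> {0..1}" using s by auto
      from has_vector_derivative_within_subset[OF line[OF \<theta> this z]]
      show "((\<lambda>s. \<theta> (z + s *\<^sub>R u)) has_vector_derivative D u (z + t *\<^sub>R u)) (at t within {0..s})"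
        using s by (auto simp: D_def)
    qed (use s in auto)
    then show ?thesis using volterra_eq_integral[OF c s] by (simp add: integral_unique)
  qed
  define h where "h r = frechet_derivative (D u) (at (x + r *\<^sub>R u)) v" for r
  have ch: "continuous_on {0..1} h"
  proof -
    have "param_Ck 0 {0..1} ?V (\<lambda>r z. frechet_derivative (D u) (at (z + r *\<^sub>R u)) v)"
      by (rule param_Ck_compose[OF smooth_on_param_Ck[OF U smooth_on_frechet_derivative[OF DS]] shift mem])
    from continuous_on_slice[OF param_Ck_continuous[OF this] x] show ?thesis by (simp add: h_def[abs_def])
  qed
  have D_eq: "D v (x + s *\<^sub>R u) = D v x + volterra h s" if s: "s \<in> {0..1}" for s
  proof -
    have shd: "((\<lambda>z. z + r *\<^sub>R u) has_derivative (\<lambda>v. v)) (at z)" for r z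
      by (auto intro!: derivative_eq_intros)
    have 1: "((\<lambda>z. \<theta> (z + s *\<^sub>R u)) has_derivative frechet_derivative \<theta> (at (x + s *\<^sub>R u))) (at x)"
      using has_derivative_compose[OF shd smooth_on_has_derivative[OF \<theta> mem[OF s x]]] by simp
    have "((\<lambda>z. \<theta> z + volterra (\<lambda>r. D u (z + r *\<^sub>R u)) s) has_derivative
        (\<lambda>v. frechet_derivative \<theta> (at x) v + volterra (\<lambda>r. frechet_derivative (D u) (at (x + r *\<^sub>R u)) v) s)) (at x)"
    proof (rule has_derivative_add[OF smooth_on_has_derivative[OF \<theta>] has_derivative_volterra[OF open_ball _ _ _ s x]])
      show "x \<in> U" using d by auto
      show "((\<lambda>z. D u (z + r *\<^sub>R u)) has_derivative frechet_derivative (D u) (at (z + r *\<^sub>R u))) (at z)"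
        if "r \<in> {0..1}" "z \<in> ?V" for r z
        using has_derivative_compose[OF shd smooth_on_has_derivative[OF DS mem[OF that]]] by simp
      show "continuous_on ({0..1} \<times> ?V) (\<lambda>(r, z). D u (z + r *\<^sub>R u))"
        by (rule param_Ck_continuous[OF Dshift])
      show "continuous_on ({0..1} \<times> ?V) (\<lambda>(r, z). frechet_derivative (D u) (at (z + r *\<^sub>R u)) v)" for v
        by (rule param_Ck_continuous[OF param_Ck_compose[OF
                smooth_on_param_Ck[OF U smooth_on_frechet_derivative[OF DS]] shift mem]])
    qed
    then have "((\<lambda>z. \<theta> (z + s *\<^sub>R u)) has_derivative
        (\<lambda>v. frechet_derivative \<theta> (at x) v + volterra (\<lambda>r. frechet_derivative (D u) (at (x + r *\<^sub>R u)) v) s)) (at x)"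
      by (rule has_derivative_transform_within_open[OF _ open_ball x]) (use eq[OF s] in auto)
    from fun_cong[OF has_derivative_unique[OF 1 this], of v] show ?thesis by (simp add: D_def h_def[abs_def])
  qed
  have z0: "(0::real) \<in> {0..1}" by simp
  have "((\<lambda>s. D v (x + s *\<^sub>R u)) has_vector_derivative frechet_derivative (D v) (at (x + 0 *\<^sub>R u)) u) (at 0 within {0..1})"
    by (rule line[OF DS z0 x])
  moreover have "((\<lambda>s. D v (x + s *\<^sub>R u)) has_vector_derivative h 0) (at 0 within {0..1})"
  proof -
    have "((\<lambda>s. D v x + integral {0..s} h) has_vector_derivative 0 + h 0) (at 0 within {0..1})"
      by (rule has_vector_derivative_add[OF has_vector_derivative_const integral_has_vector_derivative[OF ch z0]])
    then have "((\<lambda>s. D v x + integral {0..s} h) has_vector_derivative h 0) (at 0 within {0..1})" by simp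
    then show ?thesis
      by (rule has_vector_derivative_transform[OF z0, rotated])
        (use D_eq volterra_eq_integral[OF ch] in simp)
  qed
  ultimately have "frechet_derivative (D v) (at (x + 0 *\<^sub>R u)) u = h 0"
    by (intro vector_derivative_unique_within_closed_interval[of 0 1 0 "\<lambda>s. D v (x + s *\<^sub>R u)"]) auto
  then show ?thesis by (simp add: h_def D_def[abs_def])
qed

lemma second_derivative_symmetric:
  fixes \<theta> :: "'a::euclidean_space \<Rightarrow> 'b::euclidean_space"
  assumes U: "open U" and \<theta>: "smooth_on U \<theta>" and x: "x \<in> U"
  shows "frechet_derivative (\<lambda>z. frechet_derivative \<theta> (at z) v) (at x) w
       = frechet_derivative (\<lambda>z. frechet_derivative \<theta> (at z) w) (at x) v"
proof -
  obtain e where e: "e > 0" "ball x e \<subseteq> U" by (rule openE[OF U x])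
  define d where "d = e / 2"
  have d: "d > 0" "ball x (d + d) \<subseteq> U" using e by (simp_all add: d_def)
  \<comment> \<open>Both sides are linear in \<open>w\<close>, so \<open>w\<close> may be shortened
    to fit the previous lemma and \<open>c\<close> cancelled afterwards; the summand 1 covers
    \<open>w = 0\<close>.\<close>
  define c where "c = d / (norm w + 1)"
  have nw: "norm w + 1 > 0" using norm_ge_zero[of w] by linarith
  have c: "c > 0" using d(1) nw by (simp add: c_def)
  have "norm (c *\<^sub>R w) < d"
  proof -
    have "norm (c *\<^sub>R w) = c * norm w" using c by simp
    also have "\<dots> = d * (norm w / (norm w + 1))" by (simp add: c_def)
    also have "\<dots> < d * 1" using d(1) nw by (intro mult_strict_left_mono) simp_all
    finally show ?thesis by simp
  qed
  from second_derivative_symmetric_small[OF U \<theta> d(2,1) this, of v]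
  have eq: "frechet_derivative (\<lambda>z. frechet_derivative \<theta> (at z) v) (at x) (c *\<^sub>R w)
      = frechet_derivative (\<lambda>z. frechet_derivative \<theta> (at z) (c *\<^sub>R w)) (at x) v" .
  have S: "smooth_on U (\<lambda>z. frechet_derivative \<theta> (at z) u)" for u
    by (rule smooth_on_frechet_derivative[OF \<theta>])
  have "frechet_derivative (\<lambda>z. frechet_derivative \<theta> (at z) v) (at x) (c *\<^sub>R w)
      = c *\<^sub>R frechet_derivative (\<lambda>z. frechet_derivative \<theta> (at z) v) (at x) w"
    by (rule linear_cmul[OF has_derivative_linear[OF smooth_on_has_derivative[OF S x]]])
  moreover have "frechet_derivative (\<lambda>z. frechet_derivative \<theta> (at z) (c *\<^sub>R w)) (at x)
      = (\<lambda>v. c *\<^sub>R frechet_derivative (\<lambda>z. frechet_derivative \<theta> (at z) w) (at x) v)"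
  proof (rule frechet_derivative_eqI)
    have "((\<lambda>z. c *\<^sub>R frechet_derivative \<theta> (at z) w) has_derivative
        (\<lambda>v. c *\<^sub>R frechet_derivative (\<lambda>z. frechet_derivative \<theta> (at z) w) (at x) v)) (at x)"
      by (rule has_derivative_scaleR_right[OF smooth_on_has_derivative[OF S x]])
    then show "((\<lambda>z. frechet_derivative \<theta> (at z) (c *\<^sub>R w)) has_derivative
        (\<lambda>v. c *\<^sub>R frechet_derivative (\<lambda>z. frechet_derivative \<theta> (at z) w) (at x) v)) (at x)"
      by (rule has_derivative_transform_within_open[OF _ U x])
        (rule linear_cmul[OF has_derivative_linear[OF smooth_on_has_derivative[OF \<theta>]], symmetric])
  qed
  ultimately have "c *\<^sub>R frechet_derivative (\<lambda>z. frechet_derivative \<theta> (at z) v) (at x) w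
      = c *\<^sub>R frechet_derivative (\<lambda>z. frechet_derivative \<theta> (at z) w) (at x) v"
    using eq by metis
  with c show ?thesis by simp
qed

text \<open>A product rule: expanding the varying direction \<open>X z\<close> in
  \<open>Basis\<close> reduces it to derivatives of \<theta> in fixed directions.\<close>

lemma has_derivative_frechet_apply:
  fixes \<theta> :: "'a::euclidean_space \<Rightarrow> 'b::euclidean_space"
  assumes U: "open U" and \<theta>: "smooth_on U \<theta>" and X: "smooth_on U X" and x: "x \<in> U"
  shows "((\<lambda>z. frechet_derivative \<theta> (at z) (X z)) has_derivative
      (\<lambda>v. frechet_derivative (\<lambda>z. frechet_derivative \<theta> (at z) (X x)) (at x) v
         + frechet_derivative \<theta> (at x) (frechet_derivative X (at x) v))) (at x)"
proof -
  define D where "D w z = frechet_derivative \<theta> (at z) w" for w z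
  have DS: "smooth_on U (D w)" for w
    unfolding D_def by (rule smooth_on_frechet_derivative[OF \<theta>])
  have expand: "D w z = (\<Sum>b\<in>Basis. inner w b *\<^sub>R D b z)" if "z \<in> U" for w z
  proof -
    note lin = has_derivative_linear[OF smooth_on_has_derivative[OF \<theta> that]]
    have "D w z = frechet_derivative \<theta> (at z) (\<Sum>b\<in>Basis. inner w b *\<^sub>R b)"
      by (simp only: D_def euclidean_representation)
    then show ?thesis by (simp only: linear_sum[OF lin] linear_cmul[OF lin] D_def)
  qed
  have dD: "(D w has_derivative frechet_derivative (D w) (at x)) (at x)" for w
    by (rule smooth_on_has_derivative[OF DS x])
  have "((\<lambda>z. \<Sum>b\<in>Basis. inner (X z) b *\<^sub>R D b z) has_derivative
      (\<lambda>v. \<Sum>b\<in>Basis. inner (X x) b *\<^sub>R frechet_derivative (D b) (at x) v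
           + inner (frechet_derivative X (at x) v) b *\<^sub>R D b x)) (at x)"
    by (intro has_derivative_sum has_derivative_scaleR dD
        has_derivative_inner_left smooth_on_has_derivative[OF X x])
  moreover have "(\<Sum>b\<in>Basis. inner (X x) b *\<^sub>R frechet_derivative (D b) (at x) v
           + inner (frechet_derivative X (at x) v) b *\<^sub>R D b x)
      = frechet_derivative (D (X x)) (at x) v + D (frechet_derivative X (at x) v) x" for v
  proof -
    have "((\<lambda>z. \<Sum>b\<in>Basis. inner (X x) b *\<^sub>R D b z) has_derivative
        (\<lambda>v. \<Sum>b\<in>Basis. inner (X x) b *\<^sub>R frechet_derivative (D b) (at x) v)) (at x)"
      by (intro has_derivative_sum has_derivative_scaleR_right dD)
    then have "(D (X x) has_derivative
        (\<lambda>v. \<Sum>b\<in>Basis. inner (X x) b *\<^sub>R frechet_derivative (D b) (at x) v)) (at x)"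
      by (rule has_derivative_transform_within_open[OF _ U x]) (simp add: expand)
    from frechet_derivative_eqI[OF this] expand[OF x, of "frechet_derivative X (at x) v"]
    show ?thesis by (simp add: sum.distrib)
  qed
  ultimately have "((\<lambda>z. \<Sum>b\<in>Basis. inner (X z) b *\<^sub>R D b z) has_derivative
      (\<lambda>v. frechet_derivative (D (X x)) (at x) v + D (frechet_derivative X (at x) v) x)) (at x)"
    by simp
  then have "((\<lambda>z. D (X z) z) has_derivative
      (\<lambda>v. frechet_derivative (D (X x)) (at x) v + D (frechet_derivative X (at x) v) x)) (at x)"
    by (rule has_derivative_transform_within_open[OF _ U x]) (rule expand[symmetric])
  then show ?thesis by (simp add: D_def[abs_def])
qed

text \<open>Differentiate each of the two constants along the other field. The second derivatives of
  \<omega> in the two identities agree by symmetry, so the derivative of \<omega> takes the same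
  value on both halves of the bracket.\<close>

lemma frechet_derivative_bracket_eq:
  fixes \<omega> :: "'a::euclidean_space \<Rightarrow> 'b::euclidean_space"
  assumes U: "open U" and \<omega>: "smooth_on U \<omega>" and X: "smooth_on U X" and Y: "smooth_on U Y" and x: "x \<in> U"
    and cX: "\<And>z. z \<in> U \<Longrightarrow> frechet_derivative \<omega> (at z) (X z) = c1"
    and cY: "\<And>z. z \<in> U \<Longrightarrow> frechet_derivative \<omega> (at z) (Y z) = c2"
  shows "frechet_derivative \<omega> (at x) (frechet_derivative Y (at x) (X x))
       = frechet_derivative \<omega> (at x) (frechet_derivative X (at x) (Y x))"
proof -
  have const: "frechet_derivative (\<lambda>z. frechet_derivative \<omega> (at z) (Z x)) (at x) v
      + frechet_derivative \<omega> (at x) (frechet_derivative Z (at x) v) = 0"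
    if Z: "smooth_on U Z" and c: "\<And>z. z \<in> U \<Longrightarrow> frechet_derivative \<omega> (at z) (Z z) = c" for Z c v
  proof -
    have "((\<lambda>z. frechet_derivative \<omega> (at z) (Z z)) has_derivative (\<lambda>v. 0)) (at x)"
      by (rule has_derivative_transform_within_open[OF has_derivative_const U x]) (use c in simp)
    from has_derivative_unique[OF has_derivative_frechet_apply[OF U \<omega> Z x] this]
    show ?thesis by (rule fun_cong)
  qed
  from const[OF X cX, of "Y x"] const[OF Y cY, of "X x"]
    second_derivative_symmetric[OF U \<omega> x, of "X x" "Y x"]
  show ?thesis by (metis add_left_imp_eq)
qed

section \<open>Cramer's rule and smooth inverses\<close>

lemma param_Ck_prod:
  fixes w :: "'i \<Rightarrow> real \<Rightarrow> 'a::real_normed_vector \<Rightarrow> real"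
  assumes "\<And>i. i \<in> I \<Longrightarrow> param_Ck k T V (w i)"
  shows "param_Ck k T V (\<lambda>s x. \<Prod>i\<in>I. w i s x)"
  using assms
  by (induction I rule: infinite_finite_induct)
    (simp_all add: param_Ck_const param_Ck_bilinear[OF bounded_bilinear_mult])

lemma param_Ck_det:
  fixes A :: "real \<Rightarrow> 'a::real_normed_vector \<Rightarrow> real^'n^'n"
  assumes "\<And>i j. param_Ck k T V (\<lambda>s x. vec_nth (vec_nth (A s x) i) j)"
  shows "param_Ck k T V (\<lambda>s x. Determinants.det (A s x))"
  unfolding Determinants.det_def
  by (intro param_Ck_sum param_Ck_bilinear[OF bounded_bilinear_mult] param_Ck_const param_Ck_prod assms)

lemma param_Ck_real_inverse:
  fixes w :: "real \<Rightarrow> 'a::real_normed_vector \<Rightarrow> real"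
  assumes "param_Ck k T V w" "\<And>s x. s \<in> T \<Longrightarrow> x \<in> V \<Longrightarrow> w s x \<noteq> 0"
  shows "param_Ck k T V (\<lambda>s x. inverse (w s x))"
proof (rule param_Ck_compose[OF smooth_on_param_Ck[OF _ smooth_on_real_inverse] assms(1)])
  show "open (- {0} :: real set)" by auto
qed (use assms(2) in simp)

lemma param_Ck_vec_lambda:
  fixes c :: "'n::finite \<Rightarrow> real \<Rightarrow> 'a::real_normed_vector \<Rightarrow> real"
  assumes "\<And>i. param_Ck k T V (c i)"
  shows "param_Ck k T V (\<lambda>s x. vec_lambda (\<lambda>i. c i s x))"
proof -
  have "param_Ck k T V (\<lambda>s x. \<Sum>i\<in>UNIV. c i s x *\<^sub>R axis i (1::real))"
    by (intro param_Ck_sum param_Ck_bilinear[OF bounded_bilinear_scaleR] assms param_Ck_const)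
  moreover have "(\<Sum>i\<in>UNIV. c i s x *\<^sub>R axis i (1::real)) = vec_lambda (\<lambda>i. c i s x)" for s x
    by (simp add: Finite_Cartesian_Product.vec_eq_iff sum_component axis_def if_distrib cong: if_cong)
  ultimately show ?thesis by simp
qed

text \<open>The inverse function theorem makes \<open>g\<close> differentiable once. Cramer's rule
  writes its derivative through the entries of the derivative of \<open>f\<close> at
  \<open>g y\<close>, so if \<open>g\<close> is of class C^k then so is its derivative, and the
  order climbs.\<close>

lemma smooth_inverse_function:
  fixes f :: "real^'n \<Rightarrow> real^'n"
  assumes U: "open U" "x0 \<in> U" and f: "smooth_on U f"
    and inj0: "\<And>v. frechet_derivative f (at x0) v = 0 \<Longrightarrow> v = 0"
  obtains V g where "open V" "x0 \<in> V" "V \<subseteq> U" "open (f ` V)" "smooth_on (f ` V) g" "\<And>x. x \<in> V \<Longrightarrow> g (f x) = x"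
proof -
  define f' where "f' x = Blinfun (frechet_derivative f (at x))" for x
  have der: "(f has_derivative frechet_derivative f (at x)) (at x)" if "x \<in> U" for x
    by (rule smooth_on_has_derivative[OF f that])
  have f'app: "blinfun_apply (f' x) = frechet_derivative f (at x)" if "x \<in> U" for x
    unfolding f'_def by (rule bounded_linear_Blinfun_apply[OF has_derivative_bounded_linear[OF der[OF that]]])
  have derf: "(f has_derivative blinfun_apply (f' x)) (at x)" if "x \<in> U" for x
    using der[OF that] f'app[OF that] by simp
  have contf': "continuous_on U f'"
  proof (rule continuous_on_blinfun_componentwise)
    fix b :: "real^'n"
    have "continuous_on U (\<lambda>x. frechet_derivative f (at x) b)"
      by (rule smooth_on_imp_continuous_on[OF smooth_on_frechet_derivative[OF f]])
    then show "continuous_on U (\<lambda>x. blinfun_apply (f' x) b)"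
      using continuous_on_cong[of U U "\<lambda>x. blinfun_apply (f' x) b" "\<lambda>x. frechet_derivative f (at x) b"] f'app
      by simp
  qed
  have lin0: "linear (frechet_derivative f (at x0))" by (rule has_derivative_linear[OF der[OF U(2)]])
  have "inj (frechet_derivative f (at x0))"
    using inj0 linear_injective_0[OF lin0] by blast
  from linear_injective_left_inverse[OF lin0 this]
  obtain l where l: "linear l" "l \<circ> frechet_derivative f (at x0) = id" by blast
  have bl: "bounded_linear l" by (rule linear_conv_bounded_linear[THEN iffD1, OF l(1)])
  have invf: "Blinfun l o\<^sub>L f' x0 = id_blinfun"
  proof (rule blinfun_eqI)
    fix i
    show "blinfun_apply (Blinfun l o\<^sub>L f' x0) i = blinfun_apply id_blinfun i"
      using fun_cong[OF l(2), of i] by (simp add: bounded_linear_Blinfun_apply[OF bl] f'app[OF U(2)])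
  qed
  obtain U' V g g' where U': "open U'" "U' \<subseteq> U" "x0 \<in> U'" and V: "open V" "f x0 \<in> V"
    and hom: "homeomorphism U' V f g"
    and dg: "\<And>y. y \<in> V \<Longrightarrow> (g has_derivative (g' y)) (at y)"
    and g': "\<And>y. y \<in> V \<Longrightarrow> g' y = inv_into UNIV (blinfun_apply (f' (g y)))"
    and bij: "\<And>y. y \<in> V \<Longrightarrow> bij (blinfun_apply (f' (g y)))"
  proof (rule inverse_function_theorem[OF U(1) derf contf' U(2) invf], goal_cases)
    case (2 U' V g g')
    show ?case by (rule 2(1)[OF 2(2-10)])
  qed
  have gU': "g y \<in> U'" if "y \<in> V" for y using hom that unfolding homeomorphism_def by blast
  then have gU: "g y \<in> U" if "y \<in> V" for y using U'(2) that by blast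
  have fV: "f ` U' = V" and gf: "\<And>x. x \<in> U' \<Longrightarrow> g (f x) = x" using hom unfolding homeomorphism_def by blast+
  define A where "A y = matrix (frechet_derivative f (at (g y)))" for y
  have Alin: "linear (frechet_derivative f (at (g y)))" if "y \<in> V" for y
    by (rule has_derivative_linear[OF der[OF gU[OF that]]])
  have Av: "A y *v v = frechet_derivative f (at (g y)) v" if "y \<in> V" for y v
    unfolding A_def by (rule fun_cong[OF matrix_vector_mul(2)[OF Alin[OF that]]])
  have bijA: "bij (frechet_derivative f (at (g y)))" if "y \<in> V" for y
    using bij[OF that] f'app[OF gU[OF that]] by simp
  have detA: "Determinants.det (A y) \<noteq> 0" if "y \<in> V" for y
    unfolding A_def
    using det_nz_iff_inj[OF Alin[OF that]] bij_is_inj[OF bijA[OF that]] by blast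
  have g'v: "g' y v = vec_lambda (\<lambda>k. Determinants.det (vec_lambda (\<lambda>i. vec_lambda (\<lambda>j.
      if j = k then vec_nth v i else vec_nth (vec_nth (A y) i) j))) / Determinants.det (A y))"
    if y: "y \<in> V" for y v
  proof -
    have "A y *v g' y v = v"
      unfolding Av[OF y] g'[OF y] f'app[OF gU[OF y]] by (rule surj_f_inv_f[OF bij_is_surj[OF bijA[OF y]]])
    then show ?thesis using cramer[OF detA[OF y]] by blast
  qed
  \<comment> \<open>A one-point parameter set turns the classes with parameter into plain C^k, so
    that their closure lemmas apply.\<close>
  have gC: "param_Ck k {0} V (\<lambda>_. g)" for k
  proof (induction k)
    have c: "continuous_on V g" using hom unfolding homeomorphism_def by blast
    have c: "continuous_on ({0::real} \<times> V) (\<lambda>(s, x). g x)"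
    proof -
      have "snd ` ({0::real} \<times> V) \<subseteq> V" by auto
      from continuous_on_compose2[OF c continuous_on_snd[OF continuous_on_id] this]
      show ?thesis by (simp add: case_prod_beta)
    qed
    { case 0 show ?case using c by simp }
    case (Suc k)
    have entry: "param_Ck k {0} V (\<lambda>_ y. vec_nth (vec_nth (A y) i) j)" for i j
    proof -
      have "param_Ck k {0} V (\<lambda>_ y. vec_nth (frechet_derivative f (at (g y)) (axis j 1)) i)"
        by (rule param_Ck_linear[OF bounded_linear_vec_nth param_Ck_compose[OF
              smooth_on_param_Ck[OF U(1) smooth_on_frechet_derivative[OF f]] Suc gU]])
      then show ?thesis by (simp add: A_def matrix_def)
    qed
    show ?case
    proof (rule param_Ck_SucI[OF c dg])
      fix v
      have "param_Ck k {0} V (\<lambda>_ y. vec_lambda (\<lambda>k. Determinants.det (vec_lambda (\<lambda>i. vec_lambda (\<lambda>j.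
          if j = k then vec_nth v i else vec_nth (vec_nth (A y) i) j))) * inverse (Determinants.det (A y))))"
      proof (intro param_Ck_vec_lambda param_Ck_bilinear[OF bounded_bilinear_mult] param_Ck_det
          param_Ck_real_inverse entry)
        show "param_Ck k {0} V (\<lambda>_ x. vec_nth (vec_nth (vec_lambda (\<lambda>i. vec_lambda (\<lambda>j.
            if j = l then vec_nth v i else vec_nth (vec_nth (A x) i) j))) i) j)" for i j l
          by (cases "j = l") (simp_all add: param_Ck_const entry)
      qed (use detA in simp)
      then show "param_Ck k {0} V (\<lambda>s x. g' x v)"
        by (rule param_Ck_cong[OF V(1), rotated]) (simp add: g'v divide_inverse)
    qed
  qed
  have "smooth_on V g" by (rule smooth_onI_param_Ck[OF V(1) gC])
  with U'(1,3,2) V(1) fV gf show thesis by (intro that[of U' g]) simp_all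
qed

section \<open>Common kernels and adapted coordinates\<close>

lemma smooth_on_vec_lambda:
  fixes f :: "'n::finite \<Rightarrow> 'a::real_normed_vector \<Rightarrow> real"
  assumes "open U" "\<And>c. smooth_on U (f c)"
  shows "smooth_on U (\<lambda>x. vec_lambda (\<lambda>c. f c x))"
  by (rule smooth_onI_param_Ck[OF assms(1) param_Ck_vec_lambda[OF smooth_on_param_Ck[OF assms]]])

lemma frechet_derivative_linear_compose:
  assumes "bounded_linear L" "f differentiable (at x)"
  shows "frechet_derivative (\<lambda>x. L (f x)) (at x) v = L (frechet_derivative f (at x) v)"
proof -
  have "(f has_derivative frechet_derivative f (at x)) (at x)"
    using assms(2) by (simp add: frechet_derivative_works)
  from frechet_derivative_eqI[OF bounded_linear.has_derivative[OF assms(1) this]] show ?thesis by simp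
qed

lemma smooth_on_differentiable: "smooth_on U f \<Longrightarrow> x \<in> U \<Longrightarrow> f differentiable (at x)"
  using smooth_on_has_derivative unfolding differentiable_def by blast

text \<open>The kernel is the orthogonal complement of the gradients \<open>a t\<close>.
  Surjectivity provides vectors dual to these, hence their independence.\<close>

lemma dim_common_kernel:
  fixes l :: "nat \<Rightarrow> 'a::euclidean_space \<Rightarrow> real"
  assumes lin: "\<And>t. t < N \<Longrightarrow> linear (l t)"
    and surj: "\<And>w. \<exists>v. \<forall>t<N. l t v = w t"
  shows "Real_Vector_Spaces.subspace {v. \<forall>t<N. l t v = 0}" "dim {v. \<forall>t<N. l t v = 0} + N = DIM('a)"
proof -
  let ?K = "{v. \<forall>t<N. l t v = 0}"
  show "Real_Vector_Spaces.subspace ?K"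
    using linear_0[OF lin] linear_add[OF lin] linear_cmul[OF lin] by (auto simp: Real_Vector_Spaces.subspace_def)
  define a where "a t = (\<Sum>b\<in>Basis. l t b *\<^sub>R b)" for t
  have a: "inner (a t) v = l t v" if "t < N" for t v
  proof -
    note L = lin[OF that]
    have "l t v = l t (\<Sum>b\<in>Basis. inner v b *\<^sub>R b)" by (simp only: euclidean_representation)
    also have "\<dots> = (\<Sum>b\<in>Basis. inner v b * l t b)"
      by (simp only: linear_sum[OF L] linear_cmul[OF L] real_scaleR_def)
    also have "\<dots> = inner (a t) v"
      unfolding a_def inner_sum_left by (intro sum.cong refl) (simp add: inner_commute)
    finally show ?thesis by simp
  qed
  define e where "e s = (SOME v. \<forall>t<N. l t v = (if t = s then 1 else 0))" for s
  have e: "l t (e s) = (if t = s then 1 else 0)" if "t < N" for s t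
    using someI_ex[OF surj[of "\<lambda>t. if t = s then 1 else 0"]] that unfolding e_def by simp
  have inj: "inj_on a {..<N}"
  proof (rule inj_onI)
    fix s t assume s: "s \<in> {..<N}" and t: "t \<in> {..<N}" and "a s = a t"
    then have "l s (e s) = l t (e s)" using a[of s "e s"] a[of t "e s"] s t by simp
    then show "s = t" using e[of s s] e[of t s] s t by (simp split: if_splits)
  qed
  have ind: "independent (a ` {..<N})"
  proof (rule independent_if_scalars_zero)
    fix f x assume sum0: "(\<Sum>x\<in>a ` {..<N}. f x *\<^sub>R x) = 0" and "x \<in> a ` {..<N}"
    then obtain s where s: "s < N" "x = a s" by blast
    have "0 = inner (\<Sum>t<N. f (a t) *\<^sub>R a t) (e s)"
      using sum0 by (simp add: sum.reindex[OF inj] o_def)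
    also have "\<dots> = (\<Sum>t<N. f (a t) * (if t = s then 1 else 0))"
      unfolding inner_sum_left by (intro sum.cong refl) (simp add: a e)
    also have "\<dots> = f (a s)" using s(1) by (simp add: if_distrib cong: if_cong)
    finally show "f x = 0" using s(2) by simp
  qed simp
  have dimA: "dim (span (a ` {..<N})) = N"
    using dim_eq_card_independent[OF ind] card_image[OF inj] by (simp add: dim_span)
  have K: "?K = {y \<in> UNIV. \<forall>x \<in> span (a ` {..<N}). Linear_Algebra.orthogonal x y}"
  proof (intro equalityI subsetI)
    fix y assume y: "y \<in> ?K"
    have "Linear_Algebra.orthogonal y x" if "x \<in> span (a ` {..<N})" for x
    proof (rule orthogonal_to_span[OF that])
      fix z assume "z \<in> a ` {..<N}"
      then obtain t where "t < N" "z = a t" by blast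
      then show "Linear_Algebra.orthogonal y z" using y a by (simp add: Linear_Algebra.orthogonal_def inner_commute)
    qed
    then show "y \<in> {y \<in> UNIV. \<forall>x \<in> span (a ` {..<N}). Linear_Algebra.orthogonal x y}"
      by (simp add: orthogonal_commute)
  next
    fix y assume y: "y \<in> {y \<in> UNIV. \<forall>x \<in> span (a ` {..<N}). Linear_Algebra.orthogonal x y}"
    have "l t y = 0" if "t < N" for t
    proof -
      have "a t \<in> span (a ` {..<N})" using that by (intro span_base) simp
      with y have "inner (a t) y = 0" by (simp add: Linear_Algebra.orthogonal_def)
      with a[OF that] show ?thesis by simp
    qed
    then show "y \<in> ?K" by simp
  qed
  have "dim {y \<in> UNIV. \<forall>x \<in> span (a ` {..<N}). Linear_Algebra.orthogonal x y} + dim (span (a ` {..<N})) = dim (UNIV :: 'a set)"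
    by (rule dim_subspace_orthogonal_to_vectors) (simp_all add: Real_Vector_Spaces.subspace_span)
  then show "dim ?K + N = DIM('a)" using K dimA by (simp add: dim_UNIV)
qed

text \<open>If the derivative of the coordinate map at \<open>x0\<close> kills v, then so do all
  d\<xi> and hence all d\<omega>, each \<omega> being one of the \<xi>. Thus v lies in
  \<open>K\<close> and is reproduced by the derivative of the first integrals; the \<eta> components
  then say that v is orthogonal to a basis of \<open>K\<close>, so v = 0. The coordinate map enters
  the conclusion through an equation, so that a caller can insert its own expression for it.\<close>

lemma adapted_coordinates:
  fixes X :: "nat \<Rightarrow> real^'n \<Rightarrow> real^'n" and \<omega> \<xi> :: "nat \<Rightarrow> real^'n \<Rightarrow> real"
  assumes U: "open U" "x0 \<in> U"
    and X: "\<And>i. i < d \<Longrightarrow> smooth_on U (X i)"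
    and \<omega>: "\<And>i. i < d \<Longrightarrow> smooth_on U (\<omega> i)"
    and dual: "\<And>i j x. i < d \<Longrightarrow> j < d \<Longrightarrow> x \<in> U \<Longrightarrow>
        frechet_derivative (\<omega> j) (at x) (X i x) = (if i = j then 1 else 0)"
    and comm: "\<And>i j x. i < d \<Longrightarrow> j < d \<Longrightarrow> x \<in> U \<Longrightarrow>
        frechet_derivative (X i) (at x) (X j x) = frechet_derivative (X j) (at x) (X i x)"
    and \<xi>: "\<And>t. t < N \<Longrightarrow> smooth_on U (\<xi> t)"
    and \<omega>\<xi>: "\<And>i. i < d \<Longrightarrow> \<exists>t<N. \<omega> i = \<xi> t"
    and surj: "\<And>w. \<exists>v. \<forall>t<N. frechet_derivative (\<xi> t) (at x0) v = w t"
  obtains V \<eta> where "open V" "x0 \<in> V" "V \<subseteq> U" "\<And>k. k < CARD('n) - N \<Longrightarrow> smooth_on V (\<eta> k)"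
    "\<And>k i x. k < CARD('n) - N \<Longrightarrow> i < d \<Longrightarrow> x \<in> V \<Longrightarrow> frechet_derivative (\<eta> k) (at x) (X i x) = 0"
    "\<And>F. F = (\<lambda>x. vec_lambda (\<lambda>c::'n. let k = to_nat_on UNIV c in
        if k < CARD('n) - N then \<eta> k x else \<xi> (k - (CARD('n) - N)) x)) \<Longrightarrow>
        open (F ` V) \<and> (\<exists>G. smooth_on (F ` V) G \<and> (\<forall>x\<in>V. G (F x) = x))"
proof -
  let ?n = "CARD('n)"
  have der\<xi>: "linear (frechet_derivative (\<xi> t) (at x0))" if "t < N" for t
    by (rule has_derivative_linear[OF smooth_on_has_derivative[OF \<xi>[OF that] U(2)]])
  define K where "K = {v. \<forall>t<N. frechet_derivative (\<xi> t) (at x0) v = 0}"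
  note dk = dim_common_kernel[OF der\<xi> surj, folded K_def]
  have K: "dim K + N = ?n" using dk(2) by simp
  obtain B where B: "B \<subseteq> K" "independent B" "K \<subseteq> span B" "card B = dim K"
    by (rule real_vector.basis_exists[of K]) blast
  have "finite B" using B(2) by (rule independent_imp_finite)
  from ex_bij_betw_nat_finite[OF this] obtain \<kappa> where "bij_betw \<kappa> {0..<card B} B" by blast
  moreover have "card B = ?n - N" using B(4) K by simp
  ultimately have \<kappa>: "\<kappa> ` {0..<?n - N} = B" using bij_betw_imp_surj_on by metis
  obtain V0 and \<psi> :: "real^'n \<Rightarrow> real^'n" where V0: "open V0" "x0 \<in> V0" "V0 \<subseteq> U"
    and \<psi>: "smooth_on V0 \<psi>"
    and \<psi>X: "\<And>x i. x \<in> V0 \<Longrightarrow> i < d \<Longrightarrow> frechet_derivative \<psi> (at x) (X i x) = 0"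
    and \<psi>id: "\<And>v. (\<And>j. j < d \<Longrightarrow> frechet_derivative (\<omega> j) (at x0) v = 0) \<Longrightarrow>
        frechet_derivative \<psi> (at x0) v = v"
  proof (rule commuting_fields_first_integrals[where X = X and \<omega> = \<omega> and d = d, OF U X \<omega> dual comm], goal_cases)
    case (9 V \<psi>)
    show ?case by (rule 9(1)[OF 9(2-7)])
  qed
  define \<eta> where "\<eta> k x = inner (\<kappa> k) (\<psi> x)" for k x
  have d\<eta>: "frechet_derivative (\<eta> k) (at x) v = inner (\<kappa> k) (frechet_derivative \<psi> (at x) v)" if "x \<in> V0" for k x v
    unfolding \<eta>_def[abs_def]
    by (rule frechet_derivative_linear_compose[OF bounded_linear_inner_right smooth_on_differentiable[OF \<psi> that]])
  have \<eta>S: "smooth_on V0 (\<eta> k)" for k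
    unfolding \<eta>_def[abs_def] by (rule smooth_on_linear[OF V0(1) bounded_linear_inner_right \<psi>])
  define F where "F = (\<lambda>x. vec_lambda (\<lambda>c::'n. let k = to_nat_on UNIV c in
        if k < ?n - N then \<eta> k x else \<xi> (k - (?n - N)) x))"
  have tonat: "bij_betw (to_nat_on (UNIV :: 'n set)) UNIV {..<?n}"
    by (rule to_nat_on_finite) simp
  have lt: "to_nat_on UNIV c < ?n" for c :: 'n using tonat by (auto simp: bij_betw_def)
  have comp: "smooth_on V0 (\<lambda>x. let k = to_nat_on UNIV c in
        if k < ?n - N then \<eta> k x else \<xi> (k - (?n - N)) x)" for c :: 'n
  proof (cases "to_nat_on UNIV c < ?n - N")
    case True
    then show ?thesis by (simp add: \<eta>S)
  next
    case False
    then have "to_nat_on UNIV c - (?n - N) < N" using lt[of c] K by linarith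
    from smooth_on_subset[OF U(1) \<xi>[OF this] V0(1,3)] False show ?thesis by simp
  qed
  have FS: "smooth_on V0 F"
    unfolding F_def by (rule smooth_on_vec_lambda[OF V0(1) comp])
  have dF: "frechet_derivative (\<lambda>x. vec_nth (F x) c) (at x0) v = vec_nth (frechet_derivative F (at x0) v) c" for c v
    by (rule frechet_derivative_linear_compose[OF bounded_linear_vec_nth smooth_on_differentiable[OF FS V0(2)]])
  have inj0: "v = 0" if "frechet_derivative F (at x0) v = 0" for v
  proof -
    have coord: "frechet_derivative (if k < ?n - N then \<eta> k else \<xi> (k - (?n - N))) (at x0) v = 0" if "k < ?n" for k
    proof -
      have "k \<in> to_nat_on UNIV ` (UNIV :: 'n set)"
        using bij_betw_imp_surj_on[OF tonat] \<open>k < ?n\<close> by simp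
      then obtain c :: 'n where "k = to_nat_on UNIV c" by (rule imageE)
      then have c: "to_nat_on UNIV c = k" by simp
      have "(\<lambda>x. vec_nth (F x) c) = (if k < ?n - N then \<eta> k else \<xi> (k - (?n - N)))"
        by (rule ext) (simp add: F_def c)
      then show ?thesis using dF[of c v] \<open>frechet_derivative F (at x0) v = 0\<close> by simp
    qed
    have vK: "frechet_derivative (\<xi> t) (at x0) v = 0" if "t < N" for t
    proof -
      have "t + (?n - N) < ?n" using that K by linarith
      from coord[OF this] show ?thesis by (simp split: if_splits)
    qed
    have "frechet_derivative (\<omega> j) (at x0) v = 0" if "j < d" for j
      using \<omega>\<xi>[OF that] vK by auto
    then have \<psi>v: "frechet_derivative \<psi> (at x0) v = v" by (rule \<psi>id)
    have "Linear_Algebra.orthogonal v b" if "b \<in> B" for b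
    proof -
      from that have "b \<in> \<kappa> ` {0..<?n - N}" by (simp only: \<kappa>)
      then obtain k where k: "k < ?n - N" "b = \<kappa> k" by auto
      have "k < ?n" using k(1) by simp
      from coord[OF this] k(1) have "inner (\<kappa> k) v = 0" using d\<eta>[OF V0(2), of k v] \<psi>v by simp
      then show ?thesis using k(2) by (simp add: Linear_Algebra.orthogonal_def inner_commute)
    qed
    moreover have "v \<in> span B" using subsetD[OF B(3), of v] vK by (simp add: K_def)
    ultimately have "Linear_Algebra.orthogonal v v" by (rule orthogonal_to_span[rotated])
    then show ?thesis by (simp add: Linear_Algebra.orthogonal_def)
  qed
  obtain V g where V: "open V" "x0 \<in> V" "V \<subseteq> V0" "open (F ` V)" "smooth_on (F ` V) g" "\<And>x. x \<in> V \<Longrightarrow> g (F x) = x"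
  proof (rule smooth_inverse_function[OF V0(1,2) FS inj0], goal_cases)
    case (2 V g)
    show ?case by (rule 2(1)[OF 2(2-7)])
  qed
  show thesis
  proof (rule that[of V \<eta>])
    show "V \<subseteq> U" using V(3) V0(3) by blast
    show "smooth_on V (\<eta> k)" for k by (rule smooth_on_subset[OF V0(1) \<eta>S V(1,3)])
    show "frechet_derivative (\<eta> k) (at x) (X i x) = 0" if "i < d" "x \<in> V" for k i x
    proof -
      have "x \<in> V0" using that(2) V(3) by blast
      from d\<eta>[OF this] \<psi>X[OF this that(1)] show ?thesis by simp
    qed
    fix F' assume "F' = (\<lambda>x. vec_lambda (\<lambda>c::'n. let k = to_nat_on UNIV c in
        if k < ?n - N then \<eta> k x else \<xi> (k - (?n - N)) x))"
    then have "F' = F" by (simp add: F_def)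
    with V(4-6) show "open (F' ` V) \<and> (\<exists>G. smooth_on (F' ` V) G \<and> (\<forall>x\<in>V. G (F' x) = x))" by blast
  qed (use V in auto)
qed

subsection \<open>Smooth vector and matrix functions\<close>

lemma smooth_vecD:
  assumes "smooth_vec U d \<Theta>"
  shows "\<And>x. x \<in> U \<Longrightarrow> \<Theta> x \<in> carrier_vec d" "\<And>i. i < d \<Longrightarrow> smooth_on U (\<lambda>x. \<Theta> x $ i)"
  using assms by (auto simp: smooth_vec_def)

lemma smooth_matD:
  assumes "smooth_mat U r c M"
  shows "\<And>x. x \<in> U \<Longrightarrow> M x \<in> carrier_mat r c" "\<And>i j. i < r \<Longrightarrow> j < c \<Longrightarrow> smooth_on U (\<lambda>x. M x $$ (i, j))"
  using assms by (auto simp: smooth_mat_def)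

lemma smooth_vec_cong:
  assumes "open U" "smooth_vec U d \<Theta>" "\<And>x. x \<in> U \<Longrightarrow> \<Theta> x = \<Xi> x"
  shows "smooth_vec U d \<Xi>"
  unfolding smooth_vec_def
proof (intro conjI ballI allI impI)
  show "\<Xi> x \<in> carrier_vec d" if "x \<in> U" for x using smooth_vecD(1)[OF assms(2) that] assms(3)[OF that] by simp
  show "smooth_on U (\<lambda>x. \<Xi> x $ i)" if "i < d" for i
    by (rule smooth_on_cong[OF assms(1) smooth_vecD(2)[OF assms(2) that]]) (simp add: assms(3))
qed

lemma smooth_vec_subset:
  assumes "open U" "smooth_vec U d \<Theta>" "open V" "V \<subseteq> U"
  shows "smooth_vec V d \<Theta>"
  using assms(4) smooth_vecD(1)[OF assms(2)] smooth_on_subset[OF assms(1) smooth_vecD(2)[OF assms(2)] assms(3,4)]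
  by (auto simp: smooth_vec_def)

lemma smooth_mat_subset:
  assumes "open U" "smooth_mat U r c \<Theta>" "open V" "V \<subseteq> U"
  shows "smooth_mat V r c \<Theta>"
  using assms(4) smooth_matD(1)[OF assms(2)] smooth_on_subset[OF assms(1) smooth_matD(2)[OF assms(2)] assms(3,4)]
  by (auto simp: smooth_mat_def)

lemma smooth_mat_const: "open U \<Longrightarrow> M \<in> carrier_mat r c \<Longrightarrow> smooth_mat U r c (\<lambda>x. M)"
  by (simp add: smooth_mat_def smooth_on_const)

lemma mult_mat_vec_index:
  assumes "A \<in> carrier_mat r c" "v \<in> carrier_vec c" "i < r"
  shows "(A *\<^sub>v v) $ i = (\<Sum>j<c. A $$ (i, j) * v $ j)"
  using assms by (simp add: scalar_prod_def lessThan_atLeast0)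

lemma mult_mat_index:
  assumes "A \<in> carrier_mat r k" "B \<in> carrier_mat k c" "i < r" "j < c"
  shows "(A * B) $$ (i, j) = (\<Sum>l<k. A $$ (i, l) * B $$ (l, j))"
  using assms by (simp add: scalar_prod_def lessThan_atLeast0)

lemma smooth_mat_mult:
  assumes U: "open U" and A: "smooth_mat U r k A" and B: "smooth_mat U k c B"
  shows "smooth_mat U r c (\<lambda>x. A x * B x)"
  unfolding smooth_mat_def
proof (intro conjI ballI allI impI)
  show "A x * B x \<in> carrier_mat r c" if "x \<in> U" for x
    using smooth_matD(1)[OF A that] smooth_matD(1)[OF B that] by simp
  show "smooth_on U (\<lambda>x. (A x * B x) $$ (i, j))" if ij: "i < r" "j < c" for i j
  proof (rule smooth_on_cong[OF U])
    show "smooth_on U (\<lambda>x. \<Sum>l<k. A x $$ (i, l) * B x $$ (l, j))"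
      by (intro smooth_on_sum smooth_on_mult U smooth_matD(2)[OF A] smooth_matD(2)[OF B] ij) simp_all
    show "(\<Sum>l<k. A x $$ (i, l) * B x $$ (l, j)) = (A x * B x) $$ (i, j)" if "x \<in> U" for x
      by (rule mult_mat_index[OF smooth_matD(1)[OF A that] smooth_matD(1)[OF B that] ij, symmetric])
  qed
qed

lemma smooth_mat_mult_vec:
  assumes U: "open U" and A: "smooth_mat U r c A" and v: "smooth_vec U c v"
  shows "smooth_vec U r (\<lambda>x. A x *\<^sub>v v x)"
  unfolding smooth_vec_def
proof (intro conjI ballI allI impI)
  show "A x *\<^sub>v v x \<in> carrier_vec r" if "x \<in> U" for x
    by (rule mult_mat_vec_carrier[OF smooth_matD(1)[OF A that] smooth_vecD(1)[OF v that]])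
  show "smooth_on U (\<lambda>x. (A x *\<^sub>v v x) $ i)" if i: "i < r" for i
  proof (rule smooth_on_cong[OF U])
    show "smooth_on U (\<lambda>x. \<Sum>l<c. A x $$ (i, l) * v x $ l)"
      by (intro smooth_on_sum smooth_on_mult U smooth_matD(2)[OF A] smooth_vecD(2)[OF v] i) simp_all
    show "(\<Sum>l<c. A x $$ (i, l) * v x $ l) = (A x *\<^sub>v v x) $ i" if "x \<in> U" for x
      by (rule mult_mat_vec_index[OF smooth_matD(1)[OF A that] smooth_vecD(1)[OF v that] i, symmetric])
  qed
qed

lemma index_append_rows:
  assumes "A \<in> carrier_mat a c" "B \<in> carrier_mat b c" "i < a + b" "j < c"
  shows "(A @\<^sub>r B) $$ (i, j) = (if i < a then A $$ (i, j) else B $$ (i - a, j))"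
  using assms by (auto simp: append_rows_def)

lemma smooth_mat_append_rows:
  assumes U: "open U" and A: "smooth_mat U a c A" and B: "smooth_mat U b c B"
  shows "smooth_mat U (a + b) c (\<lambda>x. A x @\<^sub>r B x)"
  unfolding smooth_mat_def
proof (intro conjI ballI allI impI)
  show "A x @\<^sub>r B x \<in> carrier_mat (a + b) c" if "x \<in> U" for x
    using smooth_matD(1)[OF A that] smooth_matD(1)[OF B that] by simp
  show "smooth_on U (\<lambda>x. (A x @\<^sub>r B x) $$ (i, j))" if ij: "i < a + b" "j < c" for i j
  proof (rule smooth_on_cong[OF U])
    show "smooth_on U (\<lambda>x. if i < a then A x $$ (i, j) else B x $$ (i - a, j))"
      using ij smooth_matD(2)[OF A] smooth_matD(2)[OF B] by (cases "i < a") simp_all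
    show "(if i < a then A x $$ (i, j) else B x $$ (i - a, j)) = (A x @\<^sub>r B x) $$ (i, j)" if "x \<in> U" for x
      by (rule index_append_rows[OF smooth_matD(1)[OF A that] smooth_matD(1)[OF B that] ij, symmetric])
  qed
qed

lemma smooth_on_mat_det:
  assumes U: "open U" and A: "smooth_mat U n n A"
  shows "smooth_on U (\<lambda>x. Determinant.det (A x))"
proof (rule smooth_on_cong[OF U])
  show "smooth_on U (\<lambda>x. \<Sum>p\<in>{p. p permutes {0..<n}}. signof p * (\<Prod>i = 0..<n. A x $$ (i, p i)))"
  proof (intro smooth_on_sum smooth_on_mult smooth_on_const smooth_on_prod U smooth_matD(2)[OF A])
    show "p i < n" if "p \<in> {p. p permutes {0..<n}}" "i \<in> {0..<n}" for p i
      using permutes_in_image[of p "{0..<n}" i] that by simp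
  qed simp
  show "(\<Sum>p\<in>{p. p permutes {0..<n}}. signof p * (\<Prod>i = 0..<n. A x $$ (i, p i))) = Determinant.det (A x)"
    if "x \<in> U" for x
    by (rule det_def'[OF smooth_matD(1)[OF A that], symmetric])
qed

lemma smooth_mat_delete:
  assumes U: "open U" and A: "smooth_mat U n n A"
  shows "smooth_mat U (n - 1) (n - 1) (\<lambda>x. mat_delete (A x) i j)"
  unfolding smooth_mat_def
proof (intro conjI ballI allI impI)
  show "mat_delete (A x) i j \<in> carrier_mat (n - 1) (n - 1)" if "x \<in> U" for x
    by (rule mat_delete_carrier[OF smooth_matD(1)[OF A that]])
  show "smooth_on U (\<lambda>x. mat_delete (A x) i j $$ (k, l))" if kl: "k < n - 1" "l < n - 1" for k l
  proof (rule smooth_on_cong[OF U])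
    show "smooth_on U (\<lambda>x. A x $$ (if k < i then k else Suc k, if l < j then l else Suc l))"
      by (rule smooth_matD(2)[OF A]) (use kl in auto)
    show "A x $$ (if k < i then k else Suc k, if l < j then l else Suc l) = mat_delete (A x) i j $$ (k, l)"
      if "x \<in> U" for x
      using smooth_matD(1)[OF A that] kl by (simp add: mat_delete_def)
  qed
qed

text \<open>The adjugate formula at the end is recorded for smoothness: it presents the entries of
  the inverse as polynomials divided by a non-vanishing determinant.\<close>

lemma mat_inverse_spec:
  fixes A :: "real Matrix.mat"
  assumes A: "A \<in> carrier_mat n n" and inv: "invertible_mat A"
  shows "the (mat_inverse A) \<in> carrier_mat n n" "A * the (mat_inverse A) = 1\<^sub>m n" "the (mat_inverse A) * A = 1\<^sub>m n"
    "Determinant.det A \<noteq> 0"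
    "the (mat_inverse A) = (1 / Determinant.det A) \<cdot>\<^sub>m adj_mat A"
proof -
  obtain B where AB: "A * B = 1\<^sub>m n" and BA: "B * A = 1\<^sub>m (dim_row B)"
    using inv A unfolding invertible_mat_def inverts_mat_def by auto
  have "dim_row B = n" using arg_cong[OF BA, of dim_col] A by simp
  moreover have "dim_col B = n" using arg_cong[OF AB, of dim_col] by simp
  ultimately have B: "B \<in> carrier_mat n n" by auto
  have "A \<in> Units (ring_mat TYPE(real) n ())"
    using A B AB BA unfolding Units_def ring_mat_def by auto
  then obtain C where C: "mat_inverse A = Some C"
    using mat_inverse(1)[OF A, where b = "()"] by (cases "mat_inverse A") auto
  from mat_inverse(2)[OF A C] C
  show 1: "the (mat_inverse A) \<in> carrier_mat n n" "A * the (mat_inverse A) = 1\<^sub>m n" "the (mat_inverse A) * A = 1\<^sub>m n"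
    by simp_all
  let ?C = "the (mat_inverse A)"
  have "Determinant.det A * Determinant.det ?C = 1"
    using det_mult[OF A 1(1)] 1(2) by simp
  then show d: "Determinant.det A \<noteq> 0" by auto
  have "?C * (A * adj_mat A) = ?C * (Determinant.det A \<cdot>\<^sub>m 1\<^sub>m n)" using adj_mat(2)[OF A] by simp
  then have "(?C * A) * adj_mat A = Determinant.det A \<cdot>\<^sub>m (?C * 1\<^sub>m n)"
    using assoc_mult_mat[OF 1(1) A adj_mat(1)[OF A]] mult_smult_distrib[OF 1(1) one_carrier_mat] by simp
  then have "adj_mat A = Determinant.det A \<cdot>\<^sub>m ?C"
    using 1 adj_mat(1)[OF A] by simp
  then show "?C = (1 / Determinant.det A) \<cdot>\<^sub>m adj_mat A"
    using d by (intro eq_matI) simp_all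
qed

lemma smooth_mat_inverse:
  assumes U: "open U" and A: "smooth_mat U n n A" and inv: "\<And>x. x \<in> U \<Longrightarrow> invertible_mat (A x)"
  shows "smooth_mat U n n (\<lambda>x. the (mat_inverse (A x)))"
  unfolding smooth_mat_def
proof (intro conjI ballI allI impI)
  show "the (mat_inverse (A x)) \<in> carrier_mat n n" if "x \<in> U" for x
    by (rule mat_inverse_spec(1)[OF smooth_matD(1)[OF A that] inv[OF that]])
  show "smooth_on U (\<lambda>x. the (mat_inverse (A x)) $$ (i, j))" if ij: "i < n" "j < n" for i j
  proof (rule smooth_on_cong[OF U])
    show "smooth_on U (\<lambda>x. ((-1) ^ (j + i) * Determinant.det (mat_delete (A x) j i)) / Determinant.det (A x))"
      by (intro smooth_on_divide smooth_on_mult smooth_on_const U smooth_on_mat_det[OF U A]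
          smooth_on_mat_det[OF U smooth_mat_delete[OF U A]]
          mat_inverse_spec(4)[OF smooth_matD(1)[OF A] inv])
    show "((-1) ^ (j + i) * Determinant.det (mat_delete (A x) j i)) / Determinant.det (A x)
        = the (mat_inverse (A x)) $$ (i, j)" if "x \<in> U" for x
      using smooth_matD(1)[OF A that] ij
      by (simp add: mat_inverse_spec(5)[OF smooth_matD(1)[OF A that] inv[OF that]] adj_mat_def cofactor_def)
  qed
qed

section \<open>States as points and as coordinate vectors\<close>

lemma bij_to_nat_on_UNIV: "bij_betw (to_nat_on (UNIV :: 'n::finite set)) UNIV {..<CARD('n)}"
  by (rule to_nat_on_finite) simp

lemma from_nat_into_to_nat_on_UNIV: "from_nat_into UNIV (to_nat_on UNIV c) = (c :: 'n::finite)"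
  by (rule from_nat_into_to_nat_on) (simp_all add: countable_finite)

lemma to_nat_on_less_CARD: "to_nat_on UNIV (c :: 'n::finite) < CARD('n)"
  using bij_betw_apply[OF bij_to_nat_on_UNIV, of c] by simp

lemma point_of_axis_sum:
  assumes "w \<in> carrier_vec CARD('n)"
  shows "(point_of w :: real^'n) = (\<Sum>j<CARD('n). (w $ j) *\<^sub>R axis (from_nat_into UNIV j) 1)"
proof -
  have "(\<Sum>j<CARD('n). (w $ j) *\<^sub>R axis (from_nat_into UNIV j :: 'n) (1::real))
      = (\<Sum>c\<in>UNIV. (w $ to_nat_on UNIV c) *\<^sub>R axis (c :: 'n) 1)"
    by (rule sum.reindex_bij_betw[OF bij_to_nat_on_UNIV, symmetric, THEN trans])
      (simp add: from_nat_into_to_nat_on_UNIV)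
  also have "\<dots> = point_of w"
    by (simp add: point_of_def Finite_Cartesian_Product.vec_eq_iff sum_component axis_def if_distrib cong: if_cong)
  finally show ?thesis by simp
qed

lemma point_of_add:
  "u \<in> carrier_vec CARD('n) \<Longrightarrow> w \<in> carrier_vec CARD('n) \<Longrightarrow> (point_of (u + w) :: real^'n) = point_of u + point_of w"
  by (simp add: point_of_def Finite_Cartesian_Product.vec_eq_iff to_nat_on_less_CARD)

lemma point_of_diff:
  "u \<in> carrier_vec CARD('n) \<Longrightarrow> w \<in> carrier_vec CARD('n) \<Longrightarrow> (point_of (u - w) :: real^'n) = point_of u - point_of w"
  by (simp add: point_of_def Finite_Cartesian_Product.vec_eq_iff to_nat_on_less_CARD)

lemma smooth_on_point_of:
  assumes "open U" "smooth_vec U CARD('n) X"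
  shows "smooth_on U (\<lambda>x. point_of (X x) :: real^'n)"
  unfolding point_of_def
  by (rule smooth_on_vec_lambda[OF assms(1) smooth_vecD(2)[OF assms(2) to_nat_on_less_CARD]])

lemma gradient_scalar_prod:
  fixes \<theta> :: "real^'n \<Rightarrow> real"
  assumes "\<theta> differentiable (at x)" "w \<in> carrier_vec CARD('n)"
  shows "gradient \<theta> x \<bullet> w = frechet_derivative \<theta> (at x) (point_of w)"
proof -
  have lin: "linear (frechet_derivative \<theta> (at x))"
    using assms(1) by (rule linear_frechet_derivative)
  have "frechet_derivative \<theta> (at x) (point_of w) = (\<Sum>j<CARD('n). (w $ j) * partial_deriv \<theta> x j)"
    unfolding point_of_axis_sum[OF assms(2)] linear_sum[OF lin] linear_cmul[OF lin] partial_deriv_def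
    by simp
  then show ?thesis
    using assms(2) by (simp add: gradient_def scalar_prod_def lessThan_atLeast0 mult.commute)
qed

lemma jacobian_mat_carrier:
  "\<Theta> x \<in> carrier_vec d \<Longrightarrow> jacobian_mat \<Theta> (x :: real^'n) \<in> carrier_mat d CARD('n)"
  by (simp add: jacobian_mat_def)

lemma jacobian_mult_index:
  fixes \<Theta> :: "real^'n \<Rightarrow> real Matrix.vec"
  assumes "\<Theta> x \<in> carrier_vec d" "i < d" "(\<lambda>z. \<Theta> z $ i) differentiable (at x)" "w \<in> carrier_vec CARD('n)"
  shows "(jacobian_mat \<Theta> x *\<^sub>v w) $ i = frechet_derivative (\<lambda>z. \<Theta> z $ i) (at x) (point_of w)"
proof -
  have "(jacobian_mat \<Theta> x *\<^sub>v w) $ i = gradient (\<lambda>z. \<Theta> z $ i) x \<bullet> w"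
    using assms by (simp add: jacobian_mat_def gradient_def scalar_prod_def)
  with gradient_scalar_prod[OF assms(3,4)] show ?thesis by simp
qed

lemma smooth_mat_jacobian:
  assumes U: "open U" and \<Theta>: "smooth_vec U d \<Theta>"
  shows "smooth_mat U d CARD('n) (jacobian_mat (\<Theta> :: real^'n \<Rightarrow> real Matrix.vec))"
  unfolding smooth_mat_def
proof (intro conjI ballI allI impI)
  show "jacobian_mat \<Theta> x \<in> carrier_mat d CARD('n)" if "x \<in> U" for x
    using smooth_vecD(1)[OF \<Theta> that] by (rule jacobian_mat_carrier)
  show "smooth_on U (\<lambda>x. jacobian_mat \<Theta> x $$ (i, j))" if i: "i < d" and j: "j < CARD('n)" for i j
  proof (rule smooth_on_cong[OF U smooth_on_frechet_derivative[OF smooth_vecD(2)[OF \<Theta> i]]])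
    show "frechet_derivative (\<lambda>x. \<Theta> x $ i) (at x) (axis (from_nat_into UNIV j) 1) = jacobian_mat \<Theta> x $$ (i, j)"
      if "x \<in> U" for x
      using smooth_vecD(1)[OF \<Theta> that] i j by (simp add: jacobian_mat_def partial_deriv_def)
  qed
qed

lemma smooth_lie_vec:
  fixes \<Theta> f :: "real^'n \<Rightarrow> real Matrix.vec"
  assumes "open U" "smooth_vec U CARD('n) f" "smooth_vec U d \<Theta>"
  shows "smooth_vec U d (lie_vec f \<Theta>)"
  unfolding lie_vec_def[abs_def]
  by (rule smooth_mat_mult_vec[OF assms(1) smooth_mat_jacobian[OF assms(1,3)] assms(2)])

lemma smooth_lie_mat:
  fixes \<Theta> :: "real^'n \<Rightarrow> real Matrix.vec"
  assumes "open U" "smooth_mat U CARD('n) m g" "smooth_vec U d \<Theta>"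
  shows "smooth_mat U d m (lie_mat g \<Theta>)"
  unfolding lie_mat_def[abs_def]
  by (rule smooth_mat_mult[OF assms(1) smooth_mat_jacobian[OF assms(1,3)] assms(2)])

text \<open>\<open>rank\<close> is the dimension of the column space, and a maximal independent set
  of \<open>r\<close> columns is a basis of the whole space. Surjectivity is the form in which full
  row rank is used and proved below.\<close>

lemma full_row_rank_iff_surjective:
  assumes A: "A \<in> carrier_mat r c"
  shows "full_row_rank A \<longleftrightarrow> (\<forall>w\<in>carrier_vec r. \<exists>v\<in>carrier_vec c. A *\<^sub>v v = w)"
proof -
  interpret vec_space "TYPE(real)" r .
  have cols: "set (cols A) \<subseteq> carrier_vec r" using A cols_dim by blast
  have cs: "col_space A = {y \<in> carrier_vec r. \<exists>x\<in>carrier_vec c. A *\<^sub>v x = y}"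
    using col_space_eq[OF A] A by simp
  have rk: "full_row_rank A \<longleftrightarrow> vec_space.rank r A = r"
    using A by (simp add: full_row_rank_def mat_rank_def)
  show ?thesis
  proof
    assume "full_row_rank A"
    then have "rank A = r" using rk by simp
    have "lin_indpt {}" using finite_lin_indpt2[of "{}"] by simp
    then obtain S where S: "maximal S (\<lambda>T. T \<subseteq> set (cols A) \<and> lin_indpt T)"
      using maximal_exists_superset[of "set (cols A)" "\<lambda>T. T \<subseteq> set (cols A) \<and> lin_indpt T" "{}"] by auto
    from rank_card_indpt[OF A S] \<open>rank A = r\<close> have "card S = r" by simp
    have S': "S \<subseteq> set (cols A)" "lin_indpt S" using S by (auto simp: maximal_def)
    have "basis S"
    proof (rule dim_li_is_basis)
      show "fin_dim" by (rule fin_dim)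
      show "finite S" using S'(1) finite_subset by blast
      show "S \<subseteq> carrier_vec r" using S'(1) cols by blast
      show "dim \<le> card S" using \<open>card S = r\<close> dim_is_n by simp
    qed (rule S'(2))
    then have "span S = carrier_vec r" by (simp add: basis_def)
    moreover have "span S \<subseteq> span (set (cols A))" by (rule span_is_monotone[OF S'(1)])
    ultimately have "carrier_vec r \<subseteq> col_space A" by (simp add: col_space_def)
    with cs show "\<forall>w\<in>carrier_vec r. \<exists>v\<in>carrier_vec c. A *\<^sub>v v = w" by blast
  next
    assume "\<forall>w\<in>carrier_vec r. \<exists>v\<in>carrier_vec c. A *\<^sub>v v = w"
    then have "col_space A = carrier_vec r" using cs by blast
    then have sp: "span (set (cols A)) = carrier_vec r" by (simp add: col_space_def)
    have "rank A = vectorspace.dim class_ring (V\<lparr>carrier := carrier_vec r\<rparr>)"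
      unfolding rank_def sp ..
    moreover have "V\<lparr>carrier := carrier_vec r\<rparr> = V" by (simp add: module_vec_def)
    ultimately have "rank A = dim" by simp
    then show "full_row_rank A" using rk dim_is_n by simp
  qed
qed

subsection \<open>Runs of the algorithm\<close>

lemma frechet_derivative_mult_mat:
  fixes \<Xi> :: "real^'n \<Rightarrow> real Matrix.vec"
  assumes U: "open U" and \<Xi>: "smooth_vec U c \<Xi>" and M: "M \<in> carrier_mat r c" and i: "i < r" and x: "x \<in> U"
  shows "frechet_derivative (\<lambda>z. (M *\<^sub>v \<Xi> z) $ i) (at x) w
       = (\<Sum>s<c. M $$ (i, s) * frechet_derivative (\<lambda>z. \<Xi> z $ s) (at x) w)"
proof -
  have "((\<lambda>z. \<Sum>s<c. M $$ (i, s) * \<Xi> z $ s) has_derivative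
      (\<lambda>w. \<Sum>s<c. M $$ (i, s) * frechet_derivative (\<lambda>z. \<Xi> z $ s) (at x) w)) (at x)"
    by (intro has_derivative_sum has_derivative_mult_right smooth_on_has_derivative[OF smooth_vecD(2)[OF \<Xi>] x]) simp
  then have "((\<lambda>z. (M *\<^sub>v \<Xi> z) $ i) has_derivative
      (\<lambda>w. \<Sum>s<c. M $$ (i, s) * frechet_derivative (\<lambda>z. \<Xi> z $ s) (at x) w)) (at x)"
    by (rule has_derivative_transform_within_open[OF _ U x])
      (rule mult_mat_vec_index[OF M smooth_vecD(1)[OF \<Xi>] i, symmetric])
  from frechet_derivative_eqI[OF this] show ?thesis by simp
qed

lemma lie_vec_index:
  fixes \<Xi> f :: "real^'n \<Rightarrow> real Matrix.vec"
  assumes \<Xi>: "smooth_vec U d \<Xi>" and x: "x \<in> U" and i: "i < d" and f: "f x \<in> carrier_vec CARD('n)"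
  shows "lie_vec f \<Xi> x $ i = frechet_derivative (\<lambda>z. \<Xi> z $ i) (at x) (point_of (f x))"
  unfolding lie_vec_def
  by (rule jacobian_mult_index[OF smooth_vecD(1)[OF \<Xi> x] i smooth_on_differentiable[OF smooth_vecD(2)[OF \<Xi> i] x] f])

lemma lie_mat_mult_index:
  fixes \<Xi> :: "real^'n \<Rightarrow> real Matrix.vec"
  assumes \<Xi>: "smooth_vec U d \<Xi>" and x: "x \<in> U" and i: "i < d" and g: "g x \<in> carrier_mat CARD('n) m"
    and u: "u \<in> carrier_vec m"
  shows "(lie_mat g \<Xi> x *\<^sub>v u) $ i = frechet_derivative (\<lambda>z. \<Xi> z $ i) (at x) (point_of (g x *\<^sub>v u))"
proof -
  have "lie_mat g \<Xi> x *\<^sub>v u = jacobian_mat \<Xi> x *\<^sub>v (g x *\<^sub>v u)"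
    unfolding lie_mat_def using smooth_vecD(1)[OF \<Xi> x] by (intro assoc_mult_mat_vec[OF jacobian_mat_carrier g u])
  moreover have "g x *\<^sub>v u \<in> carrier_vec CARD('n)" by (rule mult_mat_vec_carrier[OF g u])
  ultimately show ?thesis
    using jacobian_mult_index[OF smooth_vecD(1)[OF \<Xi> x] i smooth_on_differentiable[OF smooth_vecD(2)[OF \<Xi> i] x]]
    by simp
qed

lemma derivative_along_control:
  fixes \<Xi> f :: "real^'n \<Rightarrow> real Matrix.vec"
  assumes \<Xi>: "smooth_vec U d \<Xi>" and x: "x \<in> U" and i: "i < d" and f: "f x \<in> carrier_vec CARD('n)"
    and g: "g x \<in> carrier_mat CARD('n) m" and u: "u \<in> carrier_vec m"
  shows "frechet_derivative (\<lambda>z. \<Xi> z $ i) (at x) (point_of (f x + g x *\<^sub>v u))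
    = lie_vec f \<Xi> x $ i + (lie_mat g \<Xi> x *\<^sub>v u) $ i"
proof -
  have lin: "linear (frechet_derivative (\<lambda>z. \<Xi> z $ i) (at x))"
    by (rule has_derivative_linear[OF smooth_on_has_derivative[OF smooth_vecD(2)[OF \<Xi> i] x]])
  have gu: "g x *\<^sub>v u \<in> carrier_vec CARD('n)" by (rule mult_mat_vec_carrier[OF g u])
  show ?thesis
    unfolding point_of_add[OF f gu] linear_add[OF lin]
    using lie_vec_index[where f = f, OF \<Xi> x i f] lie_mat_mult_index[where g = g, OF \<Xi> x i g u] by simp
qed

lemma finsum_vec_carrier:
  "X \<in> F \<rightarrow> carrier_vec d \<Longrightarrow> finsum_vec TYPE(real) d X F \<in> carrier_vec d"
  by (rule finsum_vec_closed)

lemma minus_finsum_vec_index: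
  fixes a :: "real Matrix.vec"
  assumes "X \<in> F \<rightarrow> carrier_vec d" "finite F" "i < d"
  shows "(a - finsum_vec TYPE(real) d X F) $ i = a $ i - (\<Sum>l\<in>F. X l $ i)"
  using finsum_vec_carrier[OF assms(1)] assms(3) by (simp add: index_finsum_vec[OF assms(2,3,1)])

locale regular_run =
  fixes U :: "(real^'n) set" and m p :: nat
    and f h :: "real^'n \<Rightarrow> real Matrix.vec" and g :: "real^'n \<Rightarrow> real Matrix.mat"
    and \<rho> :: "nat \<Rightarrow> nat" and R S :: "nat \<Rightarrow> real Matrix.mat"
    and P :: "nat \<Rightarrow> nat \<Rightarrow> real^'n \<Rightarrow> real Matrix.mat"
    and \<Theta> \<Omega> :: "nat \<Rightarrow> real^'n \<Rightarrow> real Matrix.vec" and kstar :: nat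
  assumes system: "affine_system U m p f g h"
    and regular: "regular_algorithm_run U m p f g h \<rho> R S P \<Theta> \<Omega> kstar"
begin

lemma open_U: "open U" and zero_U: "0 \<in> U" and smooth_f: "smooth_vec U CARD('n) f"
  and smooth_g: "smooth_mat U CARD('n) m g" and smooth_h: "smooth_vec U p h"
  using system by (simp_all add: affine_system_def)

lemma f_carrier: "x \<in> U \<Longrightarrow> f x \<in> carrier_vec CARD('n)"
  and g_carrier: "x \<in> U \<Longrightarrow> g x \<in> carrier_mat CARD('n) m"
  using smooth_vecD(1)[OF smooth_f] smooth_matD(1)[OF smooth_g] by blast+

lemma run: "\<rho> 0 = 0" "\<And>x. x \<in> U \<Longrightarrow> \<Theta> 0 x = h x" "1 \<le> kstar"
  "\<And>k. k \<in> {1..kstar} \<Longrightarrow> assumption_A U p g \<rho> R \<Theta> \<Omega> k"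
  "\<And>k. k \<in> {1..kstar} \<Longrightarrow> algorithm_step U p f g \<rho> R S P \<Theta> \<Omega> k"
  using regular by (simp_all add: regular_algorithm_run_def)

definition blk_dim :: "nat \<Rightarrow> nat" where "blk_dim l = \<rho> l - \<rho> (l - 1)"

lemma R_carrier: "k \<in> {1..kstar} \<Longrightarrow> R k \<in> carrier_mat (blk_dim k) (p - \<rho> (k - 1))"
  using run(4) by (simp add: assumption_A_def blk_dim_def)

lemma S_carrier: "k \<in> {1..kstar} \<Longrightarrow> S k \<in> carrier_mat (p - \<rho> k) (p - \<rho> (k - 1))"
  and RS_invertible: "k \<in> {1..kstar} \<Longrightarrow> invertible_mat (R k @\<^sub>r S k)"
  using run(5) by (simp_all add: algorithm_step_def)

text \<open>An invertible matrix is square. As subtraction of natural numbers truncates, this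
  identity is the source of the inequalities \<open>\<rho> (k - 1) \<le> \<rho> k \<le> p\<close>
  derived next.\<close>

lemma RS_dim: "k \<in> {1..kstar} \<Longrightarrow> blk_dim k + (p - \<rho> k) = p - \<rho> (k - 1)"
  using RS_invertible[of k] carrier_append_rows[OF R_carrier S_carrier, of k]
  by (auto simp: invertible_mat_def)

lemma rho_le: "k \<le> kstar \<Longrightarrow> \<rho> k \<le> p"
proof (induction k)
  case 0
  then show ?case using run(1) by simp
next
  case (Suc k)
  then show ?case using RS_dim[of "Suc k"] by (simp add: blk_dim_def split: nat_diff_split_asm)
qed

lemma rho_step:
  assumes k: "k \<in> {1..kstar}"
  shows "\<rho> (k - 1) \<le> \<rho> k"
proof -
  have "\<rho> k \<le> p" "\<rho> (k - 1) \<le> p" using rho_le k by auto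
  with RS_dim[OF k] show ?thesis unfolding blk_dim_def by arith
qed

lemma rho_mono: "i \<le> j \<Longrightarrow> j \<le> kstar \<Longrightarrow> \<rho> i \<le> \<rho> j"
proof (induction j)
  case (Suc j)
  then show ?case using rho_step[of "Suc j"] by (cases "i = Suc j") auto
qed simp

lemma rho_blk: "k \<in> {1..kstar} \<Longrightarrow> \<rho> k = \<rho> (k - 1) + blk_dim k"
  using rho_step[of k] by (simp add: blk_dim_def)

lemma Theta_smooth: "k \<le> kstar \<Longrightarrow> smooth_vec U (p - \<rho> k) (\<Theta> k)"
proof (induction k rule: less_induct)
  case (less k)
  show ?case
  proof (cases "k = 0")
    case True
    have "smooth_vec U p (\<Theta> 0)"
      by (rule smooth_vec_cong[OF open_U smooth_h]) (simp add: run(2))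
    then show ?thesis using True run(1) by simp
  next
    case False
    then have k: "k \<in> {1..kstar}" using less.prems by simp
    have \<Theta>l: "smooth_vec U (p - \<rho> (l - 1)) (\<Theta> (l - 1))" if "l \<in> {1..k}" for l
    proof -
      have "l - 1 < k" "l - 1 \<le> kstar" using that k by auto
      then show ?thesis by (rule less.IH)
    qed
    have SR: "smooth_vec U (p - \<rho> k) (lie_vec f (\<lambda>z. S k *\<^sub>v \<Theta> (k - 1) z))"
      using \<Theta>l[of k] k
      by (intro smooth_lie_vec[OF open_U smooth_f] smooth_mat_mult_vec[OF open_U smooth_mat_const[OF open_U S_carrier[OF k]]]) simp
    have RR: "smooth_vec U (p - \<rho> k) (\<lambda>x. P k l x *\<^sub>v lie_vec f (\<lambda>z. R l *\<^sub>v \<Theta> (l - 1) z) x)" if l: "l \<in> {1..k}" for l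
    proof (rule smooth_mat_mult_vec[OF open_U])
      show "smooth_mat U (p - \<rho> k) (blk_dim l) (P k l)"
        using run(5)[OF k] l by (simp add: algorithm_step_def blk_dim_def)
      have "l \<in> {1..kstar}" using l less.prems by simp
      from smooth_mat_mult_vec[OF open_U smooth_mat_const[OF open_U R_carrier[OF this]] \<Theta>l[OF l]]
      show "smooth_vec U (blk_dim l) (lie_vec f (\<lambda>z. R l *\<^sub>v \<Theta> (l - 1) z))"
        by (rule smooth_lie_vec[OF open_U smooth_f])
    qed
    have fs: "(\<lambda>l. P k l x *\<^sub>v lie_vec f (\<lambda>z. R l *\<^sub>v \<Theta> (l - 1) z) x) \<in> {1..k} \<rightarrow> carrier_vec (p - \<rho> k)"
      if "x \<in> U" for x using smooth_vecD(1)[OF RR that] by blast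
    have eq: "\<Theta> k x = lie_vec f (\<lambda>z. S k *\<^sub>v \<Theta> (k - 1) z) x -
        finsum_vec TYPE(real) (p - \<rho> k) (\<lambda>l. P k l x *\<^sub>v lie_vec f (\<lambda>z. R l *\<^sub>v \<Theta> (l - 1) z) x) {1..k}"
      if "x \<in> U" for x using run(5)[OF k] that by (simp add: algorithm_step_def)
    show ?thesis unfolding smooth_vec_def
    proof (intro conjI ballI allI impI)
      show "\<Theta> k x \<in> carrier_vec (p - \<rho> k)" if "x \<in> U" for x
        unfolding eq[OF that] by (intro minus_carrier_vec smooth_vecD(1)[OF SR that] finsum_vec_carrier fs that)
      show "smooth_on U (\<lambda>x. \<Theta> k x $ i)" if i: "i < p - \<rho> k" for i
      proof (rule smooth_on_cong[OF open_U])
        show "smooth_on U (\<lambda>x. lie_vec f (\<lambda>z. S k *\<^sub>v \<Theta> (k - 1) z) x $ i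
            - (\<Sum>l\<in>{1..k}. (P k l x *\<^sub>v lie_vec f (\<lambda>z. R l *\<^sub>v \<Theta> (l - 1) z) x) $ i))"
          by (intro smooth_on_diff smooth_on_sum open_U smooth_vecD(2)[OF SR i] smooth_vecD(2)[OF RR i])
        show "lie_vec f (\<lambda>z. S k *\<^sub>v \<Theta> (k - 1) z) x $ i
            - (\<Sum>l\<in>{1..k}. (P k l x *\<^sub>v lie_vec f (\<lambda>z. R l *\<^sub>v \<Theta> (l - 1) z) x) $ i) = \<Theta> k x $ i" if "x \<in> U" for x
          unfolding eq[OF that] by (rule minus_finsum_vec_index[OF fs[OF that] finite_atLeastAtMost i, symmetric])
      qed
    qed
  qed
qed

lemma RTheta_smooth: "l \<in> {1..kstar} \<Longrightarrow> smooth_vec U (blk_dim l) (\<lambda>z. R l *\<^sub>v \<Theta> (l - 1) z)"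
  by (intro smooth_mat_mult_vec[OF open_U smooth_mat_const[OF open_U R_carrier]] Theta_smooth) auto

lemma STheta_smooth: "l \<in> {1..kstar} \<Longrightarrow> smooth_vec U (p - \<rho> l) (\<lambda>z. S l *\<^sub>v \<Theta> (l - 1) z)"
  by (intro smooth_mat_mult_vec[OF open_U smooth_mat_const[OF open_U S_carrier]] Theta_smooth) auto

lemma P_smooth: "k \<in> {1..kstar} \<Longrightarrow> l \<in> {1..k} \<Longrightarrow> smooth_mat U (p - \<rho> k) (blk_dim l) (P k l)"
  using run(5)[of k] by (simp add: algorithm_step_def blk_dim_def)

text \<open>The component \<open>r\<close> of the \<open>l\<close>-th block of \<open>v\<^sub>d\<close>.\<close>

definition vd :: "nat \<Rightarrow> nat \<Rightarrow> real^'n \<Rightarrow> real Matrix.vec \<Rightarrow> real" where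
  "vd l r x u = frechet_derivative (\<lambda>z. (R l *\<^sub>v \<Theta> (l - 1) z) $ r) (at x) (point_of (f x + g x *\<^sub>v u))"

text \<open>The definition of \<open>\<Theta> k\<close> accounts for the drift and the equation for
  \<open>P k l\<close> for the input part, with the same coefficients. So both combine into the full
  derivatives \<open>vd\<close> of the outputs in the blocks up to k.\<close>

lemma STheta_dynamics:
  assumes k: "k \<in> {1..kstar}" and x: "x \<in> U" and u: "u \<in> carrier_vec m" and s: "s < p - \<rho> k"
  shows "frechet_derivative (\<lambda>z. (S k *\<^sub>v \<Theta> (k - 1) z) $ s) (at x) (point_of (f x + g x *\<^sub>v u))
    = \<Theta> k x $ s + (\<Sum>l\<in>{1..k}. \<Sum>r<blk_dim l. P k l x $$ (s, r) * vd l r x u)"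
proof -
  note fx = f_carrier[OF x] and gx = g_carrier[OF x]
  have lk: "l \<in> {1..kstar}" if "l \<in> {1..k}" for l using that k by simp
  let ?lf = "\<lambda>l. lie_vec f (\<lambda>z. R l *\<^sub>v \<Theta> (l - 1) z) x" and ?lg = "\<lambda>l. lie_mat g (\<lambda>z. R l *\<^sub>v \<Theta> (l - 1) z) x"
  have lf: "?lf l \<in> carrier_vec (blk_dim l)" if "l \<in> {1..k}" for l
    by (rule smooth_vecD(1)[OF smooth_lie_vec[OF open_U smooth_f RTheta_smooth[OF lk[OF that]]] x])
  have lg: "?lg l \<in> carrier_mat (blk_dim l) m" if "l \<in> {1..k}" for l
    by (rule smooth_matD(1)[OF smooth_lie_mat[OF open_U smooth_g RTheta_smooth[OF lk[OF that]]] x])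
  have Pc: "P k l x \<in> carrier_mat (p - \<rho> k) (blk_dim l)" if "l \<in> {1..k}" for l
    by (rule smooth_matD(1)[OF P_smooth[OF k that] x])
  have fs: "(\<lambda>l. P k l x *\<^sub>v ?lf l) \<in> {1..k} \<rightarrow> carrier_vec (p - \<rho> k)"
    using mult_mat_vec_carrier[OF Pc lf] by blast
  have \<Theta>k: "\<Theta> k x = lie_vec f (\<lambda>z. S k *\<^sub>v \<Theta> (k - 1) z) x - finsum_vec TYPE(real) (p - \<rho> k) (\<lambda>l. P k l x *\<^sub>v ?lf l) {1..k}"
    using run(5)[OF k] x by (simp add: algorithm_step_def)
  have lieS: "lie_vec f (\<lambda>z. S k *\<^sub>v \<Theta> (k - 1) z) x $ s = \<Theta> k x $ s + (\<Sum>l\<in>{1..k}. (P k l x *\<^sub>v ?lf l) $ s)"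
    unfolding \<Theta>k minus_finsum_vec_index[OF fs finite_atLeastAtMost s] by simp
  have gS: "lie_mat g (\<lambda>z. S k *\<^sub>v \<Theta> (k - 1) z) x = mat_sum (p - \<rho> k) m (\<lambda>l. P k l x * ?lg l) {1..k}"
    using run(5)[OF k] x gx by (simp add: algorithm_step_def)
  have lieg: "(lie_mat g (\<lambda>z. S k *\<^sub>v \<Theta> (k - 1) z) x *\<^sub>v u) $ s = (\<Sum>l\<in>{1..k}. (P k l x *\<^sub>v (?lg l *\<^sub>v u)) $ s)"
  proof -
    have "(lie_mat g (\<lambda>z. S k *\<^sub>v \<Theta> (k - 1) z) x *\<^sub>v u) $ s
        = (\<Sum>j<m. (\<Sum>l\<in>{1..k}. (P k l x * ?lg l) $$ (s, j)) * u $ j)"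
      unfolding gS by (subst mult_mat_vec_index[OF _ u s]) (auto simp: mat_sum_def s)
    also have "\<dots> = (\<Sum>l\<in>{1..k}. \<Sum>j<m. (P k l x * ?lg l) $$ (s, j) * u $ j)"
      unfolding sum_distrib_right by (rule sum.swap)
    also have "\<dots> = (\<Sum>l\<in>{1..k}. (P k l x *\<^sub>v (?lg l *\<^sub>v u)) $ s)"
    proof (intro sum.cong refl)
      fix l assume l: "l \<in> {1..k}"
      have "(P k l x * ?lg l) *\<^sub>v u = P k l x *\<^sub>v (?lg l *\<^sub>v u)"
        by (rule assoc_mult_mat_vec[OF Pc[OF l] lg[OF l] u])
      then show "(\<Sum>j<m. (P k l x * ?lg l) $$ (s, j) * u $ j) = (P k l x *\<^sub>v (?lg l *\<^sub>v u)) $ s"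
        using mult_mat_vec_index[OF mult_carrier_mat[OF Pc[OF l] lg[OF l]] u s] by simp
    qed
    finally show ?thesis .
  qed
  have vd: "vd l r x u = ?lf l $ r + (?lg l *\<^sub>v u) $ r" if l: "l \<in> {1..k}" and r: "r < blk_dim l" for l r
    unfolding vd_def by (rule derivative_along_control[where g = g and f = f, OF RTheta_smooth[OF lk[OF l]] x r fx gx u])
  have tm: "(P k l x *\<^sub>v ?lf l) $ s + (P k l x *\<^sub>v (?lg l *\<^sub>v u)) $ s = (\<Sum>r<blk_dim l. P k l x $$ (s, r) * vd l r x u)"
    if l: "l \<in> {1..k}" for l
    unfolding mult_mat_vec_index[OF Pc[OF l] lf[OF l] s]
      mult_mat_vec_index[OF Pc[OF l] mult_mat_vec_carrier[OF lg[OF l] u] s] sum.distrib[symmetric]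
    by (intro sum.cong refl) (simp add: vd[OF l] distrib_left)
  have "frechet_derivative (\<lambda>z. (S k *\<^sub>v \<Theta> (k - 1) z) $ s) (at x) (point_of (f x + g x *\<^sub>v u))
      = \<Theta> k x $ s + (\<Sum>l\<in>{1..k}. (P k l x *\<^sub>v ?lf l) $ s) + (\<Sum>l\<in>{1..k}. (P k l x *\<^sub>v (?lg l *\<^sub>v u)) $ s)"
    using derivative_along_control[where g = g and f = f, OF STheta_smooth[OF k] x s fx gx u] lieS lieg by (simp only:)
  also have "\<dots> = \<Theta> k x $ s + (\<Sum>l\<in>{1..k}. \<Sum>r<blk_dim l. P k l x $$ (s, r) * vd l r x u)"
    unfolding add.assoc sum.distrib[symmetric] by (intro arg_cong2[where f = "(+)"] sum.cong refl tm)
  finally show ?thesis .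
qed

lemma S_prod_Suc: "j \<le> Suc i \<Longrightarrow> S_prod p \<rho> S (Suc i) j = S (Suc i) * S_prod p \<rho> S i j"
  by (simp add: S_prod_def)

lemma S_prod_self: "S_prod p \<rho> S i (Suc i) = 1\<^sub>m (p - \<rho> i)"
  by (simp add: S_prod_def)

lemma S_prod_carrier:
  assumes "1 \<le> j" "j \<le> Suc i" "i \<le> kstar"
  shows "S_prod p \<rho> S i j \<in> carrier_mat (p - \<rho> i) (p - \<rho> (j - 1))"
  using assms
proof (induction i)
  case 0
  then have "j = Suc 0" by simp
  then show ?case using S_prod_self[of 0] by simp
next
  case (Suc i)
  show ?case
  proof (cases "j = Suc (Suc i)")
    case True
    then show ?thesis using S_prod_self[of "Suc i"] by simp
  next
    case False
    with Suc have "S_prod p \<rho> S i j \<in> carrier_mat (p - \<rho> i) (p - \<rho> (j - 1))" "j \<le> Suc i" by auto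
    with S_carrier[of "Suc i"] Suc.prems S_prod_Suc show ?thesis by auto
  qed
qed

text \<open>\<open>S_prod\<close> is built up from the left, but it is the rightmost factor
  \<open>S j\<close> that acts on \<open>\<Theta> (j - 1)\<close> and is consumed by one
  differentiation.\<close>

lemma S_prod_split:
  assumes "1 \<le> j" "j \<le> i" "i \<le> kstar"
  shows "S_prod p \<rho> S i j = S_prod p \<rho> S i (Suc j) * S j"
  using assms(2,3)
proof (induction i rule: dec_induct)
  case base
  then have j: "j \<in> {1..kstar}" using assms(1) by simp
  obtain j' where j': "j = Suc j'" using assms(1) by (cases j) auto
  have "S_prod p \<rho> S j j = S j * 1\<^sub>m (p - \<rho> (j - 1))"
    using S_prod_Suc[of j j'] S_prod_self[of j'] by (simp add: j')
  then show ?case using S_prod_self[of j] S_carrier[OF j] by simp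
next
  case (step i)
  have Si: "S (Suc i) \<in> carrier_mat (p - \<rho> (Suc i)) (p - \<rho> i)" using S_carrier[of "Suc i"] step.prems by simp
  have Sp: "S_prod p \<rho> S i (Suc j) \<in> carrier_mat (p - \<rho> i) (p - \<rho> j)"
    using S_prod_carrier[of "Suc j" i] step.hyps step.prems by simp
  have Sj: "S j \<in> carrier_mat (p - \<rho> j) (p - \<rho> (j - 1))" using S_carrier[of j] step.hyps step.prems assms(1) by simp
  have "S_prod p \<rho> S (Suc i) j = S (Suc i) * (S_prod p \<rho> S i (Suc j) * S j)"
    using S_prod_Suc[of j i] step by simp
  also have "\<dots> = (S (Suc i) * S_prod p \<rho> S i (Suc j)) * S j"
    by (rule assoc_mult_mat[OF Si Sp Sj, symmetric])
  also have "\<dots> = S_prod p \<rho> S (Suc i) (Suc j) * S j"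
    using S_prod_Suc[of "Suc j" i] step.hyps by simp
  finally show ?case .
qed

abbreviation \<zeta> :: "nat \<Rightarrow> nat \<Rightarrow> real^'n \<Rightarrow> real Matrix.vec" where
  "\<zeta> \<equiv> zeta_block p \<rho> R S \<Theta>"

lemma RS_prod_carrier:
  assumes "i \<in> {1..kstar}" "j \<in> {1..i}"
  shows "R i * S_prod p \<rho> S (i - 1) j \<in> carrier_mat (blk_dim i) (p - \<rho> (j - 1))"
  using S_prod_carrier[of j "i - 1"] R_carrier[OF assms(1)] assms by (intro mult_carrier_mat[OF R_carrier]) auto

lemma zeta_smooth:
  assumes "i \<in> {1..kstar}" "j \<in> {1..i}"
  shows "smooth_vec U (blk_dim i) (\<zeta> i j)"
  unfolding zeta_block_def
  using assms Theta_smooth[of "j - 1"]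
  by (intro smooth_mat_mult_vec[OF open_U smooth_mat_const[OF open_U RS_prod_carrier]]) auto

lemma zeta_diag: "i \<in> {1..kstar} \<Longrightarrow> \<zeta> i i x = R i *\<^sub>v \<Theta> (i - 1) x"
  using S_prod_self[of "i - 1"] R_carrier[of i] by (simp add: zeta_block_def)

text \<open>The constant matrix \<open>M\<close> left of \<open>S j\<close> passes through the
  derivative: it sends \<open>\<Theta> j\<close> to the next coordinate and multiplies the
  coefficients \<open>P j l\<close>. Only blocks l <= j occur, which is the origin of the vanishing
  of \<delta>.\<close>

lemma zeta_dynamics:
  assumes i: "i \<in> {1..kstar}" and j: "1 \<le> j" "j < i" and x: "x \<in> U" and u: "u \<in> carrier_vec m" and r: "r < blk_dim i"
  shows "frechet_derivative (\<lambda>z. \<zeta> i j z $ r) (at x) (point_of (f x + g x *\<^sub>v u))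
    = \<zeta> i (j + 1) x $ r + (\<Sum>l\<in>{1..j}. \<Sum>s<blk_dim l. (R i * S_prod p \<rho> S (i - 1) (j + 1) * P j l x) $$ (r, s) * vd l s x u)"
proof -
  have jk: "j \<in> {1..kstar}" and j1: "j + 1 \<in> {1..i}" using i j by auto
  define M where "M = R i * S_prod p \<rho> S (i - 1) (j + 1)"
  have M: "M \<in> carrier_mat (blk_dim i) (p - \<rho> j)"
    using RS_prod_carrier[OF i j1] by (simp add: M_def)
  have Sj: "S j \<in> carrier_mat (p - \<rho> j) (p - \<rho> (j - 1))" by (rule S_carrier[OF jk])
  have Th: "smooth_vec U (p - \<rho> (j - 1)) (\<Theta> (j - 1))" using Theta_smooth[of "j - 1"] jk by auto
  have "R i * S_prod p \<rho> S (i - 1) j = M * S j"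
  proof -
    have "S_prod p \<rho> S (i - 1) j = S_prod p \<rho> S (i - 1) (Suc j) * S j"
      by (rule S_prod_split) (use i j in auto)
    moreover have "S_prod p \<rho> S (i - 1) (Suc j) \<in> carrier_mat (p - \<rho> (i - 1)) (p - \<rho> j)"
      using S_prod_carrier[of "Suc j" "i - 1"] i j by auto
    ultimately show ?thesis
      using assoc_mult_mat[OF R_carrier[OF i] _ Sj] by (simp add: M_def)
  qed
  then have \<zeta>M: "\<zeta> i j z = M *\<^sub>v (S j *\<^sub>v \<Theta> (j - 1) z)" if "z \<in> U" for z
    using assoc_mult_mat_vec[OF M Sj smooth_vecD(1)[OF Th that]] by (simp add: zeta_block_def)
  have STh: "smooth_vec U (p - \<rho> j) (\<lambda>z. S j *\<^sub>v \<Theta> (j - 1) z)" by (rule STheta_smooth[OF jk])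
  have Thj: "\<Theta> j x \<in> carrier_vec (p - \<rho> j)" using smooth_vecD(1)[OF Theta_smooth x, of j] jk by simp
  let ?F = "point_of (f x + g x *\<^sub>v u)"
  have "frechet_derivative (\<lambda>z. \<zeta> i j z $ r) (at x) ?F
      = frechet_derivative (\<lambda>z. (M *\<^sub>v (S j *\<^sub>v \<Theta> (j - 1) z)) $ r) (at x) ?F"
    using frechet_derivative_cong_open[OF open_U x, of "\<lambda>z. (M *\<^sub>v (S j *\<^sub>v \<Theta> (j - 1) z)) $ r" "\<lambda>z. \<zeta> i j z $ r"]
      smooth_on_differentiable[OF smooth_vecD(2)[OF smooth_mat_mult_vec[OF open_U smooth_mat_const[OF open_U M] STh] r] x] \<zeta>M
    by simp
  also have "\<dots> = (\<Sum>s<p - \<rho> j. M $$ (r, s) * frechet_derivative (\<lambda>z. (S j *\<^sub>v \<Theta> (j - 1) z) $ s) (at x) ?F)"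
    by (rule frechet_derivative_mult_mat[OF open_U STh M r x])
  also have "\<dots> = (\<Sum>s<p - \<rho> j. M $$ (r, s) * \<Theta> j x $ s
      + (\<Sum>l\<in>{1..j}. \<Sum>t<blk_dim l. M $$ (r, s) * P j l x $$ (s, t) * vd l t x u))"
  proof (intro sum.cong refl)
    fix s assume "s \<in> {..<p - \<rho> j}"
    then have s: "s < p - \<rho> j" by simp
    show "M $$ (r, s) * frechet_derivative (\<lambda>z. (S j *\<^sub>v \<Theta> (j - 1) z) $ s) (at x) ?F = M $$ (r, s) * \<Theta> j x $ s
      + (\<Sum>l\<in>{1..j}. \<Sum>t<blk_dim l. M $$ (r, s) * P j l x $$ (s, t) * vd l t x u)"
      unfolding STheta_dynamics[OF jk x u s] distrib_left sum_distrib_left mult.assoc ..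
  qed
  also have "\<dots> = (\<Sum>s<p - \<rho> j. M $$ (r, s) * \<Theta> j x $ s)
      + (\<Sum>l\<in>{1..j}. \<Sum>t<blk_dim l. \<Sum>s<p - \<rho> j. M $$ (r, s) * P j l x $$ (s, t) * vd l t x u)"
  proof -
    have "(\<Sum>s<p - \<rho> j. \<Sum>l\<in>{1..j}. \<Sum>t<blk_dim l. M $$ (r, s) * P j l x $$ (s, t) * vd l t x u)
        = (\<Sum>l\<in>{1..j}. \<Sum>s<p - \<rho> j. \<Sum>t<blk_dim l. M $$ (r, s) * P j l x $$ (s, t) * vd l t x u)"
      by (rule sum.swap)
    also have "\<dots> = (\<Sum>l\<in>{1..j}. \<Sum>t<blk_dim l. \<Sum>s<p - \<rho> j. M $$ (r, s) * P j l x $$ (s, t) * vd l t x u)"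
      by (intro sum.cong refl sum.swap)
    finally show ?thesis by (simp only: sum.distrib)
  qed
  also have "(\<Sum>s<p - \<rho> j. M $$ (r, s) * \<Theta> j x $ s) = \<zeta> i (j + 1) x $ r"
    using mult_mat_vec_index[OF M Thj r] by (simp add: zeta_block_def M_def)
  also have "(\<Sum>l\<in>{1..j}. \<Sum>t<blk_dim l. \<Sum>s<p - \<rho> j. M $$ (r, s) * P j l x $$ (s, t) * vd l t x u)
      = (\<Sum>l\<in>{1..j}. \<Sum>t<blk_dim l. (M * P j l x) $$ (r, t) * vd l t x u)"
  proof (intro sum.cong refl)
    fix l t assume l: "l \<in> {1..j}" and t: "t \<in> {..<blk_dim l}"
    have "(M * P j l x) $$ (r, t) = (\<Sum>s<p - \<rho> j. M $$ (r, s) * P j l x $$ (s, t))"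
      by (rule mult_mat_index[OF M smooth_matD(1)[OF P_smooth[OF jk l] x] r]) (use t in simp)
    then show "(\<Sum>s<p - \<rho> j. M $$ (r, s) * P j l x $$ (s, t) * vd l t x u) = (M * P j l x) $$ (r, t) * vd l t x u"
      by (simp add: sum_distrib_right)
  qed
  finally show ?thesis by (simp only: M_def)
qed

end

section \<open>Numbering of chains and blocks\<close>

lemma vec_of_list_append_eq: "vec_of_list (xs @ ys) = vec_of_list xs @\<^sub>v vec_of_list ys"
  by (rule eq_vecI) (simp_all add: vec_of_list_index nth_append)

lemma vec_of_list_map_index: "w \<in> carrier_vec d \<Longrightarrow> vec_of_list (map (\<lambda>r. w $ r) [0..<d]) = w"
  by (rule eq_vecI) (simp_all add: vec_of_list_index)

lemma vcol_vec_of_list: "vcol (map (\<lambda>l. vec_of_list (F l)) ls) = vec_of_list (concat (map F ls))"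
  unfolding vcol_def by (induction ls) (simp_all add: vec_of_list_append_eq)

lemma inf_zero_list_Suc:
  "inf_zero_list \<rho> (Suc k) = inf_zero_list \<rho> k @ replicate (\<rho> (Suc k) - \<rho> k) (Suc k)"
  by (simp add: inf_zero_list_def)

lemma sum_list_inf_zero_list: "sum_list (inf_zero_list \<rho> k) = inf_zero_dim \<rho> k"
proof (induction k)
  case 0
  then show ?case by (simp add: inf_zero_list_def inf_zero_dim_def)
next
  case (Suc k)
  have "inf_zero_dim \<rho> (Suc k) = inf_zero_dim \<rho> k + Suc k * (\<rho> (Suc k) - \<rho> k)"
    by (simp add: inf_zero_dim_def)
  with Suc show ?case by (simp add: inf_zero_list_Suc sum_list_replicate mult.commute)
qed

lemma sum_split_shift:
  fixes H :: "nat \<Rightarrow> real"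
  shows "(\<Sum>l\<in>{1..a + b}. H l) = (\<Sum>l\<in>{1..a}. H l) + (\<Sum>r<b. H (a + r + 1))"
  by (induction b) simp_all

lemma invertible_matI_trivial_kernel:
  fixes A :: "real Matrix.mat"
  assumes A: "A \<in> carrier_mat n n" and ker: "\<And>v. v \<in> carrier_vec n \<Longrightarrow> A *\<^sub>v v = 0\<^sub>v n \<Longrightarrow> v = 0\<^sub>v n"
  shows "invertible_mat A"
proof -
  have d: "Determinant.det A \<noteq> 0"
    using det_0_iff_vec_prod_zero_field[OF A] ker by blast
  let ?B = "(1 / Determinant.det A) \<cdot>\<^sub>m adj_mat A"
  have one: "(1 / Determinant.det A) \<cdot>\<^sub>m (Determinant.det A \<cdot>\<^sub>m 1\<^sub>m n) = 1\<^sub>m n"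
    by (rule eq_matI) (simp_all add: d)
  have "A * ?B = 1\<^sub>m n"
    unfolding mult_smult_distrib[OF A adj_mat(1)[OF A]] adj_mat(2)[OF A] by (rule one)
  moreover have "?B * A = 1\<^sub>m n"
    unfolding mult_smult_assoc_mat[OF adj_mat(1)[OF A] A] adj_mat(3)[OF A] by (rule one)
  moreover have "?B \<in> carrier_mat n n" using adj_mat(1)[OF A] by simp
  ultimately show ?thesis using A unfolding invertible_mat_def inverts_mat_def by (intro conjI exI[of _ ?B]) auto
qed

lemma invertible_mat_kernel:
  fixes A :: "real Matrix.mat"
  assumes "A \<in> carrier_mat n n" "invertible_mat A" "v \<in> carrier_vec n" "A *\<^sub>v v = 0\<^sub>v n"
  shows "v = 0\<^sub>v n"
  using det_0_iff_vec_prod_zero_field[OF assms(1)] mat_inverse_spec(4)[OF assms(1,2)] assms(3,4) by blast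

context regular_run
begin

abbreviation "q \<equiv> inf_zero_list \<rho> kstar"
abbreviation "md \<equiv> \<rho> kstar"

lemma length_inf_zero_list: "k \<le> kstar \<Longrightarrow> length (inf_zero_list \<rho> k) = \<rho> k"
proof (induction k)
  case 0
  then show ?case using run(1) by (simp add: inf_zero_list_def)
next
  case (Suc k)
  then show ?case using rho_step[of "Suc k"] by (simp add: inf_zero_list_Suc)
qed

lemma inf_zero_list_nth:
  "k \<le> kstar \<Longrightarrow> t < \<rho> k \<Longrightarrow> inf_zero_list \<rho> k ! t \<in> {1..k} \<and>
     \<rho> (inf_zero_list \<rho> k ! t - 1) \<le> t \<and> t < \<rho> (inf_zero_list \<rho> k ! t)"
proof (induction k)
  case 0
  then show ?case using run(1) by simp
next
  case (Suc k)
  have len: "length (inf_zero_list \<rho> k) = \<rho> k" using length_inf_zero_list[of k] Suc.prems by simp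
  show ?case
  proof (cases "t < \<rho> k")
    case True
    then have "inf_zero_list \<rho> (Suc k) ! t = inf_zero_list \<rho> k ! t"
      using len by (simp add: inf_zero_list_Suc nth_append)
    with Suc.IH True Suc.prems show ?thesis by auto
  next
    case False
    then have "inf_zero_list \<rho> (Suc k) ! t = Suc k"
      using len Suc.prems by (simp add: inf_zero_list_Suc nth_append)
    with False Suc.prems show ?thesis by simp
  qed
qed

text \<open>A chain has a global number i, counted from 1. It belongs to block \<open>blk i\<close>,
  counted from 1, and is there row \<open>off i\<close>, counted from 0. Since the chains of block l
  have length l, \<open>blk i\<close> is at the same time the length of chain i.\<close>

definition blk :: "nat \<Rightarrow> nat" where "blk i = q ! (i - 1)"
definition off :: "nat \<Rightarrow> nat" where "off i = i - 1 - \<rho> (blk i - 1)"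

lemma blk_off:
  assumes "i \<in> {1..md}"
  shows "blk i \<in> {1..kstar}" "off i < blk_dim (blk i)" "\<rho> (blk i - 1) + off i + 1 = i"
proof -
  have t: "i - 1 < md" using assms by auto
  from inf_zero_list_nth[OF order_refl t] have *: "blk i \<in> {1..kstar}" "\<rho> (blk i - 1) \<le> i - 1" "i - 1 < \<rho> (blk i)"
    by (simp_all add: blk_def)
  show "blk i \<in> {1..kstar}" by (rule *(1))
  show "\<rho> (blk i - 1) + off i + 1 = i" using *(2) assms by (auto simp: off_def)
  show "off i < blk_dim (blk i)" using * by (simp add: off_def blk_dim_def)
qed

text \<open>Inverse to \<open>blk_off\<close>. By monotonicity of \<rho> the blocks occupy disjoint
  ranges of numbers, so neither an earlier nor a later block can contain this one.\<close>

lemma blk_eqI: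
  assumes l: "l \<in> {1..kstar}" and r: "r < blk_dim l"
  shows "\<rho> (l - 1) + r + 1 \<in> {1..md}" "blk (\<rho> (l - 1) + r + 1) = l" "off (\<rho> (l - 1) + r + 1) = r"
proof -
  let ?i = "\<rho> (l - 1) + r + 1"
  have lt: "\<rho> (l - 1) + r < \<rho> l" using rho_blk[OF l] r by simp
  have "\<rho> l \<le> md" using rho_mono[of l kstar] l by simp
  with lt show i: "?i \<in> {1..md}" by simp
  note b = blk_off[OF i]
  have "\<not> blk ?i < l"
  proof
    assume "blk ?i < l"
    then have "\<rho> (blk ?i) \<le> \<rho> (l - 1)" using rho_mono[of "blk ?i" "l - 1"] l by auto
    with b(2,3) rho_blk[OF b(1)] show False by linarith
  qed
  moreover have "\<not> l < blk ?i"
  proof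
    assume "l < blk ?i"
    then have "\<rho> l \<le> \<rho> (blk ?i - 1)" using rho_mono[of l "blk ?i - 1"] b(1) by auto
    with b(3) lt show False by linarith
  qed
  ultimately show bl: "blk ?i = l" by simp
  show "off ?i = r" using b(3) bl by simp
qed

definition block_list :: "nat \<Rightarrow> (nat \<times> nat) list" where
  "block_list k = concat (map (\<lambda>l. map (Pair l) [0..<blk_dim l]) [1..<Suc k])"

lemma block_list_Suc: "block_list (Suc k) = block_list k @ map (Pair (Suc k)) [0..<blk_dim (Suc k)]"
  by (simp add: block_list_def)

lemma length_block_list: "k \<le> kstar \<Longrightarrow> length (block_list k) = \<rho> k"
proof (induction k)
  case 0
  then show ?case using run(1) by (simp add: block_list_def)
next
  case (Suc k)
  then show ?case using rho_blk[of "Suc k"] by (simp add: block_list_Suc)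
qed

lemma block_list_nth: "k \<le> kstar \<Longrightarrow> l \<in> {1..k} \<Longrightarrow> r < blk_dim l \<Longrightarrow> block_list k ! (\<rho> (l - 1) + r) = (l, r)"
proof (induction k)
  case (Suc k)
  have len: "length (block_list k) = \<rho> k" using length_block_list Suc.prems by simp
  show ?case
  proof (cases "l = Suc k")
    case True
    then show ?thesis using len Suc.prems by (simp add: block_list_Suc nth_append)
  next
    case False
    then have l: "l \<in> {1..k}" using Suc.prems by simp
    have "\<rho> l = \<rho> (l - 1) + blk_dim l" using rho_blk[of l] l Suc.prems by simp
    moreover have "\<rho> l \<le> \<rho> k" using rho_mono[of l k] l Suc.prems by simp
    ultimately have "\<rho> (l - 1) + r < \<rho> k" using Suc.prems by simp
    then show ?thesis using len Suc l by (simp add: block_list_Suc nth_append)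
  qed
qed simp

lemma Omega_eq: 
  assumes x: "x \<in> U"
  shows "\<Omega> kstar x = vec_of_list (map (\<lambda>(l, r). (R l *\<^sub>v \<Theta> (l - 1) x) $ r) (block_list kstar))"
proof -
  have "\<Omega> kstar x = vcol (map (\<lambda>l. R l *\<^sub>v \<Theta> (l - 1) x) [1..<Suc kstar])"
    using run(5)[of kstar] run(3) x unfolding algorithm_step_def by simp
  also have "map (\<lambda>l. R l *\<^sub>v \<Theta> (l - 1) x) [1..<Suc kstar]
      = map (\<lambda>l. vec_of_list (map (\<lambda>r. (R l *\<^sub>v \<Theta> (l - 1) x) $ r) [0..<blk_dim l])) [1..<Suc kstar]"
  proof (intro map_cong refl)
    fix l assume "l \<in> set [1..<Suc kstar]"
    then have "l \<in> {1..kstar}" by auto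
    from smooth_vecD(1)[OF RTheta_smooth[OF this] x]
    show "R l *\<^sub>v \<Theta> (l - 1) x = vec_of_list (map (\<lambda>r. (R l *\<^sub>v \<Theta> (l - 1) x) $ r) [0..<blk_dim l])"
      by (rule vec_of_list_map_index[symmetric])
  qed
  finally show ?thesis
    unfolding vcol_vec_of_list by (simp add: block_list_def map_concat o_def)
qed

lemma Omega_carrier: "x \<in> U \<Longrightarrow> \<Omega> kstar x \<in> carrier_vec md"
  by (simp add: Omega_eq length_block_list carrier_vecI)

lemma Omega_index:
  assumes x: "x \<in> U" and i: "i \<in> {1..md}"
  shows "\<Omega> kstar x $ (i - 1) = (R (blk i) *\<^sub>v \<Theta> (blk i - 1) x) $ off i"
proof -
  note b = blk_off[OF i]
  have "i - 1 = \<rho> (blk i - 1) + off i" using b(3) by simp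
  then have "block_list kstar ! (i - 1) = (blk i, off i)"
    using block_list_nth[OF order_refl b(1,2)] by simp
  moreover have "i - 1 < length (block_list kstar)" using length_block_list i by auto
  ultimately show ?thesis by (simp add: Omega_eq[OF x] vec_of_list_index)
qed

lemma Omega_smooth: "smooth_vec U md (\<Omega> kstar)"
  unfolding smooth_vec_def
proof (intro conjI ballI allI impI)
  show "\<Omega> kstar x \<in> carrier_vec md" if "x \<in> U" for x by (rule Omega_carrier[OF that])
  show "smooth_on U (\<lambda>x. \<Omega> kstar x $ t)" if "t < md" for t
  proof -
    have i: "Suc t \<in> {1..md}" using that by simp
    show ?thesis
      by (rule smooth_on_cong[OF open_U smooth_vecD(2)[OF RTheta_smooth[OF blk_off(1)[OF i]] blk_off(2)[OF i]]])
        (use Omega_index[OF _ i] in simp)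
  qed
qed

definition \<xi> :: "nat \<Rightarrow> nat \<Rightarrow> real^'n \<Rightarrow> real" where
  "\<xi> i j x = \<zeta> (blk i) j x $ off i"

definition v :: "nat \<Rightarrow> real^'n \<Rightarrow> real Matrix.vec \<Rightarrow> real" where
  "v i x u = (lie_vec f (\<Omega> kstar) x + lie_mat g (\<Omega> kstar) x *\<^sub>v u) $ (i - 1)"

text \<open>The coefficients \<open>P j l\<close> exist for blocks l <= j only. The zero branch
  extends them to all pairs of chains and is exactly the required vanishing for j below the length
  of chain l.\<close>

definition \<delta> :: "nat \<Rightarrow> nat \<Rightarrow> nat \<Rightarrow> real^'n \<Rightarrow> real" where
  "\<delta> i j l x = (if blk l \<le> j
     then (R (blk i) * S_prod p \<rho> S (blk i - 1) (j + 1) * P j (blk l) x) $$ (off i, off l) else 0)"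

lemma lie_Omega_carrier:
  "x \<in> U \<Longrightarrow> lie_vec f (\<Omega> kstar) x \<in> carrier_vec md" "x \<in> U \<Longrightarrow> lie_mat g (\<Omega> kstar) x \<in> carrier_mat md m"
  using smooth_vecD(1)[OF smooth_lie_vec[OF open_U smooth_f Omega_smooth]]
    smooth_matD(1)[OF smooth_lie_mat[OF open_U smooth_g Omega_smooth]] by blast+

lemma xi_smooth: "i \<in> {1..md} \<Longrightarrow> j \<in> {1..blk i} \<Longrightarrow> smooth_on U (\<xi> i j)"
  unfolding \<xi>_def[abs_def] by (rule smooth_vecD(2)[OF zeta_smooth[OF blk_off(1)] blk_off(2)])

lemma Omega_xi: "i \<in> {1..md} \<Longrightarrow> x \<in> U \<Longrightarrow> \<Omega> kstar x $ (i - 1) = \<xi> i (blk i) x"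
  unfolding \<xi>_def by (simp only: Omega_index zeta_diag[OF blk_off(1)])

lemma Omega_xi_derivative:
  assumes i: "i \<in> {1..md}" and x: "x \<in> U"
  shows "frechet_derivative (\<lambda>z. \<Omega> kstar z $ (i - 1)) (at x) = frechet_derivative (\<xi> i (blk i)) (at x)"
proof (rule frechet_derivative_cong_open[OF open_U x])
  show "\<xi> i (blk i) z = \<Omega> kstar z $ (i - 1)" if "z \<in> U" for z using Omega_xi[OF i that] by simp
  show "\<xi> i (blk i) differentiable (at x)"
    by (rule smooth_on_differentiable[OF xi_smooth[OF i] x]) (use blk_off(1)[OF i] in simp)
qed

lemma control_field_carrier: "x \<in> U \<Longrightarrow> u \<in> carrier_vec m \<Longrightarrow> f x + g x *\<^sub>v u \<in> carrier_vec CARD('n)"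
  by (intro add_carrier_vec f_carrier mult_mat_vec_carrier[OF g_carrier])

lemma v_eq_derivative:
  assumes i: "i \<in> {1..md}" and x: "x \<in> U" and u: "u \<in> carrier_vec m"
  shows "v i x u = frechet_derivative (\<xi> i (blk i)) (at x) (point_of (f x + g x *\<^sub>v u))"
proof -
  have t: "i - 1 < md" using i by auto
  have "v i x u = lie_vec f (\<Omega> kstar) x $ (i - 1) + (lie_mat g (\<Omega> kstar) x *\<^sub>v u) $ (i - 1)"
    unfolding v_def using carrier_matD(1)[OF lie_Omega_carrier(2)[OF x]] t by simp
  also have "\<dots> = frechet_derivative (\<lambda>z. \<Omega> kstar z $ (i - 1)) (at x) (point_of (f x + g x *\<^sub>v u))"
    by (rule derivative_along_control[where f = f and g = g, OF Omega_smooth x t f_carrier[OF x] g_carrier[OF x] u, symmetric])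
  finally show ?thesis by (simp only: Omega_xi_derivative[OF i x])
qed

lemma v_eq_vd:
  assumes l: "l \<in> {1..kstar}" and r: "r < blk_dim l" and x: "x \<in> U" and u: "u \<in> carrier_vec m"
  shows "v (\<rho> (l - 1) + r + 1) x u = vd l r x u"
  unfolding v_eq_derivative[OF blk_eqI(1)[OF l r] x u] blk_eqI(2)[OF l r] vd_def \<xi>_def[abs_def] blk_eqI(3)[OF l r]
  by (simp only: zeta_diag[OF l])

text \<open>Regroups a sum over chains into the double sums over blocks and rows that occur in
  \<open>zeta_dynamics\<close>.\<close>

lemma sum_blocks:
  fixes H :: "nat \<Rightarrow> real"
  shows "j \<le> kstar \<Longrightarrow> (\<Sum>l\<in>{1..\<rho> j}. H l) = (\<Sum>k\<in>{1..j}. \<Sum>r<blk_dim k. H (\<rho> (k - 1) + r + 1))"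
proof (induction j)
  case 0
  then show ?case using run(1) by simp
next
  case (Suc j)
  have "\<rho> (Suc j) = \<rho> j + blk_dim (Suc j)" using rho_blk[of "Suc j"] Suc.prems by simp
  then show ?case using Suc sum_split_shift[of H "\<rho> j" "blk_dim (Suc j)"] by simp
qed

lemma xi_gradient:
  assumes i: "i \<in> {1..md}" and j: "j \<in> {1..blk i}" and x: "x \<in> U" and w: "w \<in> carrier_vec CARD('n)"
  shows "gradient (\<xi> i j) x \<bullet> w = frechet_derivative (\<xi> i j) (at x) (point_of w)"
  by (rule gradient_scalar_prod[OF smooth_on_differentiable[OF xi_smooth[OF i j] x] w])

lemma xi_dynamics_last:
  assumes i: "i \<in> {1..md}" and x: "x \<in> U" and u: "u \<in> carrier_vec m"
  shows "gradient (\<xi> i (blk i)) x \<bullet> (f x + g x *\<^sub>v u) = v i x u"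
  unfolding v_eq_derivative[OF i x u]
  by (rule xi_gradient[OF i _ x control_field_carrier[OF x u]]) (use blk_off(1)[OF i] in simp)

lemma xi_dynamics:
  assumes i: "i \<in> {1..md}" and j: "j \<in> {1..<blk i}" and x: "x \<in> U" and u: "u \<in> carrier_vec m"
  shows "gradient (\<xi> i j) x \<bullet> (f x + g x *\<^sub>v u) = \<xi> i (j + 1) x + (\<Sum>l\<in>{1..<i}. \<delta> i j l x * v l x u)"
proof -
  note b = blk_off[OF i]
  have jb: "1 \<le> j" "j < blk i" "j \<le> kstar" using j b(1) by auto
  \<comment> \<open>All chains of the blocks up to j precede chain i, because j is smaller than
    \<open>blk i\<close>.\<close>
  have jle: "\<rho> j < i"
  proof -
    have "\<rho> j \<le> \<rho> (blk i - 1)" using rho_mono[of j "blk i - 1"] jb b(1) by auto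
    then show ?thesis using b(3) by linarith
  qed
  \<comment> \<open>The other chains before i lie in blocks beyond j, where \<delta> is 0 by
    definition.\<close>
  have "(\<Sum>l\<in>{1..<i}. \<delta> i j l x * v l x u) = (\<Sum>l\<in>{1..\<rho> j}. \<delta> i j l x * v l x u)"
  proof (rule sum.mono_neutral_right)
    show "\<forall>l\<in>{1..<i} - {1..\<rho> j}. \<delta> i j l x * v l x u = 0"
    proof
      fix l assume l: "l \<in> {1..<i} - {1..\<rho> j}"
      then have lmd: "l \<in> {1..md}" using i by auto
      have "\<not> blk l \<le> j"
      proof
        assume "blk l \<le> j"
        then have "\<rho> (blk l) \<le> \<rho> j" using rho_mono jb(3) by blast
        then show False using blk_off[OF lmd] rho_blk[OF blk_off(1)[OF lmd]] l by auto
      qed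
      then show "\<delta> i j l x * v l x u = 0" by (simp add: \<delta>_def)
    qed
  qed (use jle in auto)
  also have "\<dots> = (\<Sum>l\<in>{1..j}. \<Sum>s<blk_dim l.
      (R (blk i) * S_prod p \<rho> S (blk i - 1) (j + 1) * P j l x) $$ (off i, s) * vd l s x u)"
    unfolding sum_blocks[OF jb(3)]
  proof (intro sum.cong refl)
    fix l s assume "l \<in> {1..j}" "s \<in> {..<blk_dim l}"
    then have l: "l \<in> {1..kstar}" and s: "s < blk_dim l" and lj: "l \<le> j" using jb(3) by auto
    show "\<delta> i j (\<rho> (l - 1) + s + 1) x * v (\<rho> (l - 1) + s + 1) x u
        = (R (blk i) * S_prod p \<rho> S (blk i - 1) (j + 1) * P j l x) $$ (off i, s) * vd l s x u"
      unfolding \<delta>_def blk_eqI(2,3)[OF l s] v_eq_vd[OF l s x u] using lj by simp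
  qed
  finally show ?thesis
    using zeta_dynamics[OF b(1) jb(1,2) x u b(2)] xi_gradient[OF i _ x control_field_carrier[OF x u], of j] j
    by (simp only: \<xi>_def[abs_def]) auto
qed

lemma delta_smooth:
  assumes i: "i \<in> {1..md}" and j: "j \<in> {1..<blk i}" and l: "l \<in> {1..md}"
  shows "smooth_on U (\<delta> i j l)"
proof (cases "blk l \<le> j")
  case True
  note bi = blk_off[OF i] and bl = blk_off[OF l]
  have jk: "j \<in> {1..kstar}" "j + 1 \<in> {1..blk i}" "blk l \<in> {1..j}" using j bi(1) bl(1) True by auto
  have "smooth_mat U (blk_dim (blk i)) (blk_dim (blk l))
      (\<lambda>x. R (blk i) * S_prod p \<rho> S (blk i - 1) (j + 1) * P j (blk l) x)"
    using RS_prod_carrier[OF bi(1) jk(2)]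
    by (intro smooth_mat_mult[OF open_U smooth_mat_const[OF open_U] P_smooth[OF jk(1,3)]]) simp
  from smooth_matD(2)[OF this bi(2) bl(2)] True show ?thesis by (simp add: \<delta>_def[abs_def])
next
  case False
  then show ?thesis by (simp add: \<delta>_def[abs_def] smooth_on_const open_U)
qed

end

lemma distinct_concat_Pair:
  "distinct ls \<Longrightarrow> (\<And>i. i \<in> set ls \<Longrightarrow> distinct (F i)) \<Longrightarrow> distinct (concat (map (\<lambda>i. map (Pair i) (F i)) ls))"
  by (induction ls) (auto simp: distinct_map inj_on_def)

lemma frechet_derivative_point_of:
  fixes X :: "real^'n \<Rightarrow> real Matrix.vec"
  assumes U: "open U" and X: "smooth_vec U CARD('n) X" and x: "x \<in> U" and w: "w \<in> carrier_vec CARD('n)"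
  shows "frechet_derivative (\<lambda>z. point_of (X z) :: real^'n) (at x) (point_of w) = point_of (jacobian_mat X x *\<^sub>v w)"
proof -
  have "vec_nth (frechet_derivative (\<lambda>z. point_of (X z) :: real^'n) (at x) (point_of w)) c
      = vec_nth (point_of (jacobian_mat X x *\<^sub>v w)) c" for c :: 'n
  proof -
    let ?k = "to_nat_on UNIV c"
    have k: "?k < CARD('n)" by (rule to_nat_on_less_CARD)
    have "vec_nth (frechet_derivative (\<lambda>z. point_of (X z) :: real^'n) (at x) (point_of w)) c
        = frechet_derivative (\<lambda>z. vec_nth (point_of (X z) :: real^'n) c) (at x) (point_of w)"
      by (rule frechet_derivative_linear_compose[OF bounded_linear_vec_nth
            smooth_on_differentiable[OF smooth_on_point_of[OF U X] x], symmetric])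
    also have "(\<lambda>z. vec_nth (point_of (X z) :: real^'n) c) = (\<lambda>z. X z $ ?k)"
      by (simp add: point_of_def)
    also have "frechet_derivative (\<lambda>z. X z $ ?k) (at x) (point_of w) = (jacobian_mat X x *\<^sub>v w) $ ?k"
      by (rule jacobian_mult_index[OF smooth_vecD(1)[OF X x] k smooth_on_differentiable[OF smooth_vecD(2)[OF X k] x] w, symmetric])
    finally show ?thesis by (simp add: point_of_def)
  qed
  then show ?thesis by (simp add: Finite_Cartesian_Product.vec_eq_iff)
qed

section \<open>The output transformation\<close>

context regular_run
begin

text \<open>Since \<open>\<Theta> 0\<close> is the output, the first coordinate of chain t + 1 is a
  constant linear combination of outputs; row t holds its coefficients, and together these rows
  yield the component y_d.\<close>

definition out_rows :: "real Matrix.mat" where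
  "out_rows = Matrix.mat md p (\<lambda>(t, j). (R (blk (t + 1)) * S_prod p \<rho> S (blk (t + 1) - 1) 1) $$ (off (t + 1), j))"

definition \<Gamma>o :: "real Matrix.mat" where
  "\<Gamma>o = S_prod p \<rho> S kstar 1 @\<^sub>r out_rows"

lemma S_prod_carrier_1: "k \<le> kstar \<Longrightarrow> S_prod p \<rho> S k 1 \<in> carrier_mat (p - \<rho> k) p"
  using S_prod_carrier[of 1 k] run(1) by simp

lemma RS_prod_carrier_1: "i \<in> {1..kstar} \<Longrightarrow> R i * S_prod p \<rho> S (i - 1) 1 \<in> carrier_mat (blk_dim i) p"
  using RS_prod_carrier[of i 1] run(1) by simp

lemma out_rows_carrier: "out_rows \<in> carrier_mat md p"
  by (simp add: out_rows_def)

lemma out_rows_index: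
  assumes y: "y \<in> carrier_vec p" and i: "i \<in> {1..md}"
  shows "(out_rows *\<^sub>v y) $ (i - 1) = ((R (blk i) * S_prod p \<rho> S (blk i - 1) 1) *\<^sub>v y) $ off i"
proof -
  have t: "i - 1 < md" and it: "i - 1 + 1 = i" using i by auto
  have "(out_rows *\<^sub>v y) $ (i - 1) = (\<Sum>j<p. out_rows $$ (i - 1, j) * y $ j)"
    by (rule mult_mat_vec_index[OF out_rows_carrier y t])
  also have "\<dots> = (\<Sum>j<p. (R (blk i) * S_prod p \<rho> S (blk i - 1) 1) $$ (off i, j) * y $ j)"
    by (intro sum.cong refl) (simp only: out_rows_def index_mat t lessThan_iff case_prod_conv it)
  also have "\<dots> = ((R (blk i) * S_prod p \<rho> S (blk i - 1) 1) *\<^sub>v y) $ off i"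
    by (rule mult_mat_vec_index[OF RS_prod_carrier_1[OF blk_off(1)[OF i]] y blk_off(2)[OF i], symmetric])
  finally show ?thesis .
qed

lemma Gamma_o_carrier: "\<Gamma>o \<in> carrier_mat p p"
proof -
  have "p - md + md = p" using rho_le[of kstar] by simp
  with carrier_append_rows[OF S_prod_carrier_1[OF order_refl] out_rows_carrier] show ?thesis
    by (simp only: \<Gamma>o_def)
qed

lemma Gamma_o_mult:
  "y \<in> carrier_vec p \<Longrightarrow> \<Gamma>o *\<^sub>v y = (S_prod p \<rho> S kstar 1 *\<^sub>v y) @\<^sub>v (out_rows *\<^sub>v y)"
  unfolding \<Gamma>o_def by (rule mat_mult_append[OF S_prod_carrier_1[OF order_refl] out_rows_carrier])

text \<open>A vector y in the kernel is killed by the full product of the \<open>S k\<close> and by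
  every R_k S_{k-1} ... S_1. As the stack of R_k and S_k is injective, vanishing of S_k ... S_1 y
  descends from k to k - 1, down to the empty product, where it reads y = 0.\<close>

lemma Gamma_o_invertible: "invertible_mat \<Gamma>o"
proof (rule invertible_matI_trivial_kernel[OF Gamma_o_carrier])
  fix y :: "real Matrix.vec" assume y: "y \<in> carrier_vec p" and 0: "\<Gamma>o *\<^sub>v y = 0\<^sub>v p"
  have "p = p - md + md" using rho_le[of kstar] by simp
  then have "0\<^sub>v p = (0\<^sub>v (p - md) @\<^sub>v 0\<^sub>v md :: real Matrix.vec)" by (intro eq_vecI) auto
  with 0 Gamma_o_mult[OF y] have e: "(S_prod p \<rho> S kstar 1 *\<^sub>v y) @\<^sub>v (out_rows *\<^sub>v y) = 0\<^sub>v (p - md) @\<^sub>v 0\<^sub>v md" by simp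
  have "S_prod p \<rho> S kstar 1 *\<^sub>v y = 0\<^sub>v (p - md) \<and> out_rows *\<^sub>v y = 0\<^sub>v md"
    using e append_vec_eq[OF mult_mat_vec_carrier[OF S_prod_carrier_1[OF order_refl] y] zero_carrier_vec] by blast
  then have S0: "S_prod p \<rho> S kstar 1 *\<^sub>v y = 0\<^sub>v (p - md)" and W0: "out_rows *\<^sub>v y = 0\<^sub>v md" by auto
  have R0: "(R k * S_prod p \<rho> S (k - 1) 1) *\<^sub>v y = 0\<^sub>v (blk_dim k)" if k: "k \<in> {1..kstar}" for k
  proof (rule eq_vecI)
    fix r assume "r < dim_vec (0\<^sub>v (blk_dim k) :: real Matrix.vec)"
    then have r: "r < blk_dim k" by simp
    note b = blk_eqI[OF k r]
    have "(out_rows *\<^sub>v y) $ (\<rho> (k - 1) + r + 1 - 1) = 0" using W0 b(1) by simp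
    then show "((R k * S_prod p \<rho> S (k - 1) 1) *\<^sub>v y) $ r = 0\<^sub>v (blk_dim k) $ r"
      using out_rows_index[OF y b(1)] r by (simp only: b(2,3) index_zero_vec)
  qed (use carrier_matD(1)[OF R_carrier[OF k]] in simp)
  have "S_prod p \<rho> S k 1 *\<^sub>v y = 0\<^sub>v (p - \<rho> k)" if "k \<le> kstar" for k
    using that
  proof (induction rule: inc_induct)
    case base
    show ?case by (rule S0)
  next
    case (step k)
    have k: "Suc k \<in> {1..kstar}" using step.hyps by simp
    note Rc = R_carrier[OF k] and Sc = S_carrier[OF k]
    let ?z = "S_prod p \<rho> S k 1 *\<^sub>v y"
    have Sk: "S_prod p \<rho> S k 1 \<in> carrier_mat (p - \<rho> (Suc k - 1)) p" using S_prod_carrier_1[of k] step.hyps by simp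
    have z: "?z \<in> carrier_vec (p - \<rho> (Suc k - 1))" by (rule mult_mat_vec_carrier[OF Sk y])
    have 1: "R (Suc k) *\<^sub>v ?z = 0\<^sub>v (blk_dim (Suc k))"
      using R0[OF k] unfolding assoc_mult_mat_vec[OF Rc Sk y, symmetric] by (simp only: diff_Suc_1)
    have 2: "S (Suc k) *\<^sub>v ?z = 0\<^sub>v (p - \<rho> (Suc k))"
      using step.IH assoc_mult_mat_vec[OF Sc Sk y] S_prod_Suc[of 1 k] by simp
    have dim: "blk_dim (Suc k) + (p - \<rho> (Suc k)) = p - \<rho> (Suc k - 1)" by (rule RS_dim[OF k])
    have c: "R (Suc k) @\<^sub>r S (Suc k) \<in> carrier_mat (p - \<rho> (Suc k - 1)) (p - \<rho> (Suc k - 1))"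
      using carrier_append_rows[OF Rc Sc] by (simp only: dim)
    have "(R (Suc k) @\<^sub>r S (Suc k)) *\<^sub>v ?z = 0\<^sub>v (blk_dim (Suc k)) @\<^sub>v 0\<^sub>v (p - \<rho> (Suc k))"
      unfolding mat_mult_append[OF Rc Sc z] 1 2 ..
    also have "\<dots> = 0\<^sub>v (p - \<rho> (Suc k - 1))" unfolding dim[symmetric] by (intro eq_vecI) auto
    finally have "?z = 0\<^sub>v (p - \<rho> (Suc k - 1))" by (rule invertible_mat_kernel[OF c RS_invertible[OF k] z])
    then show ?case by simp
  qed
  from this[of 0] show "y = 0\<^sub>v p" using S_prod_self[of 0] run(1) y by simp
qed

lemma Gamma_o_output:
  assumes x: "x \<in> U"
  shows "\<Gamma>o *\<^sub>v h x = (S_prod p \<rho> S kstar 1 *\<^sub>v h x) @\<^sub>v Matrix.vec md (\<lambda>i. \<xi> (i + 1) 1 x)"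
proof -
  have hx: "h x \<in> carrier_vec p" by (rule smooth_vecD(1)[OF smooth_h x])
  have "out_rows *\<^sub>v h x = Matrix.vec md (\<lambda>i. \<xi> (i + 1) 1 x)"
  proof (rule eq_vecI)
    fix t assume "t < dim_vec (Matrix.vec md (\<lambda>i. \<xi> (i + 1) 1 x))"
    then have t: "t < md" and i: "t + 1 \<in> {1..md}" by simp_all
    show "(out_rows *\<^sub>v h x) $ t = Matrix.vec md (\<lambda>i. \<xi> (i + 1) 1 x) $ t"
      using out_rows_index[OF hx i] run(2)[OF x] t by (simp add: \<xi>_def zeta_block_def)
  qed (use out_rows_carrier in simp)
  with Gamma_o_mult[OF hx] show ?thesis by simp
qed

lemma he_smooth: "smooth_vec U (p - md) (\<lambda>x. S_prod p \<rho> S kstar 1 *\<^sub>v h x)"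
  by (rule smooth_mat_mult_vec[OF open_U smooth_mat_const[OF open_U S_prod_carrier_1[OF order_refl]] smooth_h])

section \<open>Orderings of the chain coordinates\<close>

definition pair_list :: "(nat \<times> nat) list" where
  "pair_list = concat (map (\<lambda>i. map (Pair i) [1..<Suc (blk i)]) [1..<Suc md])"

lemma xi_col_eq: "xi_col q \<xi> x = vec_of_list (map (\<lambda>(i, j). \<xi> i j x) pair_list)"
  by (simp only: xi_col_def pair_list_def length_inf_zero_list[OF order_refl] blk_def[symmetric] map_concat map_map o_def case_prod_conv)

lemma set_pair_list: "set pair_list = {(i, j). i \<in> {1..md} \<and> j \<in> {1..blk i}}"
  unfolding pair_list_def by (auto simp del: upt_Suc simp: atLeastLessThanSuc_atLeastAtMost image_iff)

lemma distinct_pair_list: "distinct pair_list"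
  unfolding pair_list_def by (rule distinct_concat_Pair) simp_all

lemma length_pair_list: "length pair_list = inf_zero_dim \<rho> kstar"
proof -
  have "map blk [1..<Suc md] = map (\<lambda>i. q ! i) [0..<md]"
    by (rule nth_equalityI) (simp_all add: blk_def del: upt_Suc)
  also have "map (\<lambda>i. q ! i) [0..<md] = q"
    using map_nth[of q] by (simp only: length_inf_zero_list[OF order_refl])
  finally have "sum_list (map blk [1..<Suc md]) = sum_list q" by (simp only:)
  then show ?thesis
    by (simp add: pair_list_def length_concat o_def sum_list_inf_zero_list del: upt_Suc)
qed

text \<open>The order of \<open>Phi_d_bar\<close>: by block k, then by level j, then by row r.
  \<open>pair_list\<close> runs along one chain after the other instead, so the same coordinates
  stand in a different order.\<close>

definition triple_list :: "(nat \<times> nat \<times> nat) list" where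
  "triple_list = concat (map (\<lambda>k. map (Pair k) (concat (map (\<lambda>j. map (Pair j) [0..<blk_dim k]) [1..<Suc k]))) [1..<Suc kstar])"

lemma set_triple_list: "set triple_list = {(k, j, r). k \<in> {1..kstar} \<and> j \<in> {1..k} \<and> r < blk_dim k}"
  unfolding triple_list_def by (auto simp del: upt_Suc simp: atLeastLessThanSuc_atLeastAtMost image_iff)

lemma Phi_d_bar_eq:
  assumes x: "x \<in> U"
  shows "Phi_d_bar p \<rho> R S \<Theta> kstar x = vec_of_list (map (\<lambda>(k, j, r). \<zeta> k j x $ r) triple_list)"
proof -
  have "zeta p \<rho> R S \<Theta> k x = vec_of_list (concat (map (\<lambda>j. map (\<lambda>r. \<zeta> k j x $ r) [0..<blk_dim k]) [1..<Suc k]))"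
    if k: "k \<in> set [1..<Suc kstar]" for k
  proof -
    have "map (\<lambda>j. \<zeta> k j x) [1..<Suc k] = map (\<lambda>j. vec_of_list (map (\<lambda>r. \<zeta> k j x $ r) [0..<blk_dim k])) [1..<Suc k]"
    proof (intro map_cong refl)
      fix j assume "j \<in> set [1..<Suc k]"
      then have "k \<in> {1..kstar}" "j \<in> {1..k}" using k by auto
      from smooth_vecD(1)[OF zeta_smooth[OF this] x]
      show "\<zeta> k j x = vec_of_list (map (\<lambda>r. \<zeta> k j x $ r) [0..<blk_dim k])"
        by (rule vec_of_list_map_index[symmetric])
    qed
    then show ?thesis unfolding zeta_def by (simp only: vcol_vec_of_list)
  qed
  then have "map (\<lambda>k. zeta p \<rho> R S \<Theta> k x) [1..<Suc kstar]
      = map (\<lambda>k. vec_of_list (concat (map (\<lambda>j. map (\<lambda>r. \<zeta> k j x $ r) [0..<blk_dim k]) [1..<Suc k]))) [1..<Suc kstar]"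
    by (intro map_cong refl)
  then show ?thesis
    unfolding Phi_d_bar_def triple_list_def
    by (simp only: vcol_vec_of_list map_concat map_map o_def case_prod_conv)
qed

text \<open>Full row rank is restated as the freedom to prescribe all derivatives at once. In this
  form the order of the rows has disappeared, so the passage to the order of \<open>xi_col\<close>
  is a mere renaming.\<close>

lemma zeta_derivatives_surjective:
  assumes B: "full_row_rank (jacobian_mat (Phi_d_bar p \<rho> R S \<Theta> kstar) x)" and x: "x \<in> U"
  shows "\<exists>e. \<forall>k\<in>{1..kstar}. \<forall>j\<in>{1..k}. \<forall>r<blk_dim k.
    frechet_derivative (\<lambda>z. \<zeta> k j z $ r) (at x) e = w k j r"
proof -
  let ?\<Phi> = "Phi_d_bar p \<rho> R S \<Theta> kstar" and ?N = "length triple_list"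
  have \<Phi>c: "?\<Phi> z \<in> carrier_vec ?N" if "z \<in> U" for z by (simp add: Phi_d_bar_eq[OF that] carrier_vecI)
  let ?w = "vec_of_list (map (\<lambda>(k, j, r). w k j r) triple_list)"
  have "?w \<in> carrier_vec ?N" by (simp add: carrier_vecI)
  with B[unfolded full_row_rank_iff_surjective[OF jacobian_mat_carrier[where \<Theta> = ?\<Phi> and x = x, OF \<Phi>c[OF x]]]]
  obtain e where e: "e \<in> carrier_vec CARD('n)" "jacobian_mat ?\<Phi> x *\<^sub>v e = ?w" by blast
  have "frechet_derivative (\<lambda>z. \<zeta> k j z $ r) (at x) (point_of e) = w k j r"
    if k: "k \<in> {1..kstar}" and j: "j \<in> {1..k}" and r: "r < blk_dim k" for k j r
  proof -
    have "(k, j, r) \<in> set triple_list" unfolding set_triple_list using k j r by blast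
    then obtain t where t: "t < ?N" "triple_list ! t = (k, j, r)" unfolding in_set_conv_nth by blast
    have comp: "\<zeta> k j z $ r = ?\<Phi> z $ t" if "z \<in> U" for z
      using t by (simp add: Phi_d_bar_eq[OF that] vec_of_list_index)
    have dz: "(\<lambda>z. \<zeta> k j z $ r) differentiable (at x)"
      by (rule smooth_on_differentiable[OF smooth_vecD(2)[OF zeta_smooth[OF k j] r] x])
    have d\<Phi>: "smooth_on U (\<lambda>z. ?\<Phi> z $ t)"
      by (rule smooth_on_cong[OF open_U smooth_vecD(2)[OF zeta_smooth[OF k j] r] comp])
    have "w k j r = ?w $ t" using t by (simp add: vec_of_list_index)
    also have "\<dots> = frechet_derivative (\<lambda>z. ?\<Phi> z $ t) (at x) (point_of e)"
      unfolding e(2)[symmetric] by (rule jacobian_mult_index[OF \<Phi>c[OF x] t(1) smooth_on_differentiable[OF d\<Phi> x] e(1)])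
    also have "frechet_derivative (\<lambda>z. ?\<Phi> z $ t) (at x) = frechet_derivative (\<lambda>z. \<zeta> k j z $ r) (at x)"
      by (rule frechet_derivative_cong_open[OF open_U x comp dz])
    finally show ?thesis by simp
  qed
  then show ?thesis by blast
qed

definition \<xi>s :: "nat \<Rightarrow> real^'n \<Rightarrow> real" where
  "\<xi>s t = (case pair_list ! t of (i, j) \<Rightarrow> \<xi> i j)"

lemma xis_smooth: "t < length pair_list \<Longrightarrow> smooth_on U (\<xi>s t)"
proof -
  assume "t < length pair_list"
  then have "pair_list ! t \<in> set pair_list" by (rule nth_mem)
  then obtain i j where "pair_list ! t = (i, j)" "i \<in> {1..md}" "j \<in> {1..blk i}" unfolding set_pair_list by blast
  with xi_smooth show ?thesis by (simp add: \<xi>s_def)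
qed

lemma xis_exists: "i \<in> {1..md} \<Longrightarrow> j \<in> {1..blk i} \<Longrightarrow> \<exists>t<length pair_list. \<xi> i j = \<xi>s t"
proof -
  assume "i \<in> {1..md}" "j \<in> {1..blk i}"
  then have "(i, j) \<in> set pair_list" by (simp add: set_pair_list)
  then obtain t where "t < length pair_list" "pair_list ! t = (i, j)" unfolding in_set_conv_nth by blast
  then show ?thesis by (intro exI[of _ t]) (simp add: \<xi>s_def)
qed

lemma xis_surjective:
  assumes B: "full_row_rank (jacobian_mat (Phi_d_bar p \<rho> R S \<Theta> kstar) x)" and x: "x \<in> U"
  shows "\<exists>e. \<forall>t<length pair_list. frechet_derivative (\<xi>s t) (at x) e = w t"
proof -
  \<comment> \<open>The target values \<open>w\<close> are indexed by position in
    \<open>pair_list\<close>, whereas derivatives are prescribed per block, level and row. The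
    position is unique because the list is distinct.\<close>
  define pos where "pos ij = (THE t. t < length pair_list \<and> pair_list ! t = ij)" for ij
  have pos: "pos (pair_list ! t) = t" if "t < length pair_list" for t
    unfolding pos_def using that distinct_pair_list
    by (intro the_equality) (auto simp: nth_eq_iff_index_eq)
  from zeta_derivatives_surjective[OF B x, of "\<lambda>k j r. w (pos (\<rho> (k - 1) + r + 1, j))"]
  obtain e where e: "\<forall>k\<in>{1..kstar}. \<forall>j\<in>{1..k}. \<forall>r<blk_dim k.
    frechet_derivative (\<lambda>z. \<zeta> k j z $ r) (at x) e = w (pos (\<rho> (k - 1) + r + 1, j))" by blast
  have "frechet_derivative (\<xi>s t) (at x) e = w t" if t: "t < length pair_list" for t
  proof -
    have "pair_list ! t \<in> set pair_list" using t by (rule nth_mem)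
    then obtain i j where ij: "pair_list ! t = (i, j)" and i: "i \<in> {1..md}" and j: "j \<in> {1..blk i}"
      unfolding set_pair_list by blast
    note b = blk_off[OF i]
    have "frechet_derivative (\<xi> i j) (at x) e = w (pos (i, j))"
      using e[rule_format, OF b(1) j b(2)] unfolding \<xi>_def[abs_def] by (simp only: b(3))
    then show ?thesis using pos[OF t] ij by (simp add: \<xi>s_def)
  qed
  then show ?thesis by blast
qed

end

lemma vec_last_append: "c \<in> carrier_vec k \<Longrightarrow> vec_last (a @\<^sub>v c) k = (c :: real Matrix.vec)"
  by (intro eq_vecI) (auto simp: vec_last_def)

lemma mult_mat_unit_vec: "A \<in> carrier_mat r k \<Longrightarrow> i < k \<Longrightarrow> A *\<^sub>v unit_vec k i = col A (i :: nat)"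
  for A :: "real Matrix.mat"
  by (intro eq_vecI) auto

lemma mult_mat_zero_vec: "A \<in> carrier_mat r k \<Longrightarrow> A *\<^sub>v 0\<^sub>v k = 0\<^sub>v r" for A :: "real Matrix.mat"
  by (intro eq_vecI) auto

lemma zero_mat_mult_vec: "c \<in> carrier_vec k \<Longrightarrow> 0\<^sub>m r k *\<^sub>v c = (0\<^sub>v r :: real Matrix.vec)"
  by (intro eq_vecI) auto

subsection \<open>The normal form\<close>

locale decoupled_run = regular_run U m p f h g \<rho> R S P \<Theta> \<Omega> kstar
  for U :: "(real^'n) set" and m p :: nat
    and f h :: "real^'n \<Rightarrow> real Matrix.vec" and g :: "real^'n \<Rightarrow> real Matrix.mat"
    and \<rho> :: "nat \<Rightarrow> nat" and R S :: "nat \<Rightarrow> real Matrix.mat"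
    and P :: "nat \<Rightarrow> nat \<Rightarrow> real^'n \<Rightarrow> real Matrix.mat"
    and \<Theta> \<Omega> :: "nat \<Rightarrow> real^'n \<Rightarrow> real Matrix.vec" and kstar :: nat +
  fixes \<Gamma>ie \<Gamma>i gd :: "real^'n \<Rightarrow> real Matrix.mat"
  assumes assumption_B: "\<forall>x\<in>U. full_row_rank (jacobian_mat (Phi_d_bar p \<rho> R S \<Theta> kstar) x)"
    and \<Gamma>ie: "smooth_mat U (m - \<rho> kstar) m \<Gamma>ie"
    and \<Gamma>i: "\<forall>x. \<Gamma>i x = \<Gamma>ie x @\<^sub>r lie_mat g (\<Omega> kstar) x"
    and \<Gamma>i_nonsingular: "\<forall>x\<in>U. invertible_mat (\<Gamma>i x)"
    and gd: "\<forall>x. gd x = g x * (the (mat_inverse (\<Gamma>i x)) * (0\<^sub>m (m - \<rho> kstar) (\<rho> kstar) @\<^sub>r 1\<^sub>m (\<rho> kstar)))"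
    and involutive: "involutive_on U (column_distribution gd)"
begin

abbreviation "b \<equiv> lie_mat g (\<Omega> kstar)"
abbreviation "B x \<equiv> the (mat_inverse (\<Gamma>i x))"
abbreviation "E \<equiv> 0\<^sub>m (m - md) md @\<^sub>r 1\<^sub>m md :: real Matrix.mat"

lemma Gamma_smooth_stacked: "smooth_mat U (m - md + md) m \<Gamma>i"
proof -
  have "\<Gamma>i = (\<lambda>x. \<Gamma>ie x @\<^sub>r b x)" using \<Gamma>i by blast
  then show ?thesis
    using smooth_mat_append_rows[OF open_U \<Gamma>ie smooth_lie_mat[OF open_U smooth_g Omega_smooth]] by (simp only:)
qed

text \<open>\<open>\<Gamma>i\<close> is invertible at 0, a point of \<open>U\<close>, hence square.
  From here on \<open>m - md\<close> is a true difference.\<close>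

lemma md_le: "m - md + md = m"
  using smooth_matD(1)[OF Gamma_smooth_stacked zero_U] \<Gamma>i_nonsingular zero_U
  by (auto simp: invertible_mat_def)

lemma Gamma_smooth: "smooth_mat U m m \<Gamma>i"
  using Gamma_smooth_stacked by (simp only: md_le)

lemma Gamma_carrier: "x \<in> U \<Longrightarrow> \<Gamma>i x \<in> carrier_mat m m"
  by (rule smooth_matD(1)[OF Gamma_smooth])

lemma B_smooth: "smooth_mat U m m B"
  using \<Gamma>i_nonsingular by (intro smooth_mat_inverse[OF open_U Gamma_smooth]) blast

lemma B_carrier: "x \<in> U \<Longrightarrow> B x \<in> carrier_mat m m"
  by (rule smooth_matD(1)[OF B_smooth])

lemma E_carrier: "E \<in> carrier_mat m md"
  using carrier_append_rows[OF zero_carrier_mat one_carrier_mat, of "m - md" md] by (simp only: md_le)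

lemma E_mult: "c \<in> carrier_vec md \<Longrightarrow> E *\<^sub>v c = 0\<^sub>v (m - md) @\<^sub>v c"
  unfolding mat_mult_append[OF zero_carrier_mat one_carrier_mat] by (simp add: zero_mat_mult_vec)

text \<open>\<open>b\<close> forms the last rows of \<open>\<Gamma>i\<close>, and the product of
  \<open>\<Gamma>i\<close> with \<open>B\<close> is the identity.\<close>

lemma b_B_mult:
  assumes x: "x \<in> U" and z: "z \<in> carrier_vec m"
  shows "b x *\<^sub>v (B x *\<^sub>v z) = vec_last z md"
proof -
  note G = Gamma_carrier[OF x] and Bc = B_carrier[OF x]
  have w: "B x *\<^sub>v z \<in> carrier_vec m" by (rule mult_mat_vec_carrier[OF Bc z])
  have "\<Gamma>i x *\<^sub>v (B x *\<^sub>v z) = z"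
    using mat_inverse_spec(2)[OF G \<Gamma>i_nonsingular[rule_format, OF x]] assoc_mult_mat_vec[OF G Bc z] z by simp
  moreover have "\<Gamma>i x *\<^sub>v (B x *\<^sub>v z) = (\<Gamma>ie x *\<^sub>v (B x *\<^sub>v z)) @\<^sub>v (b x *\<^sub>v (B x *\<^sub>v z))"
    unfolding \<Gamma>i[rule_format] by (rule mat_mult_append[OF smooth_matD(1)[OF \<Gamma>ie x] lie_Omega_carrier(2)[OF x] w[unfolded \<Gamma>i[rule_format]]])
  moreover have "b x *\<^sub>v (B x *\<^sub>v z) \<in> carrier_vec md"
    by (rule mult_mat_vec_carrier[OF lie_Omega_carrier(2)[OF x] w])
  ultimately show ?thesis using vec_last_append by metis
qed

lemma gd_mult:
  assumes x: "x \<in> U" and c: "c \<in> carrier_vec md"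
  shows "gd x *\<^sub>v c = g x *\<^sub>v (B x *\<^sub>v (0\<^sub>v (m - md) @\<^sub>v c))"
  using assoc_mult_mat_vec[OF g_carrier[OF x] mult_carrier_mat[OF B_carrier[OF x] E_carrier] c]
    assoc_mult_mat_vec[OF B_carrier[OF x] E_carrier c]
  unfolding gd[rule_format] E_mult[OF c] by simp

lemma gd_smooth: "smooth_mat U CARD('n) md gd"
  using smooth_mat_mult[OF open_U smooth_g smooth_mat_mult[OF open_U B_smooth smooth_mat_const[OF open_U E_carrier]]]
  unfolding gd[rule_format, abs_def] .

lemma gd_carrier: "x \<in> U \<Longrightarrow> gd x \<in> carrier_mat CARD('n) md"
  by (rule smooth_matD(1)[OF gd_smooth])

lemma zero_append_carrier: "c \<in> carrier_vec md \<Longrightarrow> 0\<^sub>v (m - md) @\<^sub>v c \<in> carrier_vec m"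
  using append_carrier_vec[OF zero_carrier_vec, of c md "m - md"] by (simp only: md_le)

lemma b_full_row_rank:
  assumes x: "x \<in> U"
  shows "full_row_rank (b x)"
  unfolding full_row_rank_iff_surjective[OF lie_Omega_carrier(2)[OF x]]
proof
  fix c :: "real Matrix.vec" assume c: "c \<in> carrier_vec md"
  show "\<exists>w\<in>carrier_vec m. b x *\<^sub>v w = c"
  proof
    show "b x *\<^sub>v (B x *\<^sub>v (0\<^sub>v (m - md) @\<^sub>v c)) = c"
      by (simp only: b_B_mult[OF x zero_append_carrier[OF c]] vec_last_append[OF c])
  qed (rule mult_mat_vec_carrier[OF B_carrier[OF x] zero_append_carrier[OF c]])
qed

text \<open>The vector \<open>gd x\<close> times c is the effect of an input that \<open>b x\<close>
  maps to c, by \<open>b_B_mult\<close>. Taking unit vectors for c gives the duality of the columns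
  of \<open>gd\<close> with the ends of the chains.\<close>

lemma derivative_along_gd:
  assumes x: "x \<in> U" and c: "c \<in> carrier_vec md" and i: "i \<in> {1..md}"
  shows "frechet_derivative (\<xi> i (blk i)) (at x) (point_of (gd x *\<^sub>v c)) = c $ (i - 1)"
proof -
  let ?w = "B x *\<^sub>v (0\<^sub>v (m - md) @\<^sub>v c)"
  have w: "?w \<in> carrier_vec m" by (rule mult_mat_vec_carrier[OF B_carrier[OF x] zero_append_carrier[OF c]])
  have t: "i - 1 < md" using i by auto
  have "c $ (i - 1) = (b x *\<^sub>v ?w) $ (i - 1)"
    by (simp only: b_B_mult[OF x zero_append_carrier[OF c]] vec_last_append[OF c])
  also have "\<dots> = frechet_derivative (\<lambda>z. \<Omega> kstar z $ (i - 1)) (at x) (point_of (g x *\<^sub>v ?w))"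
    by (rule lie_mat_mult_index[where g = g, OF Omega_smooth x t g_carrier[OF x] w])
  finally show ?thesis by (simp only: Omega_xi_derivative[OF i x] gd_mult[OF x c])
qed

section \<open>The commuting columns of \<open>gd\<close>\<close>

abbreviation X :: "nat \<Rightarrow> real^'n \<Rightarrow> real Matrix.vec" where "X i x \<equiv> col (gd x) i"

lemma X_eq: "x \<in> U \<Longrightarrow> i < md \<Longrightarrow> X i x = gd x *\<^sub>v unit_vec md i"
  by (rule mult_mat_unit_vec[OF gd_carrier, symmetric])

lemma X_smooth:
  assumes i: "i < md"
  shows "smooth_vec U CARD('n) (X i)"
  unfolding smooth_vec_def
proof (intro conjI ballI allI impI)
  show "X i x \<in> carrier_vec CARD('n)" if "x \<in> U" for x
    using col_carrier_vec[OF i gd_carrier[OF that]] .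
  show "smooth_on U (\<lambda>x. X i x $ r)" if r: "r < CARD('n)" for r
    by (rule smooth_on_cong[OF open_U smooth_matD(2)[OF gd_smooth r i]])
      (simp add: carrier_matD[OF gd_carrier] i r)
qed

lemma X_in_distribution:
  assumes i: "i < md"
  shows "vector_field_in U (column_distribution gd) (X i)"
  unfolding vector_field_in_def column_distribution_def
proof (intro conjI ballI X_smooth[OF i])
  fix x assume x: "x \<in> U"
  show "X i x \<in> vec_space.col_space CARD('n) (gd x)"
    unfolding vec_space.col_space_eq[OF gd_carrier[OF x]] X_eq[OF x i]
    using gd_carrier[OF x] mult_mat_vec_carrier[OF gd_carrier[OF x] unit_vec_carrier, of i] by auto
qed

lemma X_dual:
  assumes x: "x \<in> U" and i: "i < md" and j: "j < md"
  shows "frechet_derivative (\<xi> (j + 1) (blk (j + 1))) (at x) (point_of (X i x)) = (if i = j then 1 else 0)"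
proof -
  have "j + 1 \<in> {1..md}" using j by simp
  from derivative_along_gd[OF x unit_vec_carrier this, of i] show ?thesis
    using i j by (simp add: X_eq[OF x i])
qed

lemma X_commute:
  assumes x: "x \<in> U" and i: "i < md" and j: "j < md"
  shows "frechet_derivative (\<lambda>z. point_of (X i z) :: real^'n) (at x) (point_of (X j x))
       = frechet_derivative (\<lambda>z. point_of (X j z) :: real^'n) (at x) (point_of (X i x))"
proof -
  let ?Y = "\<lambda>i z. point_of (X i z) :: real^'n"
  note Xc = smooth_vecD(1)[OF X_smooth x]
  have Jc: "jacobian_mat (X j) x *\<^sub>v X i x \<in> carrier_vec CARD('n)" if "i < md" "j < md" for i j
    by (rule mult_mat_vec_carrier[OF jacobian_mat_carrier[where \<Theta> = "X j", OF Xc[OF that(2)]] Xc[OF that(1)]])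
  have J: "point_of (jacobian_mat (X j) x *\<^sub>v X i x) = frechet_derivative (?Y j) (at x) (?Y i x)"
    if "i < md" "j < md" for i j
    by (rule frechet_derivative_point_of[OF open_U X_smooth[OF that(2)] x Xc[OF that(1)], symmetric])
  let ?L = "lie_bracket (X i) (X j) x"
  have "vector_field_in U (column_distribution gd) (lie_bracket (X i) (X j))"
    using involutive X_in_distribution[OF i] X_in_distribution[OF j] unfolding involutive_on_def by blast
  then have "?L \<in> vec_space.col_space CARD('n) (gd x)"
    using x unfolding vector_field_in_def column_distribution_def by blast
  then obtain c where c: "c \<in> carrier_vec md" and L: "?L = gd x *\<^sub>v c"
    unfolding vec_space.col_space_eq[OF gd_carrier[OF x]] using gd_carrier[OF x] by auto
  have pL: "point_of ?L = frechet_derivative (?Y j) (at x) (?Y i x) - frechet_derivative (?Y i) (at x) (?Y j x)"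
    unfolding lie_bracket_def by (simp only: point_of_diff[OF Jc[OF i j] Jc[OF j i]] J[OF i j] J[OF j i])
  \<comment> \<open>By duality the differential of the end of chain k + 1 reads off the coefficient
    \<open>c $ k\<close> of the bracket; on the other hand it annihilates brackets of the
    columns.\<close>
  have "c $ k = 0" if k: "k < md" for k
  proof -
    have k1: "k + 1 \<in> {1..md}" using k by simp
    let ?w = "\<xi> (k + 1) (blk (k + 1))"
    have w: "smooth_on U ?w" by (rule xi_smooth[OF k1]) (use blk_off(1)[OF k1] in simp)
    have lin: "linear (frechet_derivative ?w (at x))"
      by (rule has_derivative_linear[OF smooth_on_has_derivative[OF w x]])
    have "c $ k = frechet_derivative ?w (at x) (point_of ?L)"
      unfolding L using derivative_along_gd[OF x c k1] by simp
    also have "\<dots> = 0"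
      unfolding pL linear_diff[OF lin]
      using frechet_derivative_bracket_eq[OF open_U w smooth_on_point_of[OF open_U X_smooth[OF i]]
        smooth_on_point_of[OF open_U X_smooth[OF j]] x X_dual[OF _ i k] X_dual[OF _ j k]]
      by simp
    finally show ?thesis .
  qed
  then have "c = 0\<^sub>v md" using c by (intro eq_vecI) auto
  then have "?L = 0\<^sub>v CARD('n)" using L mult_mat_zero_vec[OF gd_carrier[OF x]] by (simp only:)
  then have "point_of ?L = (0 :: real^'n)"
    by (simp add: point_of_def Finite_Cartesian_Product.vec_eq_iff to_nat_on_less_CARD)
  with pL show ?thesis by simp
qed

section \<open>The internal dynamics\<close>

abbreviation "nd \<equiv> inf_zero_dim \<rho> kstar"
abbreviation "E2 \<equiv> 1\<^sub>m (m - md) @\<^sub>r 0\<^sub>m md (m - md) :: real Matrix.mat"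

lemma E2_carrier: "E2 \<in> carrier_mat m (m - md)"
  using carrier_append_rows[OF one_carrier_mat zero_carrier_mat, of "m - md" md] by (simp only: md_le)

lemma E2_mult: "z \<in> carrier_vec (m - md) \<Longrightarrow> E2 *\<^sub>v z = z @\<^sub>v 0\<^sub>v md"
  unfolding mat_mult_append[OF one_carrier_mat zero_carrier_mat] by (simp add: zero_mat_mult_vec)

text \<open>Write u as \<open>B x\<close> applied to z, where z consists of u_e and u_d. The columns
  of g B that multiply u_d are those of \<open>gd\<close>.\<close>

lemma input_split:
  assumes x: "x \<in> U" and u: "u \<in> carrier_vec m"
  defines "z \<equiv> \<Gamma>i x *\<^sub>v u"
  shows "g x *\<^sub>v u = (g x * (B x * E2)) *\<^sub>v vec_first z (m - md) + gd x *\<^sub>v vec_last z md"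
proof -
  let ?z1 = "vec_first z (m - md)" and ?z2 = "vec_last z md"
  note G = Gamma_carrier[OF x] and Bc = B_carrier[OF x] and gc = g_carrier[OF x]
  have z: "z \<in> carrier_vec m" unfolding z_def by (rule mult_mat_vec_carrier[OF G u])
  have z1: "?z1 \<in> carrier_vec (m - md)" and z2: "?z2 \<in> carrier_vec md" by (simp_all add: vec_first_def vec_last_def)
  have z10: "?z1 @\<^sub>v 0\<^sub>v md \<in> carrier_vec m"
    using append_carrier_vec[OF z1 zero_carrier_vec[of md]] by (simp only: md_le)
  note z02 = zero_append_carrier[OF z2]
  have "?z1 @\<^sub>v ?z2 = z" using z vec_first_last_append[of z "m - md" md] by (simp only: md_le)
  then have "z = (?z1 @\<^sub>v 0\<^sub>v md) + (0\<^sub>v (m - md) @\<^sub>v ?z2)"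
    by (simp only: append_vec_add[OF z1 zero_carrier_vec zero_carrier_vec z2] left_zero_vec[OF z2] right_zero_vec[OF z1])
  moreover have "u = B x *\<^sub>v z"
    unfolding z_def using mat_inverse_spec(3)[OF G \<Gamma>i_nonsingular[rule_format, OF x]] assoc_mult_mat_vec[OF Bc G u] u by simp
  ultimately have "u = B x *\<^sub>v (?z1 @\<^sub>v 0\<^sub>v md) + B x *\<^sub>v (0\<^sub>v (m - md) @\<^sub>v ?z2)"
    using mult_add_distrib_mat_vec[OF Bc z10 z02] by simp
  then have "g x *\<^sub>v u = g x *\<^sub>v (B x *\<^sub>v (?z1 @\<^sub>v 0\<^sub>v md)) + g x *\<^sub>v (B x *\<^sub>v (0\<^sub>v (m - md) @\<^sub>v ?z2))"
    using mult_add_distrib_mat_vec[OF gc mult_mat_vec_carrier[OF Bc z10] mult_mat_vec_carrier[OF Bc z02]] by (simp only:)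
  moreover have "(g x * (B x * E2)) *\<^sub>v ?z1 = g x *\<^sub>v (B x *\<^sub>v (?z1 @\<^sub>v 0\<^sub>v md))"
    by (simp only: assoc_mult_mat_vec[OF gc mult_carrier_mat[OF Bc E2_carrier] z1] assoc_mult_mat_vec[OF Bc E2_carrier z1] E2_mult[OF z1])
  ultimately show ?thesis by (simp only: gd_mult[OF x z2])
qed

lemma xi_col_index: "t < length pair_list \<Longrightarrow> xi_col q \<xi> x $ t = \<xi>s t x"
  by (simp add: xi_col_eq vec_of_list_index \<xi>s_def split: prod.split)

text \<open>The differentials of the chain coordinates are independent at 0, a point that
  \<open>U\<close> contains, so there are at most as many as state dimensions. This makes the
  dimension of \<eta> a true difference.\<close>

lemma nd_le:
  "nd \<le> CARD('n)"
proof -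
  note x = zero_U
  have "linear (frechet_derivative (\<xi>s t) (at 0))" if "t < length pair_list" for t
    by (rule has_derivative_linear[OF smooth_on_has_derivative[OF xis_smooth[OF that] x]])
  from dim_common_kernel(2)[OF this xis_surjective[OF assumption_B[rule_format, OF x] x]]
  show ?thesis by (simp add: length_pair_list)
qed

text \<open>The Jacobian of \<eta> kills the columns of \<open>gd\<close>, so the u_d part of the
  split input drops out and only u_e acts on \<eta>.\<close>

lemma internal_dynamics:
  assumes V: "open V" "V \<subseteq> U" and \<eta>: "smooth_vec V d \<eta>" and x: "x \<in> V" and u: "u \<in> carrier_vec m"
    and 0: "\<And>i. i < md \<Longrightarrow> jacobian_mat \<eta> x *\<^sub>v X i x = 0\<^sub>v d"
  shows "jacobian_mat \<eta> x *\<^sub>v (f x + g x *\<^sub>v u)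
    = jacobian_mat \<eta> x *\<^sub>v f x + (jacobian_mat \<eta> x * (g x * (B x * E2))) *\<^sub>v vec_first (\<Gamma>i x *\<^sub>v u) (m - md)"
proof -
  have xU: "x \<in> U" using x V by blast
  let ?J = "jacobian_mat \<eta> x" and ?z1 = "vec_first (\<Gamma>i x *\<^sub>v u) (m - md)" and ?z2 = "vec_last (\<Gamma>i x *\<^sub>v u) md"
  have J: "?J \<in> carrier_mat d CARD('n)" by (rule jacobian_mat_carrier[where \<Theta> = \<eta>, OF smooth_vecD(1)[OF \<eta> x]])
  have z1: "?z1 \<in> carrier_vec (m - md)" and z2: "?z2 \<in> carrier_vec md" by (simp_all add: vec_first_def vec_last_def)
  have M: "g x * (B x * E2) \<in> carrier_mat CARD('n) (m - md)"
    by (rule mult_carrier_mat[OF g_carrier[OF xU] mult_carrier_mat[OF B_carrier[OF xU] E2_carrier]])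
  note Mz = mult_mat_vec_carrier[OF M z1] and gz = mult_mat_vec_carrier[OF gd_carrier[OF xU] z2]
  have "?J * gd x = 0\<^sub>m d md"
  proof (rule eq_matI)
    fix k i assume "k < dim_row (0\<^sub>m d md :: real Matrix.mat)" "i < dim_col (0\<^sub>m d md :: real Matrix.mat)"
    then have k: "k < d" and i: "i < md" by simp_all
    show "(?J * gd x) $$ (k, i) = 0\<^sub>m d md $$ (k, i)"
      using arg_cong[OF 0[OF i], of "\<lambda>w. w $ k"] k i carrier_matD[OF J] carrier_matD[OF gd_carrier[OF xU]] by simp
  qed (use carrier_matD[OF J] carrier_matD[OF gd_carrier[OF xU]] in simp_all)
  then have Jg: "?J *\<^sub>v (gd x *\<^sub>v ?z2) = 0\<^sub>v d"
    by (simp only: assoc_mult_mat_vec[OF J gd_carrier[OF xU] z2, symmetric] zero_mat_mult_vec[OF z2])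
  have "?J *\<^sub>v (f x + g x *\<^sub>v u) = ?J *\<^sub>v f x + (?J *\<^sub>v ((g x * (B x * E2)) *\<^sub>v ?z1) + ?J *\<^sub>v (gd x *\<^sub>v ?z2))"
    unfolding input_split[OF xU u]
    by (simp only: mult_add_distrib_mat_vec[OF J f_carrier[OF xU] add_carrier_vec[OF Mz gz]] mult_add_distrib_mat_vec[OF J Mz gz])
  also have "?J *\<^sub>v ((g x * (B x * E2)) *\<^sub>v ?z1) + ?J *\<^sub>v (gd x *\<^sub>v ?z2) = (?J * (g x * (B x * E2))) *\<^sub>v ?z1"
    unfolding Jg right_zero_vec[OF mult_mat_vec_carrier[OF J Mz]] by (rule assoc_mult_mat_vec[OF J M z1, symmetric])
  finally show ?thesis .
qed

lemma local_coordinates: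
  assumes x0: "x0 \<in> U"
  shows "\<exists>V \<eta>. open V \<and> x0 \<in> V \<and> V \<subseteq> U \<and> smooth_vec V (CARD('n) - nd) \<eta> \<and>
    diffeomorphic_coordinates V (\<lambda>x. \<eta> x @\<^sub>v xi_col q \<xi> x) \<and>
    (\<forall>i<md. \<forall>x\<in>V. jacobian_mat \<eta> x *\<^sub>v X i x = 0\<^sub>v (CARD('n) - nd))"
proof (rule adapted_coordinates[where U = U and ?x0.0 = x0 and X = "\<lambda>i z. point_of (X i z)" and d = md
      and \<omega> = "\<lambda>i. \<xi> (i + 1) (blk (i + 1))" and \<xi> = \<xi>s and N = "length pair_list"], goal_cases)
  case 1 show ?case by (rule open_U)
next
  case 2 show ?case by (rule x0)
next
  case (3 i) then show ?case by (rule smooth_on_point_of[OF open_U X_smooth])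
next
  case (4 i)
  then have i: "i + 1 \<in> {1..md}" by simp
  show ?case by (rule xi_smooth[OF i]) (use blk_off(1)[OF i] in simp)
next
  case (5 i j x) then show ?case by (intro X_dual)
next
  case (6 i j x) then show ?case by (intro X_commute)
next
  case (7 t) then show ?case by (rule xis_smooth)
next
  case (8 i)
  then have i: "i + 1 \<in> {1..md}" by simp
  show ?case by (rule xis_exists[OF i]) (use blk_off(1)[OF i] in simp)
next
  case (9 w) show ?case by (rule xis_surjective[OF assumption_B[rule_format, OF x0] x0])
next
  case (10 V \<eta>)
  note V = 10(1,2,3) and \<eta> = 10(4) and \<eta>X = 10(5) and F = 10(6)
  let ?d = "CARD('n) - length pair_list"
  define \<eta>' where "\<eta>' x = Matrix.vec ?d (\<lambda>k. \<eta> k x)" for x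
  have \<eta>'k: "(\<lambda>x. \<eta>' x $ k) = \<eta> k" if "k < ?d" for k using that by (simp add: \<eta>'_def)
  have \<eta>'s: "smooth_vec V ?d \<eta>'"
    unfolding smooth_vec_def
  proof (intro conjI ballI allI impI)
    show "\<eta>' x \<in> carrier_vec ?d" for x by (simp add: \<eta>'_def)
    show "smooth_on V (\<lambda>x. \<eta>' x $ k)" if "k < ?d" for k using \<eta>[OF that] by (simp only: \<eta>'k[OF that])
  qed
  have dim: "?d + length pair_list = CARD('n)" using nd_le by (simp add: length_pair_list)
  have c: "\<eta>' x @\<^sub>v xi_col q \<xi> x \<in> carrier_vec CARD('n)" for x
    using append_carrier_vec[of "\<eta>' x" ?d "xi_col q \<xi> x" "length pair_list"]
    by (simp only: dim) (simp add: \<eta>'_def xi_col_eq carrier_vecI)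
  have idx: "(\<eta>' x @\<^sub>v xi_col q \<xi> x) $ k = (if k < ?d then \<eta> k x else \<xi>s (k - ?d) x)" if k: "k < CARD('n)" for x k
  proof -
    have d: "dim_vec (\<eta>' x) = ?d" "dim_vec (xi_col q \<xi> x) = length pair_list"
      by (simp_all add: \<eta>'_def xi_col_eq)
    have "(\<eta>' x @\<^sub>v xi_col q \<xi> x) $ k = (if k < ?d then \<eta>' x $ k else xi_col q \<xi> x $ (k - ?d))"
      using index_append_vec(1)[of k "\<eta>' x" "xi_col q \<xi> x"] k unfolding d dim by blast
    moreover have "k - ?d < length pair_list" if "\<not> k < ?d" using that k dim by linarith
    ultimately show ?thesis by (simp add: \<eta>'_def xi_col_index)
  qed
  have diff: "diffeomorphic_coordinates V (\<lambda>x. \<eta>' x @\<^sub>v xi_col q \<xi> x)"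
    unfolding diffeomorphic_coordinates_def Let_def
  proof
    show "smooth_vec V CARD('n) (\<lambda>x. \<eta>' x @\<^sub>v xi_col q \<xi> x)"
      unfolding smooth_vec_def
    proof (intro conjI ballI allI impI c)
      fix k assume k: "k < CARD('n)"
      have "smooth_on V (if k < ?d then \<eta> k else \<xi>s (k - ?d))"
      proof (cases "k < ?d")
        case True
        then show ?thesis using \<eta>[OF True] by (simp only: if_True)
      next
        case False
        then have "k - ?d < length pair_list" using k dim by linarith
        from smooth_on_subset[OF open_U xis_smooth[OF this] V(1,3)] False show ?thesis by (simp only: if_False)
      qed
      then show "smooth_on V (\<lambda>x. (\<eta>' x @\<^sub>v xi_col q \<xi> x) $ k)"
        by (rule smooth_on_cong[OF V(1)]) (simp add: idx[OF k])
    qed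
    show "open ((\<lambda>x. point_of (\<eta>' x @\<^sub>v xi_col q \<xi> x) :: real^'n) ` V) \<and>
      (\<exists>G. smooth_on ((\<lambda>x. point_of (\<eta>' x @\<^sub>v xi_col q \<xi> x) :: real^'n) ` V) G \<and>
         (\<forall>x\<in>V. G (point_of (\<eta>' x @\<^sub>v xi_col q \<xi> x)) = x))"
      by (rule F) (simp add: point_of_def idx[OF to_nat_on_less_CARD] Let_def)
  qed
  have J0: "jacobian_mat \<eta>' x *\<^sub>v X i x = 0\<^sub>v ?d" if i: "i < md" and x: "x \<in> V" for i x
  proof (rule eq_vecI)
    fix k assume "k < dim_vec (0\<^sub>v ?d :: real Matrix.vec)"
    then have k: "k < ?d" by simp
    have xU: "x \<in> U" using x V(3) by blast
    have "(jacobian_mat \<eta>' x *\<^sub>v X i x) $ k = frechet_derivative (\<lambda>z. \<eta>' z $ k) (at x) (point_of (X i x))"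
      by (rule jacobian_mult_index[where \<Theta> = \<eta>', OF smooth_vecD(1)[OF \<eta>'s x] k
          smooth_on_differentiable[OF smooth_vecD(2)[OF \<eta>'s k] x] smooth_vecD(1)[OF X_smooth[OF i] xU]])
    then show "(jacobian_mat \<eta>' x *\<^sub>v X i x) $ k = 0\<^sub>v ?d $ k" using k by (simp only: \<eta>'k[OF k] \<eta>X[OF k i x] index_zero_vec)
  qed (simp add: jacobian_mat_def \<eta>'_def)
  show ?case
    unfolding length_pair_list[symmetric]
    by (intro exI[of _ V] exI[of _ \<eta>'] conjI V \<eta>'s diff allI impI ballI J0)
qed

lemma local_normal_form:
  assumes x0: "x0 \<in> U"
  shows "\<exists>V \<eta> fe ge \<phi>.
    open V \<and> x0 \<in> V \<and> V \<subseteq> U \<and>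
    smooth_vec V (CARD('n) - nd) \<eta> \<and>
    diffeomorphic_coordinates V (\<lambda>x. \<eta> x @\<^sub>v xi_col q \<xi> x) \<and>
    smooth_vec V (CARD('n) - nd) fe \<and>
    smooth_mat V (CARD('n) - nd) (m - md) ge \<and>
    (\<forall>l\<in>{1..md}. smooth_vec V (CARD('n) - nd) (\<phi> l)) \<and>
    (\<forall>x\<in>V. \<forall>u\<in>carrier_vec m.
       jacobian_mat \<eta> x *\<^sub>v (f x + g x *\<^sub>v u) =
         fe x + ge x *\<^sub>v vec_first (\<Gamma>i x *\<^sub>v u) (m - md)
           + finsum_vec TYPE(real) (CARD('n) - nd) (\<lambda>l. v l x u \<cdot>\<^sub>v \<phi> l x) {1..md}) \<and>
    (\<forall>l\<in>{1..md}. \<forall>x\<in>V. \<phi> l x = 0\<^sub>v (CARD('n) - nd))"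
proof -
  let ?d = "CARD('n) - nd"
  obtain V and \<eta> :: "real^'n \<Rightarrow> real Matrix.vec" where V: "open V" "x0 \<in> V" "V \<subseteq> U" and \<eta>: "smooth_vec V ?d \<eta>"
    and diff: "diffeomorphic_coordinates V (\<lambda>x. \<eta> x @\<^sub>v xi_col q \<xi> x)"
    and \<eta>X: "\<And>i x. i < md \<Longrightarrow> x \<in> V \<Longrightarrow> jacobian_mat \<eta> x *\<^sub>v X i x = 0\<^sub>v ?d"
    using local_coordinates[OF x0] by blast
  \<comment> \<open>As u_d leaves no trace in the dynamics of \<eta>, nothing has to be re-expressed
    through v_d: \<phi> is zero, and the drift is just the derivative of \<eta> along
    \<open>f\<close>.\<close>
  let ?fe = "\<lambda>x. jacobian_mat \<eta> x *\<^sub>v f x" and ?ge = "\<lambda>x. jacobian_mat \<eta> x * (g x * (B x * E2))"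
    and ?\<phi> = "\<lambda>(l::nat) (x::real^'n). 0\<^sub>v ?d :: real Matrix.vec"
  note J = smooth_mat_jacobian[OF V(1) \<eta>]
  have fe: "smooth_vec V ?d ?fe"
    by (rule smooth_mat_mult_vec[OF V(1) J smooth_vec_subset[OF open_U smooth_f V(1,3)]])
  have ge: "smooth_mat V ?d (m - md) ?ge"
    by (rule smooth_mat_mult[OF V(1) J smooth_mat_subset[OF open_U
        smooth_mat_mult[OF open_U smooth_g smooth_mat_mult[OF open_U B_smooth smooth_mat_const[OF open_U E2_carrier]]] V(1,3)]])
  have "jacobian_mat \<eta> x *\<^sub>v (f x + g x *\<^sub>v u) =
         ?fe x + ?ge x *\<^sub>v vec_first (\<Gamma>i x *\<^sub>v u) (m - md)
           + finsum_vec TYPE(real) ?d (\<lambda>l. v l x u \<cdot>\<^sub>v ?\<phi> l x) {1..md}"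
    if x: "x \<in> V" and u: "u \<in> carrier_vec m" for x u
  proof -
    have "finsum_vec TYPE(real) ?d (\<lambda>l. v l x u \<cdot>\<^sub>v ?\<phi> l x) {1..md} = 0\<^sub>v ?d"
      using finsum_vec_carrier[of "\<lambda>l. v l x u \<cdot>\<^sub>v ?\<phi> l x" "{1..md}" ?d]
      by (intro eq_vecI) (auto simp: index_finsum_vec)
    moreover have "?fe x + ?ge x *\<^sub>v vec_first (\<Gamma>i x *\<^sub>v u) (m - md) \<in> carrier_vec ?d"
      by (intro add_carrier_vec smooth_vecD(1)[OF fe x] mult_mat_vec_carrier[OF smooth_matD(1)[OF ge x]])
        (simp add: vec_first_def)
    ultimately show ?thesis using internal_dynamics[OF V(1,3) \<eta> x u \<eta>X[OF _ x]] by simp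
  qed
  then show ?thesis
    using V \<eta> diff fe ge
    by (intro exI[of _ V] exI[of _ \<eta>] exI[of _ ?fe] exI[of _ ?ge] exI[of _ ?\<phi>])
      (auto simp: smooth_vec_def smooth_on_const)
qed

end

text \<open>Local and global data are separated: one choice of \<xi>, v, \<delta> and of the
  transformations serves all of \<open>U\<close>, and only \<eta> with its coefficients is chosen
  anew around each point \<open>x0\<close>, completing the same \<xi> to coordinates there.\<close>

theorem theorem3p2p2:
  fixes U :: "(real^'n) set" and m p md nd kstar :: nat
    and f h :: "real^'n \<Rightarrow> real Matrix.vec" and g :: "real^'n \<Rightarrow> real Matrix.mat"
    and \<rho> :: "nat \<Rightarrow> nat" and q :: "nat list" and R S :: "nat \<Rightarrow> real Matrix.mat"
    and P :: "nat \<Rightarrow> nat \<Rightarrow> real^'n \<Rightarrow> real Matrix.mat"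
    and \<Theta> \<Omega> :: "nat \<Rightarrow> real^'n \<Rightarrow> real Matrix.vec"
    and \<Gamma>ie \<Gamma>i gd :: "real^'n \<Rightarrow> real Matrix.mat"
  assumes system: "affine_system U m p f g h"
    and regular: "regular_algorithm_run U m p f g h \<rho> R S P \<Theta> \<Omega> kstar"
    and md: "md = \<rho> kstar"
    and nd: "nd = inf_zero_dim \<rho> kstar"
    and q: "q = inf_zero_list \<rho> kstar"
    and assumption_B: "\<forall>x\<in>U. full_row_rank (jacobian_mat (Phi_d_bar p \<rho> R S \<Theta> kstar) x)"
    and \<Gamma>ie: "smooth_mat U (m - md) m \<Gamma>ie"
    and \<Gamma>i: "\<forall>x. \<Gamma>i x = \<Gamma>ie x @\<^sub>r lie_mat g (\<Omega> kstar) x"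
    and \<Gamma>i_nonsingular: "\<forall>x\<in>U. invertible_mat (\<Gamma>i x)"
    and gd: "\<forall>x. gd x = g x * (the (mat_inverse (\<Gamma>i x)) * (0\<^sub>m (m - md) md @\<^sub>r 1\<^sub>m md))"
    and involutive: "involutive_on U (column_distribution gd)"
  shows "\<exists>\<Gamma>o \<xi> he a b v \<delta>.
     \<comment> \<open>input and output transformations\<close>
     smooth_mat U m m \<Gamma>i \<and> (\<forall>x\<in>U. invertible_mat (\<Gamma>i x)) \<and>
     \<Gamma>o \<in> carrier_mat p p \<and> invertible_mat \<Gamma>o \<and>
     \<comment> \<open>coefficient functions on \<open>U\<close>\<close>
     smooth_vec U (p - md) he \<and>
     smooth_vec U md a \<and> smooth_mat U md m b \<and> (\<forall>x\<in>U. full_row_rank (b x)) \<and>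
     (\<forall>i x u. v i x u = (a x + b x *\<^sub>v u) $ (i - 1)) \<and>
     (\<forall>i\<in>{1..md}. \<forall>j\<in>{1..<q ! (i - 1)}. \<forall>l\<in>{1..<i}.
        smooth_on U (\<delta> i j l) \<and> (j < q ! (l - 1) \<longrightarrow> (\<forall>x\<in>U. \<delta> i j l x = 0))) \<and>
     \<comment> \<open>the coordinates \<open>\<xi>\<close> and their dynamics on \<open>U\<close>\<close>
     (\<forall>i\<in>{1..md}. \<forall>j\<in>{1..q ! (i - 1)}. smooth_on U (\<xi> i j)) \<and>
     (\<forall>x\<in>U. \<forall>u\<in>carrier_vec m. \<forall>i\<in>{1..md}.
        (\<forall>j\<in>{1..<q ! (i - 1)}.
           gradient (\<xi> i j) x \<bullet> (f x + g x *\<^sub>v u) =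
             \<xi> i (j + 1) x + (\<Sum>l\<in>{1..<i}. \<delta> i j l x * v l x u)) \<and>
        gradient (\<xi> i (q ! (i - 1))) x \<bullet> (f x + g x *\<^sub>v u) = v i x u) \<and>
     \<comment> \<open>the output \<open>col {y\<^sub>e, y\<^sub>d}\<close>\<close>
     (\<forall>x\<in>U. \<Gamma>o *\<^sub>v h x = he x @\<^sub>v Matrix.vec md (\<lambda>i. \<xi> (i + 1) 1 x)) \<and>
     \<comment> \<open>around every point of \<open>U\<close>: coordinates \<open>col {\<eta>, \<xi>}\<close> and the dynamics of \<open>\<eta>\<close>\<close>
     (\<forall>x0\<in>U. \<exists>V \<eta> fe ge \<phi>.
        open V \<and> x0 \<in> V \<and> V \<subseteq> U \<and>
        smooth_vec V (CARD('n) - nd) \<eta> \<and>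
        diffeomorphic_coordinates V (\<lambda>x. \<eta> x @\<^sub>v xi_col q \<xi> x) \<and>
        smooth_vec V (CARD('n) - nd) fe \<and>
        smooth_mat V (CARD('n) - nd) (m - md) ge \<and>
        (\<forall>l\<in>{1..md}. smooth_vec V (CARD('n) - nd) (\<phi> l)) \<and>
        (\<forall>x\<in>V. \<forall>u\<in>carrier_vec m.
           jacobian_mat \<eta> x *\<^sub>v (f x + g x *\<^sub>v u) =
             fe x + ge x *\<^sub>v vec_first (\<Gamma>i x *\<^sub>v u) (m - md)
               + finsum_vec TYPE(real) (CARD('n) - nd) (\<lambda>l. v l x u \<cdot>\<^sub>v \<phi> l x) {1..md}) \<and>
        (\<forall>l\<in>{1..md}. \<forall>x\<in>V. \<phi> l x = 0\<^sub>v (CARD('n) - nd)))"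
proof -
  interpret decoupled_run U m p f h g \<rho> R S P \<Theta> \<Omega> kstar \<Gamma>ie \<Gamma>i gd
    by unfold_locales (fact system regular assumption_B \<Gamma>ie[unfolded md] \<Gamma>i \<Gamma>i_nonsingular gd[unfolded md] involutive)+
  have v: "\<forall>i x u. v i x u = (lie_vec f (\<Omega> kstar) x + lie_mat g (\<Omega> kstar) x *\<^sub>v u) $ (i - 1)"
    by (simp only: v_def) blast
  \<comment> \<open>As \<open>blk l\<close> is the length of chain l, the condition on j selects the
    zero branch in the definition of \<open>\<delta>\<close>.\<close>
  have \<delta>: "smooth_on U (\<delta> i j l) \<and> (j < blk l \<longrightarrow> (\<forall>x\<in>U. \<delta> i j l x = 0))"
    if "i \<in> {1..\<rho> kstar}" "j \<in> {1..<blk i}" "l \<in> {1..<i}" for i j l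
    using delta_smooth[OF that(1,2)] that(1,3) by (simp add: \<delta>_def)
  show ?thesis
    unfolding md nd q blk_def[symmetric]
    by (intro exI[of _ \<Gamma>o] exI[of _ \<xi>] exI[of _ "\<lambda>x. S_prod p \<rho> S kstar 1 *\<^sub>v h x"]
        exI[of _ "lie_vec f (\<Omega> kstar)"] exI[of _ "lie_mat g (\<Omega> kstar)"] exI[of _ v] exI[of _ \<delta>]
        conjI ballI Gamma_smooth \<Gamma>i_nonsingular[rule_format] Gamma_o_carrier Gamma_o_invertible he_smooth
        smooth_lie_vec[OF open_U smooth_f Omega_smooth] smooth_lie_mat[OF open_U smooth_g Omega_smooth]
        b_full_row_rank v \<delta> xi_smooth xi_dynamics xi_dynamics_last Gamma_o_output local_normal_form)
qed

end
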